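(* For a prime $p$ the following conditions are equivalent: (1) $p$ is a Mersenne prime; (2) $\mathrm{SL}(p+1,\mathbb{Q}(i))$ is minimal; (3) $\mathrm{ST}^+(p+1,\mathbb{Q}(i))$ is minimal.
   Context: All topological groups are Hausdorff. A Mersenne prime is a prime number of the form $2^q-1$ with $q$ prime (equivalently, a prime that is one less than a power of two). $\mathbb{Q}(i)\subset\mathbb{C}$ is the Gaussian rational field with the topology inherited from $\mathbb{C}$. For a topological field $\mathbb{F}$, $\mathrm{SL}(n,\mathbb{F})$ denotes the special linear group of degree $n$ over $\mathbb{F}$ with the topology inherited from $\mathbb{F}^{n^2}$, and $\mathrm{ST}^+(n,\mathbb{F})$ denotes its topological subgroup consisting of the upper triangular matrices. A topological group $G$ is minimal if every continuous group isomorphism $f\colon G\to H$ onto a (Hausdorff) topological group $H$ is a topological isomorphism; equivalently, if $G$ admits no strictly coarser Hausdorff group topology. *)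

theory Defs
  imports "HOL-Analysis.Analysis" "Jordan_Normal_Form.Determinant"
begin

section \<open>Minimal topological groups\<close>

definition topological_group :: "('a, 'm) monoid_scheme \<Rightarrow> 'a topology \<Rightarrow> bool" where
  "topological_group G T \<longleftrightarrow>
     group G \<and> topspace T = carrier G \<and> Hausdorff_space T \<and>
     continuous_map (prod_topology T T) T (\<lambda>(x, y). x \<otimes>\<^bsub>G\<^esub> y) \<and>
     continuous_map T T (\<lambda>x. inv\<^bsub>G\<^esub> x)"

text \<open>
  A definition cannot quantify over the element type of the target group, so \<open>H\<close> ranges over
  the groups with the same element type as \<open>G\<close>.  This is no restriction: a group isomorphic to \<open>G\<close>
  can be transported to the carrier of \<open>G\<close>
  (\<open>minimal_topological_group_homeomorphic_map\<close> below, where \<open>H\<close> has any element type).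
\<close>

definition minimal_topological_group :: "('a, 'm) monoid_scheme \<Rightarrow> 'a topology \<Rightarrow> bool" where
  "minimal_topological_group G T \<longleftrightarrow>
     topological_group G T \<and>
     (\<forall>(H :: 'a monoid) T' f.
        topological_group H T' \<and> f \<in> iso G H \<and> continuous_map T T' f
        \<longrightarrow> homeomorphic_map T T' f)"

lemma topological_group_transport:
  fixes G :: "('a, 'm) monoid_scheme" and H :: "('b, 'n) monoid_scheme" and K :: "'a monoid"
  assumes G: "group G" and H: "topological_group H T'" and f: "f \<in> iso G H"
  defines "K \<equiv> \<lparr>carrier = carrier G, mult = mult G, one = one G\<rparr>"
  defines "S \<equiv> pullback_topology (carrier G) f T'"
  shows "topological_group K S" "homeomorphic_map S T' f"
proof -
  have gH: "group H" and tsH: "topspace T' = carrier H" and hd: "Hausdorff_space T'"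
    and cm: "continuous_map (prod_topology T' T') T' (\<lambda>(x, y). x \<otimes>\<^bsub>H\<^esub> y)"
    and ci: "continuous_map T' T' (\<lambda>x. inv\<^bsub>H\<^esub> x)"
    using H unfolding topological_group_def by auto
  have hom: "f \<in> hom G H" and bij: "bij_betw f (carrier G) (carrier H)"
    using f unfolding iso_def by auto
  have fim: "f ` carrier G = carrier H" and inj: "inj_on f (carrier G)"
    using bij unfolding bij_betw_def by auto
  have ts: "topspace S = carrier G"
    using fim tsH unfolding S_def topspace_pullback_topology by auto
  have cf: "continuous_map S T' f"
    using continuous_map_pullback[of T' T' id "carrier G" f] unfolding S_def by simp
  have om: "open_map S T' f"
    unfolding open_map_def
  proof (intro allI impI)
    fix U assume "openin S U"
    then obtain V where V: "openin T' V" "U = f -` V \<inter> carrier G"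
      unfolding S_def openin_pullback_topology by auto
    have "f ` U = V"
      using V(2) openin_subset[OF V(1)] unfolding tsH fim[symmetric] by blast
    then show "openin T' (f ` U)" using V by simp
  qed
  show homeo: "homeomorphic_map S T' f"
    by (rule bijective_open_imp_homeomorphic_map[OF cf om]) (use ts tsH fim inj in auto)
  have mon: "group K"
    using G unfolding K_def group_def group_axioms_def monoid_def Units_def by auto
  have invK: "inv\<^bsub>K\<^esub> x = inv\<^bsub>G\<^esub> x" for x
    unfolding K_def m_inv_def by simp
  have hdS: "Hausdorff_space S"
    using homeo hd homeomorphic_Hausdorff_space homeomorphic_map_imp_homeomorphic_space by blast
  have pull: "continuous_map X S g"
    if "continuous_map X T' (f \<circ> g)" "\<And>x. x \<in> topspace X \<Longrightarrow> g x \<in> carrier G" for X g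
    unfolding S_def by (rule continuous_map_pullback') (use that in auto)
  have "continuous_map (prod_topology S S) T' ((\<lambda>(x, y). x \<otimes>\<^bsub>H\<^esub> y) \<circ> (\<lambda>(x, y). (f x, f y)))"
    by (rule continuous_map_compose[OF _ cm])
       (simp add: case_prod_unfold continuous_map_pairwise o_def
         continuous_map_compose[OF continuous_map_fst cf, unfolded o_def]
         continuous_map_compose[OF continuous_map_snd cf, unfolded o_def])
  then have "continuous_map (prod_topology S S) T' (f \<circ> (\<lambda>(x, y). x \<otimes>\<^bsub>G\<^esub> y))"
    by (rule continuous_map_eq) (auto simp: ts hom_mult[OF hom])
  then have 1: "continuous_map (prod_topology S S) S (\<lambda>(x, y). x \<otimes>\<^bsub>G\<^esub> y)"
    by (rule pull) (auto simp: ts G group.is_monoid monoid.m_closed)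
  have "continuous_map S T' ((\<lambda>x. inv\<^bsub>H\<^esub> x) \<circ> f)"
    by (rule continuous_map_compose[OF cf ci])
  then have "continuous_map S T' (f \<circ> (\<lambda>x. inv\<^bsub>G\<^esub> x))"
    by (rule continuous_map_eq)
       (use G gH hom in \<open>auto simp: ts group_hom.hom_inv group_hom_def group_hom_axioms_def\<close>)
  then have 2: "continuous_map S S (\<lambda>x. inv\<^bsub>G\<^esub> x)"
    by (rule pull) (auto simp: ts G)
  show "topological_group K S"
    unfolding topological_group_def invK
    using mon ts hdS 1 2 by (simp add: K_def)
qed

lemma minimal_topological_group_homeomorphic_map:
  fixes H :: "('b, 'n) monoid_scheme"
  assumes min: "minimal_topological_group G T"
    and H: "topological_group H T'" and f: "f \<in> iso G H" and cf: "continuous_map T T' f"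
  shows "homeomorphic_map T T' f"
proof -
  let ?K = "\<lparr>carrier = carrier G, mult = mult G, one = one G\<rparr>"
  let ?S = "pullback_topology (carrier G) f T'"
  have G: "group G" and ts: "topspace T = carrier G"
    using min unfolding minimal_topological_group_def topological_group_def by auto
  note tr = topological_group_transport[OF G H f]
  have "continuous_map T ?S id"
    by (rule continuous_map_pullback') (use cf ts in auto)
  moreover have "id \<in> iso G ?K"
    by (auto simp: iso_def hom_def group.is_monoid[OF G] monoid.m_closed)
  ultimately have "homeomorphic_map T ?S id"
    using min tr(1) unfolding minimal_topological_group_def by blast
  then show ?thesis using tr(2) by simp
qed

lemma minimal_topological_group_iff_no_coarser:
  "minimal_topological_group G T \<longleftrightarrow>
     topological_group G T \<and>
     (\<forall>S. topological_group G S \<and> (\<forall>U. openin S U \<longrightarrow> openin T U) \<longrightarrow> S = T)"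
proof (intro iffI conjI allI impI)
  assume min: "minimal_topological_group G T"
  then show tg: "topological_group G T" unfolding minimal_topological_group_def by simp
  fix S assume S: "topological_group G S \<and> (\<forall>U. openin S U \<longrightarrow> openin T U)"
  have ts: "topspace T = topspace S" using tg S unfolding topological_group_def by simp
  have "homeomorphic_map T S id"
    by (rule minimal_topological_group_homeomorphic_map[OF min])
       (use S ts topology_finer_continuous_id[of S T] in \<open>auto simp: iso_def hom_def\<close>)
  then show "S = T" by simp
next
  assume R: "topological_group G T \<and>
     (\<forall>S. topological_group G S \<and> (\<forall>U. openin S U \<longrightarrow> openin T U) \<longrightarrow> S = T)"
  then have G: "group G" and ts: "topspace T = carrier G" unfolding topological_group_def by auto
  show "minimal_topological_group G T"
    unfolding minimal_topological_group_def
  proof (intro conjI allI impI)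
    show "topological_group G T" using R by simp
    fix H :: "'a monoid" and T' f
    assume a: "topological_group H T' \<and> f \<in> iso G H \<and> continuous_map T T' f"
    let ?K = "\<lparr>carrier = carrier G, mult = mult G, one = one G\<rparr>"
    let ?S = "pullback_topology (carrier G) f T'"
    have tr: "topological_group ?K ?S" "homeomorphic_map ?S T' f"
      using topological_group_transport[OF G, of H T' f] a by auto
    have "m_inv ?K = m_inv G" by (simp add: m_inv_def fun_eq_iff)
    then have tgS: "topological_group G ?S"
      using tr(1) G unfolding topological_group_def by simp
    have "continuous_map T ?S id"
      by (rule continuous_map_pullback') (use a ts in auto)
    moreover have "topspace T = topspace ?S"
      using tgS ts unfolding topological_group_def by simp
    ultimately have "\<forall>U. openin ?S U \<longrightarrow> openin T U"
      using topology_finer_continuous_id[of ?S T] by auto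
    then show "homeomorphic_map T T' f" using R tgS tr(2) by auto
  qed
qed


section \<open>The groups $\mathrm{SL}(n,F)$ and $\mathrm{ST}^+(n,F)$\<close>

text \<open>
  The topological field \<open>F\<close> is given as a subset of an ambient field that carries a topology, and
  has the subspace topology.
\<close>

definition SL :: "nat \<Rightarrow> 'a::field set \<Rightarrow> 'a mat monoid" where
  "SL n F =
     \<lparr>carrier = {A \<in> carrier_mat n n. elements_mat A \<subseteq> F \<and> Determinant.det A = 1},
      mult = (*), one = 1\<^sub>m n\<rparr>"

definition STplus :: "nat \<Rightarrow> 'a::field set \<Rightarrow> 'a mat monoid" where
  "STplus n F = (SL n F)\<lparr>carrier := {A \<in> carrier (SL n F). upper_triangular A}\<rparr>"

text \<open>
  The entries of a matrix identify it with a point of $F^{n^2}$, that is, with an (extensional)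
  function on the index pairs.
\<close>

definition SL_topology :: "nat \<Rightarrow> 'a::{field, topological_space} set \<Rightarrow> 'a mat topology" where
  "SL_topology n F =
     pullback_topology (carrier (SL n F))
       (\<lambda>A. \<lambda>ij \<in> {..<n} \<times> {..<n}. A $$ ij)
       (product_topology (\<lambda>_. top_of_set F) ({..<n} \<times> {..<n}))"

definition STplus_topology :: "nat \<Rightarrow> 'a::{field, topological_space} set \<Rightarrow> 'a mat topology" where
  "STplus_topology n F = subtopology (SL_topology n F) (carrier (STplus n F))"

lemma topspace_SL_topology: "topspace (SL_topology n F) = carrier (SL n F)"
  by (force simp: SL_topology_def topspace_pullback_topology SL_def)

lemma topspace_STplus_topology: "topspace (STplus_topology n F) = carrier (STplus n F)"
  by (auto simp: STplus_topology_def topspace_SL_topology STplus_def)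


section \<open>Gaussian rationals and Mersenne primes\<close>

definition gaussian_rationals :: "complex set" where
  "gaussian_rationals = {z. Re z \<in> \<rat> \<and> Im z \<in> \<rat>}"

definition mersenne_prime :: "nat \<Rightarrow> bool" where
  "mersenne_prime p \<longleftrightarrow> prime p \<and> (\<exists>q. prime q \<and> p = 2 ^ q - 1)"

end

theory Submission
  imports Defs
begin

text \<open>
  For a prime \<open>p\<close>, being a Mersenne prime means that \<open>n = p + 1\<close> is a power of two.  The scalar
  matrices in \<open>SL(n, \<complex>)\<close> are given by the \<open>n\<close>-th roots of unity, and minimality of \<open>SL(n, F)\<close> and
  \<open>ST\<^sup>+(n, F)\<close> for \<open>F = \<rat>(\<i>)\<close> turns on whether every nontrivial group of \<open>n\<close>-th roots of unity meets \<open>F\<close>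
  nontrivially.  If \<open>n\<close> is a power of two, every such group contains \<open>-1\<close>.  If \<open>n\<close> has an odd divisor
  \<open>r > 1\<close>, the group of \<open>r\<close>-th roots of unity meets \<open>F\<close> only in \<open>1\<close>
  (\<open>gaussian_rational_root_of_unity_odd\<close>).

  In the second case, passing from \<open>SL(n, \<complex>)\<close> to its quotient by the scalar matrices of order dividing
  \<open>r\<close> is injective on either group and gives it a Hausdorff group topology.  That topology is strictly
  coarser, since \<open>F\<close> is dense in \<open>\<complex>\<close> and therefore the group accumulates at all these scalar matrices
  (\<open>not_minimal_if_closure_meets_finite_central_subgroup\<close>, \<open>not_minimal_if_missing_roots_of_unity\<close>).

  In the first case, let \<open>S\<close> be a coarser Hausdorff group topology and \<open>g\<close> a net that tends to the
  identity in \<open>S\<close>; it has to converge entrywise.  This holds on each root subgroup, that is, for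
  elementary matrices \<open>E\<^sub>i\<^sub>j(x)\<close>, thanks to the action of the torus
  (\<open>tendsto_0_if_limitin_elem_mat\<close>).  For general \<open>g\<close>, one forms iterated commutators of \<open>g E\<^sub>j\<^sub>k(1) g\<^sup>-\<^sup>1\<close>
  with elements that may depend on \<open>g\<close> but stay bounded, in such a way that the result lies in a root
  subgroup and its coordinate is a product of an entry of \<open>g\<close> and one of \<open>g\<^sup>-\<^sup>1\<close>.  In \<open>S\<close>, the result
  has the same limit as the word with \<open>g\<close> replaced by the identity, so that the coordinate converges.
  For \<open>SL(n, F)\<close> with \<open>n \<ge> 4\<close> (\<open>null_entries_all_roots\<close>), and up to the corner entry for \<open>ST\<^sup>+(n, F)\<close>
  (\<open>null_entries_off_corner\<close>), this shows that \<open>c g\<close> tends to the identity entrywise for suitable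
  scalars \<open>c\<close>; the corner is then reached by commutators with the torus (\<open>entries_of_null_upper\<close>).
  Taking determinants, \<open>c\<^sup>n\<close> tends to \<open>1\<close>.  As \<open>n\<close> is a power of two, one can take square roots
  repeatedly.  At each step the limit \<open>-1\<close> is impossible, because a power of \<open>g\<close> would then tend to \<open>-I\<close>
  entrywise and hence in \<open>S\<close>, where it tends to \<open>I\<close> (\<open>scalar_tendsto_1\<close>).  So \<open>c\<close> tends to \<open>1\<close>.
\<close>

section \<open>Subgroups of topological groups, and a criterion against minimality\<close>

lemma topological_group_subgroup:
  assumes L: "topological_group L T" and H: "subgroup H L"
  shows "topological_group (L\<lparr>carrier := H\<rparr>) (subtopology T H)"
proof -
  have G: "group L" and ts: "topspace T = carrier L" and hd: "Hausdorff_space T"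
    and cm: "continuous_map (prod_topology T T) T (\<lambda>(x, y). x \<otimes>\<^bsub>L\<^esub> y)"
    and ci: "continuous_map T T (\<lambda>x. inv\<^bsub>L\<^esub> x)"
    using L unfolding topological_group_def by auto
  have sub: "H \<subseteq> carrier L" using H by (rule subgroup.subset)
  have "continuous_map (subtopology (prod_topology T T) (H \<times> H)) (subtopology T H)
      (\<lambda>(x, y). x \<otimes>\<^bsub>L\<^esub> y)"
    using continuous_map_from_subtopology[OF cm] H
    by (auto simp: continuous_map_in_subtopology subgroup.m_closed)
  moreover have "continuous_map (subtopology T H) (subtopology T H)
      (\<lambda>x. inv\<^bsub>L\<lparr>carrier := H\<rparr>\<^esub> x)"
  proof (rule continuous_map_eq)
    show "continuous_map (subtopology T H) (subtopology T H) (\<lambda>x. inv\<^bsub>L\<^esub> x)"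
      using continuous_map_from_subtopology[OF ci] H
      by (auto simp: continuous_map_in_subtopology subgroup.m_inv_closed)
  qed (use group.m_inv_consistent[OF G H] in auto)
  ultimately show ?thesis
    using sub ts hd group.subgroup_imp_group[OF G H]
    by (simp add: topological_group_def subtopology_Times Hausdorff_space_subtopology Int_absorb1)
qed

text \<open>
  Passing to the quotient \<open>L / Z\<close> is injective on \<open>H\<close> and therefore induces a Hausdorff group
  topology on \<open>H\<close>: its open sets are the traces of the \<open>Z\<close>-invariant open subsets of \<open>L\<close>.
  It is strictly coarser than the original one, because \<open>H\<close> accumulates at \<open>z\<close>, and the quotient
  cannot tell \<open>z\<close> from the identity.
\<close>

lemma not_minimal_if_closure_meets_finite_central_subgroup:
  fixes L :: "('a, 'm) monoid_scheme" (structure)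
  assumes L: "topological_group L T" and H: "subgroup H L" and Z: "subgroup Z L"
    and fin: "finite Z"
    and central: "\<And>z x. z \<in> Z \<Longrightarrow> x \<in> carrier L \<Longrightarrow> z \<otimes> x = x \<otimes> z"
    and HZ: "H \<inter> Z = {\<one>}"
    and z: "z \<in> Z" "z \<noteq> \<one>" "z \<in> T closure_of H"
  shows "\<not> minimal_topological_group (L\<lparr>carrier := H\<rparr>) (subtopology T H)"
proof
  assume min: "minimal_topological_group (L\<lparr>carrier := H\<rparr>) (subtopology T H)"
  have G: "group L" and ts: "topspace T = carrier L" and hd: "Hausdorff_space T"
    and cm: "continuous_map (prod_topology T T) T (\<lambda>(x, y). x \<otimes> y)"
    and ci: "continuous_map T T (\<lambda>x. inv x)"
    using L unfolding topological_group_def by auto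
  interpret group L by (rule G)
  have HL: "\<And>x. x \<in> H \<Longrightarrow> x \<in> carrier L" and ZL: "\<And>x. x \<in> Z \<Longrightarrow> x \<in> carrier L"
    using subgroup.subset[OF H] subgroup.subset[OF Z] by auto
  note Hm = subgroup.m_closed[OF H] and Hi = subgroup.m_inv_closed[OF H]
  note Zm = subgroup.m_closed[OF Z] and Zi = subgroup.m_inv_closed[OF Z] and Z1 = subgroup.one_closed[OF Z]
  have tr: "continuous_map T T (\<lambda>x. a \<otimes> x)" if "a \<in> carrier L" for a
  proof -
    have "continuous_map T (prod_topology T T) (\<lambda>x. (a, x))"
      using that ts by (simp add: continuous_map_pairwise o_def)
    from continuous_map_compose[OF this cm] show ?thesis by (simp add: o_def)
  qed
  have tr_open: "openin T ((\<lambda>x. a \<otimes> x) ` V)" if a: "a \<in> carrier L" and V: "openin T V" for a V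
  proof -
    have VL: "V \<subseteq> carrier L" using openin_subset[OF V] ts by simp
    have "(\<lambda>x. a \<otimes> x) ` V = {x \<in> topspace T. inv a \<otimes> x \<in> V}"
    proof (intro equalityI subsetI)
      fix x assume "x \<in> {x \<in> topspace T. inv a \<otimes> x \<in> V}"
      then show "x \<in> (\<lambda>x. a \<otimes> x) ` V"
        using a ts by (intro image_eqI[of _ _ "inv a \<otimes> x"]) (auto simp: m_assoc[symmetric])
    next
      fix x assume "x \<in> (\<lambda>x. a \<otimes> x) ` V"
      then show "x \<in> {x \<in> topspace T. inv a \<otimes> x \<in> V}"
        using a ts VL by (auto simp: m_assoc[symmetric] subset_iff)
    qed
    then show ?thesis using openin_continuous_map_preimage[OF tr V, of "inv a"] a by simp
  qed
  define invt where "invt V \<longleftrightarrow> openin T V \<and> (\<forall>z\<in>Z. \<forall>x\<in>V. z \<otimes> x \<in> V)" for V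
  define sat where "sat V = (\<Union>z\<in>Z. (\<lambda>x. z \<otimes> x) ` V)" for V
  have sat: "invt (sat V)" "V \<subseteq> sat V" if V: "openin T V" for V
  proof -
    have VL: "V \<subseteq> carrier L" using openin_subset[OF V] ts by simp
    show "V \<subseteq> sat V"
    proof
      fix x assume "x \<in> V"
      then have "x = \<one> \<otimes> x" using VL by auto
      then show "x \<in> sat V" unfolding sat_def using Z1 \<open>x \<in> V\<close> by blast
    qed
    show "invt (sat V)"
      unfolding invt_def sat_def
    proof (intro conjI ballI)
      show "openin T (\<Union>z\<in>Z. (\<lambda>x. z \<otimes> x) ` V)" using tr_open[OF ZL V] by (intro openin_Union) auto
    next
      fix a x assume "a \<in> Z" "x \<in> (\<Union>z\<in>Z. (\<lambda>x. z \<otimes> x) ` V)"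
      then obtain b y where b: "b \<in> Z" "y \<in> V" "x = b \<otimes> y" by blast
      have "y \<in> carrier L" using b(2) VL by blast
      then have "a \<otimes> x = (a \<otimes> b) \<otimes> y"
        unfolding b(3) by (rule m_assoc[OF ZL[OF \<open>a \<in> Z\<close>] ZL[OF b(1)], symmetric])
      then show "a \<otimes> x \<in> (\<Union>z\<in>Z. (\<lambda>x. z \<otimes> x) ` V)"
        by (rule UN_I[OF Zm[OF \<open>a \<in> Z\<close> b(1)] image_eqI[OF _ b(2)]])
    qed
  qed
  define S where "S = topology (\<lambda>U. \<exists>V. invt V \<and> U = V \<inter> H)"
  have "istopology (\<lambda>U. \<exists>V. invt V \<and> U = V \<inter> H)"
    unfolding istopology_def
  proof (intro conjI allI impI)
    fix U U' assume "\<exists>V. invt V \<and> U = V \<inter> H" "\<exists>V. invt V \<and> U' = V \<inter> H"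
    then obtain V V' where "invt V" "U = V \<inter> H" "invt V'" "U' = V' \<inter> H" by blast
    then show "\<exists>V. invt V \<and> U \<inter> U' = V \<inter> H"
      by (intro exI[of _ "V \<inter> V'"]) (auto simp: invt_def)
  next
    fix \<K> assume "\<forall>U\<in>\<K>. \<exists>V. invt V \<and> U = V \<inter> H"
    then obtain V where "\<forall>U\<in>\<K>. invt (V U) \<and> U = V U \<inter> H" by metis
    then show "\<exists>V. invt V \<and> \<Union> \<K> = V \<inter> H"
      by (intro exI[of _ "\<Union> (V ` \<K>)"]) (auto simp: invt_def, blast+)
  qed
  then have openS: "openin S U \<longleftrightarrow> (\<exists>V. invt V \<and> U = V \<inter> H)" for U
    unfolding S_def by (simp add: topology_inverse')
  have "invt (carrier L)" unfolding invt_def using ts openin_topspace[of T] ZL by auto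
  then have "openin S H" unfolding openS using HL by blast
  then have tsS: "topspace S = H"
    using openS[of "topspace S"] openin_subset[of S H] by auto
  have "topological_group (L\<lparr>carrier := H\<rparr>) S"
    unfolding topological_group_def
  proof (intro conjI)
    show "group (L\<lparr>carrier := H\<rparr>)" by (rule subgroup_imp_group[OF H])
    show "topspace S = carrier (L\<lparr>carrier := H\<rparr>)" using tsS by simp
    show "Hausdorff_space S"
      unfolding Hausdorff_space_def tsS
    proof (intro allI impI, elim conjE)
      fix a b assume ab: "a \<in> H" "b \<in> H" "a \<noteq> b"
      have "\<exists>P Q. openin T P \<and> openin T Q \<and> a \<in> P \<and> c \<otimes> b \<in> Q \<and> disjnt P Q"
        if c: "c \<in> Z" for c
      proof -
        have "a \<noteq> c \<otimes> b"
        proof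
          assume e: "a = c \<otimes> b"
          then have "c = a \<otimes> inv b" using ab c HL ZL by (simp add: m_assoc)
          then have "c \<in> H \<inter> Z" using Hm[OF ab(1) Hi[OF ab(2)]] c by simp
          then have "c = \<one>" using HZ by blast
          then show False using e ab HL by simp
        qed
        moreover have "a \<in> topspace T" "c \<otimes> b \<in> topspace T" using ab c ts HL ZL by auto
        ultimately show ?thesis using hd unfolding Hausdorff_space_def by blast
      qed
      then obtain P Q where PQ: "\<And>c. c \<in> Z \<Longrightarrow> openin T (P c) \<and> openin T (Q c) \<and>
          a \<in> P c \<and> c \<otimes> b \<in> Q c \<and> disjnt (P c) (Q c)" by metis
      \<comment> \<open>\<open>P'\<close> is disjoint from all translates of \<open>Q'\<close> by elements of the finite group \<open>Z\<close>\<close>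
      define P' where "P' = (\<Inter>c\<in>Z. P c)"
      define Q' where "Q' = (\<Inter>c\<in>Z. (\<lambda>x. inv c \<otimes> x) ` Q c)"
      have Zne: "Z \<noteq> {}" using z by auto
      have P': "openin T P'" "a \<in> P'"
        unfolding P'_def using PQ fin Zne by (auto intro!: openin_Inter)
      have Q': "openin T Q'" "b \<in> Q'"
      proof -
        show "openin T Q'"
          unfolding Q'_def using PQ fin Zne Zi ZL by (intro openin_Inter) (auto intro!: tr_open)
        have "b = inv c \<otimes> (c \<otimes> b)" if "c \<in> Z" for c
          using that ab HL ZL by (simp add: m_assoc[symmetric])
        then show "b \<in> Q'" unfolding Q'_def using PQ by blast
      qed
      have PL: "P' \<subseteq> carrier L" and QL: "Q' \<subseteq> carrier L"
        using P' Q' openin_subset ts by blast+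
      have PQc: "x \<noteq> c \<otimes> y" if x: "x \<in> P'" and y: "y \<in> Q'" and c: "c \<in> Z" for x y c
      proof
        assume e: "x = c \<otimes> y"
        obtain w where w: "w \<in> Q c" "y = inv c \<otimes> w" using y c unfolding Q'_def by blast
        then have wL: "w \<in> carrier L" using PQ[OF c] openin_subset ts by blast
        have "x = w" using e w wL ZL[OF c] by (simp add: m_assoc[symmetric])
        moreover have "x \<in> P c" using x c unfolding P'_def by blast
        ultimately show False using PQ[OF c] w(1) unfolding disjnt_def by blast
      qed
      have "disjnt (sat P') (sat Q')"
      proof -
        have False if "x \<in> P'" "y \<in> Q'" "c \<in> Z" "d \<in> Z" "c \<otimes> x = d \<otimes> y" for x y c d
        proof -
          have xy: "x \<in> carrier L" "y \<in> carrier L" using that PL QL by auto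
          have "x = inv c \<otimes> (c \<otimes> x)" using ZL[OF that(3)] xy by (simp add: m_assoc[symmetric])
          also have "\<dots> = (inv c \<otimes> d) \<otimes> y" using that ZL xy by (simp add: m_assoc)
          finally show False using PQc[of x y "inv c \<otimes> d"] that Zm[OF Zi] by blast
        qed
        then show ?thesis unfolding disjnt_def sat_def by blast
      qed
      then show "\<exists>U V. openin S U \<and> openin S V \<and> a \<in> U \<and> b \<in> V \<and> disjnt U V"
        using sat[OF P'(1)] sat[OF Q'(1)] P' Q' ab
        by (intro exI[of _ "sat P' \<inter> H"] exI[of _ "sat Q' \<inter> H"]) (auto simp: openS disjnt_def)
    qed
    show "continuous_map (prod_topology S S) S (\<lambda>(x, y). x \<otimes>\<^bsub>L\<lparr>carrier := H\<rparr>\<^esub> y)"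
      unfolding continuous_map_def
    proof (intro conjI allI impI)
      show "(\<lambda>(x, y). x \<otimes>\<^bsub>L\<lparr>carrier := H\<rparr>\<^esub> y) \<in> topspace (prod_topology S S) \<rightarrow> topspace S"
        using tsS Hm by auto
      fix U assume "openin S U"
      then obtain V where V: "invt V" "U = V \<inter> H" using openS by blast
      show "openin (prod_topology S S)
          {p \<in> topspace (prod_topology S S). (case p of (x, y) \<Rightarrow> x \<otimes>\<^bsub>L\<lparr>carrier := H\<rparr>\<^esub> y) \<in> U}"
        unfolding openin_prod_topology_alt
      proof (clarsimp simp: tsS)
        fix a b assume ab: "a \<in> H" "b \<in> H" "a \<otimes> b \<in> U"
        have "openin (prod_topology T T) {p \<in> topspace (prod_topology T T). (\<lambda>(x, y). x \<otimes> y) p \<in> V}"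
          using openin_continuous_map_preimage[OF cm] V unfolding invt_def by blast
        then have "\<exists>A B. openin T A \<and> openin T B \<and> a \<in> A \<and> b \<in> B \<and>
          A \<times> B \<subseteq> {p \<in> topspace (prod_topology T T). (\<lambda>(x, y). x \<otimes> y) p \<in> V}"
          unfolding openin_prod_topology_alt using ab V ts HL by auto
        then obtain A B where AB: "openin T A" "openin T B" "a \<in> A" "b \<in> B"
          "\<And>x y. x \<in> A \<Longrightarrow> y \<in> B \<Longrightarrow> x \<otimes> y \<in> V" by (auto simp: subset_iff)
        have AL: "A \<subseteq> carrier L" and BL: "B \<subseteq> carrier L"
          using AB openin_subset ts by blast+
        have "(c \<otimes> x) \<otimes> (d \<otimes> y) \<in> V" if "x \<in> A" "y \<in> B" "c \<in> Z" "d \<in> Z" for c d x y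
        proof -
          have xy: "x \<in> carrier L" "y \<in> carrier L" "c \<in> carrier L" "d \<in> carrier L"
            using that AL BL ZL by auto
          have "(c \<otimes> x) \<otimes> (d \<otimes> y) = (c \<otimes> d) \<otimes> (x \<otimes> y)"
            using xy central[OF that(4) xy(1)] by (metis m_assoc m_closed)
          then show ?thesis using AB(5)[OF that(1,2)] Zm[OF that(3,4)] V(1) unfolding invt_def by auto
        qed
        then have "sat A \<times> sat B \<subseteq> {p. fst p \<otimes> snd p \<in> V}"
          unfolding sat_def by auto
        then show "\<exists>A. openin S A \<and> (\<exists>B. openin S B \<and> a \<in> A \<and> b \<in> B \<and>
            A \<times> B \<subseteq> {p \<in> H \<times> H. (case p of (x, y) \<Rightarrow> x \<otimes> y) \<in> U})"
          using sat[OF AB(1)] sat[OF AB(2)] AB ab V(2) Hm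
          by (intro exI[of _ "sat A \<inter> H"] conjI exI[of _ "sat B \<inter> H"]) (auto simp: openS)
      qed
    qed
    show "continuous_map S S (\<lambda>x. inv\<^bsub>L\<lparr>carrier := H\<rparr>\<^esub> x)"
    proof (rule continuous_map_eq)
      show "continuous_map S S (\<lambda>x. inv x)"
        unfolding continuous_map_def
      proof (intro conjI allI impI)
        fix U assume "openin S U"
        then obtain V where V: "invt V" "U = V \<inter> H" using openS by blast
        let ?W = "{x \<in> topspace T. inv x \<in> V}"
        have "invt ?W"
          unfolding invt_def
        proof (intro conjI ballI)
          show "openin T ?W"
            using openin_continuous_map_preimage[OF ci] V unfolding invt_def by blast
          fix c x assume c: "c \<in> Z" and x: "x \<in> ?W"
          then have xL: "x \<in> carrier L" using ts by simp
          have "inv (c \<otimes> x) = inv c \<otimes> inv x"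
            using xL ZL[OF c] central[OF Zi[OF c], of "inv x"] by (simp add: inv_mult_group)
          moreover have "inv c \<otimes> inv x \<in> V" using V(1) Zi[OF c] x unfolding invt_def by auto
          ultimately show "c \<otimes> x \<in> ?W" using ZL[OF c] xL ts by simp
        qed
        moreover have "{x \<in> topspace S. inv x \<in> U} = ?W \<inter> H"
          using V ts tsS HL Hi by auto
        ultimately show "openin S {x \<in> topspace S. inv x \<in> U}" unfolding openS by blast
      qed (use tsS Hi in auto)
    qed (use m_inv_consistent[OF H] tsS in auto)
  qed
  moreover have "openin (subtopology T H) U" if "openin S U" for U
    using that unfolding openS openin_subtopology invt_def by blast
  ultimately have eq: "S = subtopology T H"
    using min unfolding minimal_topological_group_iff_no_coarser by blast
  have zL: "z \<in> carrier L" using z ZL by auto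
  obtain A B where AB: "openin T A" "openin T B" "\<one> \<in> A" "z \<in> B" "disjnt A B"
    using hd z zL ts unfolding Hausdorff_space_def by (metis one_closed)
  have "openin S (A \<inter> H)" unfolding eq openin_subtopology using AB by blast
  then obtain V where V: "invt V" "A \<inter> H = V \<inter> H" unfolding openS by blast
  have "\<one> \<in> V" using V AB subgroup.one_closed[OF H] by auto
  then have "z \<otimes> \<one> \<in> V" using V(1) z unfolding invt_def by blast
  then have "z \<in> V" using zL by simp
  then have "openin T (V \<inter> B)" "z \<in> V \<inter> B" using V(1) AB unfolding invt_def by auto
  then obtain h where "h \<in> H" "h \<in> V \<inter> B" using z(3) unfolding in_closure_of by blast
  then show False using V AB unfolding disjnt_def by blast
qed


section \<open>The topological groups $\mathrm{SL}(n,F)$ and $\mathrm{ST}^+(n,F)$\<close>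

definition subfield_set :: "'a::field set \<Rightarrow> bool" where
  "subfield_set F \<longleftrightarrow> 0 \<in> F \<and> 1 \<in> F \<and> (\<forall>x\<in>F. \<forall>y\<in>F. x + y \<in> F \<and> x * y \<in> F) \<and>
     (\<forall>x\<in>F. - x \<in> F \<and> inverse x \<in> F)"

lemma subfield_setD:
  assumes "subfield_set F"
  shows "0 \<in> F" "1 \<in> F" "x \<in> F \<Longrightarrow> y \<in> F \<Longrightarrow> x + y \<in> F" "x \<in> F \<Longrightarrow> y \<in> F \<Longrightarrow> x * y \<in> F"
    "x \<in> F \<Longrightarrow> - x \<in> F" "x \<in> F \<Longrightarrow> inverse x \<in> F" "x \<in> F \<Longrightarrow> y \<in> F \<Longrightarrow> x - y \<in> F"
    "x \<in> F \<Longrightarrow> y \<in> F \<Longrightarrow> x / y \<in> F"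
  using assms unfolding subfield_set_def
  by (auto simp: divide_inverse) (metis diff_conv_add_uminus)

lemma subfield_set_UNIV: "subfield_set UNIV"
  by (simp add: subfield_set_def)

lemma subfield_set_sum: "subfield_set F \<Longrightarrow> (\<And>i. i \<in> I \<Longrightarrow> f i \<in> F) \<Longrightarrow> sum f I \<in> F"
  by (induction I rule: infinite_finite_induct) (auto simp: subfield_setD)

lemma subfield_set_prod: "subfield_set F \<Longrightarrow> (\<And>i. i \<in> I \<Longrightarrow> f i \<in> F) \<Longrightarrow> prod f I \<in> F"
  by (induction I rule: infinite_finite_induct) (auto simp: subfield_setD)

lemma subfield_set_power: "subfield_set F \<Longrightarrow> x \<in> F \<Longrightarrow> x ^ k \<in> F"
  by (induction k) (auto simp: subfield_setD)

lemma carrier_SL: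
  "A \<in> carrier (SL n F) \<longleftrightarrow>
     A \<in> carrier_mat n n \<and> (\<forall>i<n. \<forall>j<n. A $$ (i, j) \<in> F) \<and> Determinant.det A = 1"
proof -
  have "elements_mat A \<subseteq> F \<longleftrightarrow> (\<forall>i<n. \<forall>j<n. A $$ (i, j) \<in> F)" if "A \<in> carrier_mat n n"
    using that by (auto elim!: elements_matD)
  then show ?thesis by (auto simp: SL_def)
qed

lemma carrier_STplus:
  "A \<in> carrier (STplus n F) \<longleftrightarrow> A \<in> carrier (SL n F) \<and> (\<forall>i<n. \<forall>j<i. A $$ (i, j) = 0)"
  by (auto simp: STplus_def carrier_SL)

lemma mat_mult_entry:
  fixes A B :: "'a::comm_ring_1 mat"
  assumes "A \<in> carrier_mat n n" "B \<in> carrier_mat n n" "i < n" "j < n"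
  shows "(A * B) $$ (i, j) = (\<Sum>k<n. A $$ (i, k) * B $$ (k, j))"
  using assms by (auto simp: scalar_prod_def atLeast0LessThan)

lemma permutes_lessThan: "p permutes {0..<n} \<Longrightarrow> i < n \<Longrightarrow> p i < (n::nat)"
  using permutes_in_image[of p "{0..<n}" i] by simp

lemma det_in_subfield:
  assumes F: "subfield_set F" and A: "\<And>i j. i < dim_row A \<Longrightarrow> j < dim_col A \<Longrightarrow> A $$ (i, j) \<in> F"
  shows "Determinant.det A \<in> F"
proof (cases "dim_row A = dim_col A")
  case True
  have s: "signof p \<in> F" for p :: "nat \<Rightarrow> nat" by (cases p rule: sign_cases)
      (auto simp: subfield_setD[OF F])
  show ?thesis
    unfolding Determinant.det_def using True
    by (auto intro!: subfield_set_sum[OF F] subfield_setD(4)[OF F] s subfield_set_prod[OF F] A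
        simp: permutes_lessThan)
qed (simp add: Determinant.det_def subfield_setD[OF F])

lemma adj_mat_in_subfield:
  assumes F: "subfield_set F" and A: "A \<in> carrier_mat n n" "\<And>i j. i < n \<Longrightarrow> j < n \<Longrightarrow> A $$ (i, j) \<in> F"
    and ij: "i < n" "j < n"
  shows "adj_mat A $$ (i, j) \<in> F"
proof -
  have "Determinant.det (mat_delete A j i) \<in> F"
    by (rule det_in_subfield[OF F]) (use A in \<open>auto simp: mat_delete_def\<close>)
  moreover have "(- 1) ^ (j + i) \<in> F" by (intro subfield_set_power subfield_setD F)
  ultimately show ?thesis
    using A(1) ij by (auto simp: adj_mat_def cofactor_def intro: subfield_setD[OF F])
qed

lemma adj_mat_SL:
  assumes F: "subfield_set F" and A: "A \<in> carrier (SL n F)"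
  shows "adj_mat A \<in> carrier (SL n F)" "adj_mat A * A = 1\<^sub>m n" "A * adj_mat A = 1\<^sub>m n"
proof -
  have c: "A \<in> carrier_mat n n" and d: "Determinant.det A = 1" using A by (auto simp: carrier_SL)
  show r: "adj_mat A * A = 1\<^sub>m n" "A * adj_mat A = 1\<^sub>m n"
    using adj_mat[OF c] by (auto simp: d)
  have "Determinant.det (adj_mat A) = 1"
    using det_mult[OF adj_mat(1)[OF c] c] by (simp add: r d)
  then show "adj_mat A \<in> carrier (SL n F)"
    using adj_mat(1)[OF c] adj_mat_in_subfield[OF F c] A by (auto simp: carrier_SL)
qed

lemma SL_simps [simp]: "mult (SL n F) = (*)" "one (SL n F) = 1\<^sub>m n"
  by (simp_all add: SL_def)

lemma one_in_SL: "subfield_set F \<Longrightarrow> 1\<^sub>m n \<in> carrier (SL n F)"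
  by (auto simp: carrier_SL subfield_setD)

lemma mult_in_SL:
  assumes F: "subfield_set F" and "A \<in> carrier (SL n F)" "B \<in> carrier (SL n F)"
  shows "A * B \<in> carrier (SL n F)"
  using assms det_mult[of A n B]
  by (auto simp: carrier_SL mat_mult_entry simp del: index_mult_mat(1)
      intro!: subfield_set_sum[OF F] subfield_setD(4)[OF F])

lemma group_SL: assumes F: "subfield_set F" shows "group (SL n F)"
proof (rule groupI)
  show "\<exists>y\<in>carrier (SL n F). y \<otimes>\<^bsub>SL n F\<^esub> A = \<one>\<^bsub>SL n F\<^esub>" if "A \<in> carrier (SL n F)" for A
    using adj_mat_SL[OF F that] by auto
qed (auto simp: one_in_SL[OF F] mult_in_SL[OF F],
    auto simp: carrier_SL assoc_mult_mat[of _ n n _ n _ n])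

lemma inv_SL:
  assumes "A \<in> carrier (SL n UNIV)"
  shows "inv\<^bsub>SL n UNIV\<^esub> A = adj_mat A"
  using group.inv_equality[OF group_SL[OF subfield_set_UNIV]] adj_mat_SL[OF subfield_set_UNIV assms] assms
  by simp

lemma carrier_SL_UNIV: "carrier (SL n F) \<subseteq> carrier (SL n UNIV)"
  by (auto simp: carrier_SL)

lemma subgroup_SL:
  assumes F: "subfield_set F"
  shows "subgroup (carrier (SL n F)) (SL n UNIV)"
proof (rule group.subgroupI[OF group_SL[OF subfield_set_UNIV]])
  show "inv\<^bsub>SL n UNIV\<^esub> A \<in> carrier (SL n F)" if "A \<in> carrier (SL n F)" for A
    using that carrier_SL_UNIV[of n F] adj_mat_SL(1)[OF F that] by (auto simp: inv_SL)
  show "carrier (SL n F) \<noteq> {}" using one_in_SL[OF F] by blast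
qed (use carrier_SL_UNIV[of n F] mult_in_SL[OF F] in auto)

text \<open>
  In \<open>B * A = 1\<close> the columns of \<open>B\<close> are obtained one after the other from those of \<open>A\<close>, which
  have nonzero diagonal entries.
\<close>

lemma inverse_upper_triangular:
  fixes A B :: "'a::field mat"
  assumes A: "A \<in> carrier_mat n n" "\<And>i j. i < n \<Longrightarrow> j < i \<Longrightarrow> A $$ (i, j) = 0" "Determinant.det A = 1"
    and B: "B \<in> carrier_mat n n" "B * A = 1\<^sub>m n"
    and ij: "i < n" "j < i"
  shows "B $$ (i, j) = 0"
  using ij(2)
proof (induction j rule: less_induct)
  case (less j)
  have "upper_triangular A" using A by auto
  then have "prod_list (diag_mat A) = 1" using det_upper_triangular[of A n] A by simp
  then have "0 \<notin> set (diag_mat A)" by (metis prod_list_zero_iff zero_neq_one)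
  moreover have "A $$ (j, j) \<in> set (diag_mat A)"
    using less.prems ij(1) A(1) by (auto simp: diag_mat_def)
  ultimately have "A $$ (j, j) \<noteq> 0" by metis
  have "0 = (B * A) $$ (i, j)" using B(2) ij(1) less.prems by simp
  also have "\<dots> = (\<Sum>k<n. B $$ (i, k) * A $$ (k, j))"
    using mat_mult_entry[OF B(1) A(1)] ij(1) less.prems by simp
  also have "\<dots> = (\<Sum>k<n. if k = j then B $$ (i, j) * A $$ (j, j) else 0)"
  proof (rule sum.cong)
    fix k assume "k \<in> {..<n}"
    then show "B $$ (i, k) * A $$ (k, j) = (if k = j then B $$ (i, j) * A $$ (j, j) else 0)"
      using less.IH[of k] A(2)[of k j] less.prems by (cases k j rule: linorder_cases) auto
  qed simp
  also have "\<dots> = B $$ (i, j) * A $$ (j, j)" using ij(1) less.prems by simp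
  finally show ?case using \<open>A $$ (j, j) \<noteq> 0\<close> by simp
qed

lemma subgroup_STplus:
  assumes F: "subfield_set F"
  shows "subgroup (carrier (STplus n F)) (SL n UNIV)"
proof (rule group.subgroupI[OF group_SL[OF subfield_set_UNIV]])
  show "carrier (STplus n F) \<subseteq> carrier (SL n UNIV)"
    by (auto simp: carrier_STplus carrier_SL)
  show "carrier (STplus n F) \<noteq> {}"
  proof -
    have "1\<^sub>m n \<in> carrier (STplus n F)" using one_in_SL[OF F, of n] by (simp add: carrier_STplus)
    then show ?thesis by blast
  qed
next
  fix A assume A: "A \<in> carrier (STplus n F)"
  then have A': "A \<in> carrier (SL n F)" by (simp add: carrier_STplus)
  have "adj_mat A \<in> carrier (STplus n F)"
    unfolding carrier_STplus
    using adj_mat_SL[OF F A'] inverse_upper_triangular[of A n "adj_mat A"] A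
    by (auto simp: carrier_STplus carrier_SL)
  then show "inv\<^bsub>SL n UNIV\<^esub> A \<in> carrier (STplus n F)"
    using A' carrier_SL_UNIV[of n F] by (auto simp: inv_SL)
next
  fix A B assume A: "A \<in> carrier (STplus n F)" and B: "B \<in> carrier (STplus n F)"
  have "(A * B) $$ (i, j) = 0" if ij: "i < n" "j < i" for i j
  proof -
    have "A $$ (i, k) * B $$ (k, j) = 0" if "k < n" for k
      using A B ij that by (cases "k < i") (auto simp: carrier_STplus)
    then show ?thesis
      using A B ij
      by (subst mat_mult_entry[of _ n]) (auto simp: carrier_STplus carrier_SL intro!: sum.neutral)
  qed
  then show "A \<otimes>\<^bsub>SL n UNIV\<^esub> B \<in> carrier (STplus n F)"
    using mult_in_SL[OF F, of A n B] A B by (auto simp: carrier_STplus simp del: index_mult_mat)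
qed

lemma SL_eq: "SL n F = (SL n UNIV)\<lparr>carrier := carrier (SL n F)\<rparr>"
  by (simp add: SL_def)

lemma STplus_eq: "STplus n F = (SL n UNIV)\<lparr>carrier := carrier (STplus n F)\<rparr>"
  by (simp add: SL_def STplus_def)

lemma limitin_pullback_topology:
  "limitin (pullback_topology A f T) g l \<Phi> \<longleftrightarrow>
     l \<in> A \<and> (\<forall>\<^sub>F x in \<Phi>. g x \<in> A) \<and> limitin T (f \<circ> g) (f l) \<Phi>" (is "?L \<longleftrightarrow> ?R")
proof
  assume L: ?L
  have A: "openin (pullback_topology A f T) (topspace (pullback_topology A f T))" by simp
  have l: "l \<in> topspace (pullback_topology A f T)" using L by (rule limitin_topspace)
  have "continuous_map (pullback_topology A f T) T f"
    using continuous_map_pullback[of T T id A f] by simp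
  from continuous_map_limit[OF this L] have "limitin T (f \<circ> g) (f l) \<Phi>" .
  moreover have "\<forall>\<^sub>F x in \<Phi>. g x \<in> A"
    using limitinD[OF L A l] by eventually_elim (simp add: topspace_pullback_topology)
  ultimately show ?R using l by (simp add: topspace_pullback_topology)
next
  assume R: ?R
  show ?L
    unfolding limitin_def openin_pullback_topology
  proof (intro conjI allI impI)
    show "l \<in> topspace (pullback_topology A f T)"
      using R limitin_topspace by (fastforce simp: topspace_pullback_topology)
    fix U assume "(\<exists>V. openin T V \<and> U = f -` V \<inter> A) \<and> l \<in> U"
    then obtain V where V: "openin T V" "U = f -` V \<inter> A" "l \<in> U" by blast
    have "\<forall>\<^sub>F x in \<Phi>. (f \<circ> g) x \<in> V" using R V by (auto dest: limitinD)
    then show "\<forall>\<^sub>F x in \<Phi>. g x \<in> U"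
      using R V by (auto elim: eventually_elim2)
  qed
qed

lemma limitin_SL_topology:
  fixes F :: "'a::{field, topological_space} set"
  shows "limitin (SL_topology n F) f A \<Phi> \<longleftrightarrow> A \<in> carrier (SL n F) \<and>
     (\<forall>\<^sub>F x in \<Phi>. f x \<in> carrier (SL n F)) \<and>
     (\<forall>i<n. \<forall>j<n. ((\<lambda>x. f x $$ (i, j)) \<longlongrightarrow> A $$ (i, j)) \<Phi>)" (is "?L \<longleftrightarrow> ?R")
proof
  assume ?L
  then have *: "A \<in> carrier (SL n F)" "\<forall>\<^sub>F x in \<Phi>. f x \<in> carrier (SL n F)"
    "\<And>ij. ij \<in> {..<n} \<times> {..<n} \<Longrightarrow> limitin (top_of_set F)
       (\<lambda>c. ((\<lambda>A. \<lambda>ij \<in> {..<n} \<times> {..<n}. A $$ ij) \<circ> f) c ij) ((\<lambda>ij \<in> {..<n} \<times> {..<n}. A $$ ij) ij) \<Phi>"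
    unfolding SL_topology_def limitin_pullback_topology limitin_componentwise by auto
  then have "((\<lambda>x. f x $$ (i, j)) \<longlongrightarrow> A $$ (i, j)) \<Phi>" if "i < n" "j < n" for i j
    using *(3)[of "(i, j)"] that by (simp add: limitin_subtopology)
  with * show ?R by blast
next
  assume R: ?R
  have ev: "\<forall>\<^sub>F x in \<Phi>. f x $$ (i, j) \<in> F" if "i < n" "j < n" for i j
    using R that by (auto simp: carrier_SL elim: eventually_mono)
  have "\<forall>\<^sub>F x in \<Phi>. ((\<lambda>A. \<lambda>ij \<in> {..<n} \<times> {..<n}. A $$ ij) \<circ> f) x \<in>
      topspace (product_topology (\<lambda>_. top_of_set F) ({..<n} \<times> {..<n}))"
    using R by (auto simp: carrier_SL elim!: eventually_mono)
  then show ?L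
    unfolding SL_topology_def limitin_pullback_topology limitin_componentwise
    using R ev by (auto simp: limitin_subtopology carrier_SL)
qed

text \<open>
  All topologies in question are traces of the one on the group over the whole field, so that
  continuity of the operations has to be shown only there.
\<close>

lemma SL_topology_eq: "SL_topology n F = subtopology (SL_topology n UNIV) (carrier (SL n F))"
proof -
  have lim: "limitin (SL_topology n F) f A \<Phi> \<longleftrightarrow>
      limitin (subtopology (SL_topology n UNIV) (carrier (SL n F))) f A \<Phi>"
    for f A and \<Phi> :: "'a mat filter"
    unfolding limitin_subtopology limitin_SL_topology
    using carrier_SL_UNIV[of n F] by (auto elim: eventually_mono)
  have ts: "topspace (subtopology (SL_topology n UNIV) (carrier (SL n F))) = topspace (SL_topology n F)"
    using carrier_SL_UNIV[of n F] by (auto simp: topspace_SL_topology)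
  have "continuous_map (SL_topology n F) (subtopology (SL_topology n UNIV) (carrier (SL n F))) id"
    unfolding continuous_map_atin lim[symmetric]
    by (simp add: limitin_atin) (metis openin_subset Diff_subset)
  moreover have "continuous_map (subtopology (SL_topology n UNIV) (carrier (SL n F))) (SL_topology n F) id"
    unfolding continuous_map_atin lim ts
    by (simp add: limitin_atin ts[simplified]) (metis openin_subset Diff_subset)
  ultimately show ?thesis
    using topology_finer_continuous_id[OF ts] topology_finer_continuous_id[OF ts[symmetric]]
    by (metis topology_eq)
qed

lemma STplus_topology_eq:
  "STplus_topology n F = subtopology (SL_topology n UNIV) (carrier (STplus n F))"
  unfolding STplus_topology_def SL_topology_eq[of n F] subtopology_subtopology
  by (rule arg_cong[where f = "subtopology _"]) (auto simp: carrier_STplus)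

lemma tendsto_det:
  fixes f :: "'b \<Rightarrow> 'a::real_normed_field mat"
  assumes f: "\<forall>\<^sub>F x in \<Phi>. f x \<in> carrier_mat n n" and A: "A \<in> carrier_mat n n"
    and lim: "\<And>i j. i < n \<Longrightarrow> j < n \<Longrightarrow> ((\<lambda>x. f x $$ (i, j)) \<longlongrightarrow> A $$ (i, j)) \<Phi>"
  shows "((\<lambda>x. Determinant.det (f x)) \<longlongrightarrow> Determinant.det A) \<Phi>"
proof (rule Lim_transform_eventually)
  show "\<forall>\<^sub>F x in \<Phi>. (\<Sum>p | p permutes {0..<n}. signof p * (\<Prod>i = 0..<n. f x $$ (i, p i))) =
      Determinant.det (f x)"
    using f by eventually_elim (simp add: det_def')
  show "((\<lambda>x. \<Sum>p | p permutes {0..<n}. signof p * (\<Prod>i = 0..<n. f x $$ (i, p i))) \<longlongrightarrow>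
      Determinant.det A) \<Phi>"
    unfolding det_def'[OF A]
    by (intro tendsto_sum tendsto_mult tendsto_const tendsto_prod lim) (auto simp: permutes_lessThan)
qed

lemma tendsto_adj_mat:
  fixes f :: "'b \<Rightarrow> 'a::real_normed_field mat"
  assumes f: "\<forall>\<^sub>F x in \<Phi>. f x \<in> carrier_mat n n" and A: "A \<in> carrier_mat n n"
    and lim: "\<And>i j. i < n \<Longrightarrow> j < n \<Longrightarrow> ((\<lambda>x. f x $$ (i, j)) \<longlongrightarrow> A $$ (i, j)) \<Phi>"
    and ij: "i < n" "j < n"
  shows "((\<lambda>x. adj_mat (f x) $$ (i, j)) \<longlongrightarrow> adj_mat A $$ (i, j)) \<Phi>"
proof (rule Lim_transform_eventually)
  show "\<forall>\<^sub>F x in \<Phi>. (- 1) ^ (j + i) * Determinant.det (mat_delete (f x) j i) = adj_mat (f x) $$ (i, j)"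
    using f by eventually_elim (use ij in \<open>simp add: adj_mat_def cofactor_def\<close>)
  have "((\<lambda>x. Determinant.det (mat_delete (f x) j i)) \<longlongrightarrow> Determinant.det (mat_delete A j i)) \<Phi>"
  proof (rule tendsto_det[where n = "n - 1"])
    show "\<forall>\<^sub>F x in \<Phi>. mat_delete (f x) j i \<in> carrier_mat (n - 1) (n - 1)"
      using f by eventually_elim (auto simp: mat_delete_def)
    show "mat_delete A j i \<in> carrier_mat (n - 1) (n - 1)" using A by (auto simp: mat_delete_def)
    fix k l assume kl: "k < n - 1" "l < n - 1"
    let ?k = "if k < j then k else Suc k" and ?l = "if l < i then l else Suc l"
    show "((\<lambda>x. mat_delete (f x) j i $$ (k, l)) \<longlongrightarrow> mat_delete A j i $$ (k, l)) \<Phi>"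
    proof (rule Lim_transform_eventually)
      show "\<forall>\<^sub>F x in \<Phi>. f x $$ (?k, ?l) = mat_delete (f x) j i $$ (k, l)"
        using f by eventually_elim (use kl in \<open>auto simp: mat_delete_def\<close>)
      show "((\<lambda>x. f x $$ (?k, ?l)) \<longlongrightarrow> mat_delete A j i $$ (k, l)) \<Phi>"
        using lim[of ?k ?l] kl A by (auto simp: mat_delete_def)
    qed
  qed
  then show "((\<lambda>x. (- 1) ^ (j + i) * Determinant.det (mat_delete (f x) j i)) \<longlongrightarrow> adj_mat A $$ (i, j)) \<Phi>"
    using A ij by (auto simp: adj_mat_def cofactor_def intro!: tendsto_intros)
qed

lemma topological_group_SL_UNIV:
  "topological_group (SL n (UNIV :: 'a::real_normed_field set)) (SL_topology n UNIV)"
  unfolding topological_group_def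
proof (intro conjI)
  let ?T = "SL_topology n (UNIV :: 'a set)"
  show "group (SL n (UNIV :: 'a set))" by (rule group_SL[OF subfield_set_UNIV])
  show "topspace ?T = carrier (SL n UNIV)" by (rule topspace_SL_topology)
  have entry: "((\<lambda>A. h A $$ (i, j)) \<longlongrightarrow> h p $$ (i, j)) (atin X p)"
    if "continuous_map X ?T h" "p \<in> topspace X" "i < n" "j < n"
    for X :: "'c topology" and h p i j
    using that by (auto simp: continuous_map_atin limitin_SL_topology)
  have carr: "\<forall>\<^sub>F x in atin X p. h x \<in> carrier (SL n UNIV)"
    if "continuous_map X ?T h" "p \<in> topspace X"
    for X :: "'c topology" and h p
    using that by (auto simp: continuous_map_atin limitin_SL_topology)
  show "Hausdorff_space ?T"
    unfolding Hausdorff_space_def topspace_SL_topology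
  proof (intro allI impI, elim conjE)
    fix A B :: "'a mat" assume AB: "A \<in> carrier (SL n UNIV)" "B \<in> carrier (SL n UNIV)" "A \<noteq> B"
    then obtain i j where ij: "i < n" "j < n" "A $$ (i, j) \<noteq> B $$ (i, j)"
      unfolding carrier_SL by (metis carrier_matD eq_matI)
    then obtain U V where UV: "open U" "open V" "A $$ (i, j) \<in> U" "B $$ (i, j) \<in> V" "U \<inter> V = {}"
      by (meson hausdorff)
    have cont: "continuous_map ?T euclidean (\<lambda>A. A $$ (i, j))"
      unfolding continuous_map_atin using entry[of ?T id] ij by simp
    show "\<exists>U V. openin ?T U \<and> openin ?T V \<and> A \<in> U \<and> B \<in> V \<and> disjnt U V"
      using openin_continuous_map_preimage[OF cont, of U] openin_continuous_map_preimage[OF cont, of V] UV AB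
      by (intro exI[of _ "{A \<in> topspace ?T. A $$ (i, j) \<in> U}"]
          exI[of _ "{A \<in> topspace ?T. A $$ (i, j) \<in> V}"])
        (auto simp: disjnt_def topspace_SL_topology)
  qed
  show "continuous_map (prod_topology ?T ?T) ?T (\<lambda>(A, B). A \<otimes>\<^bsub>SL n UNIV\<^esub> B)"
    unfolding continuous_map_atin limitin_SL_topology
  proof (intro ballI conjI allI impI)
    let ?P = "prod_topology ?T ?T"
    fix p assume p: "p \<in> topspace ?P"
    obtain A B where AB: "p = (A, B)" "A \<in> carrier (SL n UNIV)" "B \<in> carrier (SL n UNIV)"
      using p by (auto simp: topspace_SL_topology)
    show "(case p of (A, B) \<Rightarrow> A \<otimes>\<^bsub>SL n UNIV\<^esub> B) \<in> carrier (SL n UNIV)"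
      using AB mult_in_SL[OF subfield_set_UNIV] by simp
    note ev = carr[OF continuous_map_fst p] carr[OF continuous_map_snd p]
    show "\<forall>\<^sub>F x in atin ?P p. (case x of (A, B) \<Rightarrow> A \<otimes>\<^bsub>SL n UNIV\<^esub> B) \<in> carrier (SL n UNIV)"
      using ev by eventually_elim (auto simp: mult_in_SL[OF subfield_set_UNIV])
    fix i j assume ij: "i < n" "j < n"
    show "((\<lambda>x. (case x of (A, B) \<Rightarrow> A \<otimes>\<^bsub>SL n UNIV\<^esub> B) $$ (i, j)) \<longlongrightarrow>
        (case p of (A, B) \<Rightarrow> A \<otimes>\<^bsub>SL n UNIV\<^esub> B) $$ (i, j)) (atin ?P p)"
    proof (rule Lim_transform_eventually)
      show "\<forall>\<^sub>F x in atin ?P p. (\<Sum>k<n. fst x $$ (i, k) * snd x $$ (k, j)) =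
          (case x of (A, B) \<Rightarrow> A \<otimes>\<^bsub>SL n UNIV\<^esub> B) $$ (i, j)"
        using ev by eventually_elim (use ij in
            \<open>auto simp: carrier_SL mat_mult_entry simp del: index_mult_mat(1)\<close>)
      have "((\<lambda>x. \<Sum>k<n. fst x $$ (i, k) * snd x $$ (k, j)) \<longlongrightarrow>
          (\<Sum>k<n. fst p $$ (i, k) * snd p $$ (k, j))) (atin ?P p)"
        using entry[OF continuous_map_fst p] entry[OF continuous_map_snd p] ij
        by (intro tendsto_sum tendsto_mult) auto
      then show "((\<lambda>x. \<Sum>k<n. fst x $$ (i, k) * snd x $$ (k, j)) \<longlongrightarrow>
          (case p of (A, B) \<Rightarrow> A \<otimes>\<^bsub>SL n UNIV\<^esub> B) $$ (i, j)) (atin ?P p)"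
        using AB ij mat_mult_entry[of A n B] by (auto simp: carrier_SL)
    qed
  qed
  show "continuous_map ?T ?T (\<lambda>A. inv\<^bsub>SL n UNIV\<^esub> A)"
  proof (rule continuous_map_eq)
    show "adj_mat A = inv\<^bsub>SL n UNIV\<^esub> A" if "A \<in> topspace ?T" for A
      using that by (simp add: topspace_SL_topology inv_SL)
    show "continuous_map ?T ?T adj_mat"
      unfolding continuous_map_atin limitin_SL_topology
    proof (intro ballI conjI allI impI)
      fix A assume A: "A \<in> topspace ?T"
      then have A': "A \<in> carrier (SL n UNIV)" by (simp add: topspace_SL_topology)
      have ev: "\<forall>\<^sub>F x in atin ?T A. x \<in> carrier (SL n UNIV)"
        using carr[OF continuous_map_id A] by simp
      show "adj_mat A \<in> carrier (SL n UNIV)" by (rule adj_mat_SL(1)[OF subfield_set_UNIV A'])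
      show "\<forall>\<^sub>F x in atin ?T A. adj_mat x \<in> carrier (SL n UNIV)"
        using ev by eventually_elim (rule adj_mat_SL(1)[OF subfield_set_UNIV])
      fix i j assume "i < n" "j < n"
      then show "((\<lambda>x. adj_mat x $$ (i, j)) \<longlongrightarrow> adj_mat A $$ (i, j)) (atin ?T A)"
        using A' entry[OF continuous_map_id A] ev
        by (intro tendsto_adj_mat[where n = n]) (auto simp: carrier_SL elim: eventually_mono)
    qed
  qed
qed


section \<open>Null nets in a topological group\<close>

locale Hausdorff_group = group G for G :: "('a, 'm) monoid_scheme" (structure) +
  fixes T :: "'a topology"
  assumes tg: "topological_group G T"
begin

lemma topspace_eq: "topspace T = carrier G" and Hausdorff: "Hausdorff_space T"
  and cont_mult: "continuous_map (prod_topology T T) T (\<lambda>(x, y). x \<otimes> y)"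
  and cont_inv: "continuous_map T T (\<lambda>x. inv x)"
  using tg unfolding topological_group_def by auto

lemma limitin_mult:
  assumes "limitin T f a \<Phi>" "limitin T g b \<Phi>"
  shows "limitin T (\<lambda>x. f x \<otimes> g x) (a \<otimes> b) \<Phi>"
proof -
  have "limitin (prod_topology T T) (\<lambda>x. (f x, g x)) (a, b) \<Phi>"
    using assms by (simp add: limitin_pairwise o_def)
  from continuous_map_limit[OF cont_mult this] show ?thesis by (simp add: o_def)
qed

lemma limitin_inv: "limitin T f a \<Phi> \<Longrightarrow> limitin T (\<lambda>x. inv (f x)) (inv a) \<Phi>"
  using continuous_map_limit[OF cont_inv] by (simp add: o_def)

text \<open>
  A net is null if it tends to the identity, and tame if conjugation by it preserves the null nets.
  The tame nets form a group in which the null nets are a normal subgroup, and \<open>near\<close> is congruence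
  modulo it.  Hence in any word in tame nets, a null net may be replaced by the identity at the price
  of a null factor; for iterated commutators this is \<open>near_comm\<close>.
\<close>

definition null :: "'b filter \<Rightarrow> ('b \<Rightarrow> 'a) \<Rightarrow> bool" where
  "null \<Phi> y \<longleftrightarrow> (\<forall>x. y x \<in> carrier G) \<and> limitin T y \<one> \<Phi>"

definition tame :: "'b filter \<Rightarrow> ('b \<Rightarrow> 'a) \<Rightarrow> bool" where
  "tame \<Phi> a \<longleftrightarrow> (\<forall>x. a x \<in> carrier G) \<and>
     (\<forall>y. null \<Phi> y \<longrightarrow> null \<Phi> (\<lambda>x. a x \<otimes> y x \<otimes> inv (a x)) \<and> null \<Phi> (\<lambda>x. inv (a x) \<otimes> y x \<otimes> a x))"

definition near :: "'b filter \<Rightarrow> ('b \<Rightarrow> 'a) \<Rightarrow> ('b \<Rightarrow> 'a) \<Rightarrow> bool" where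
  "near \<Phi> a b \<longleftrightarrow> tame \<Phi> a \<and> tame \<Phi> b \<and> null \<Phi> (\<lambda>x. a x \<otimes> inv (b x))"

definition comm :: "'a \<Rightarrow> 'a \<Rightarrow> 'a" where
  "comm a b = a \<otimes> b \<otimes> inv a \<otimes> inv b"

lemma null_closed: "null \<Phi> y \<Longrightarrow> y x \<in> carrier G"
  by (simp add: null_def)

lemma tame_closed: "tame \<Phi> a \<Longrightarrow> a x \<in> carrier G"
  by (simp add: tame_def)

lemma null_mult: "null \<Phi> y \<Longrightarrow> null \<Phi> z \<Longrightarrow> null \<Phi> (\<lambda>x. y x \<otimes> z x)"
  unfolding null_def using limitin_mult[of y \<one> \<Phi> z \<one>] by simp

lemma null_inv: "null \<Phi> y \<Longrightarrow> null \<Phi> (\<lambda>x. inv (y x))"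
  unfolding null_def using limitin_inv[of y \<one> \<Phi>] by simp

lemma null_one: "null \<Phi> (\<lambda>x. \<one>)"
  by (simp add: null_def topspace_eq)

lemma tame_const:
  assumes a: "a \<in> carrier G"
  shows "tame \<Phi> (\<lambda>_. a)"
proof -
  have "limitin T (\<lambda>_. b) b \<Phi>" if "b \<in> carrier G" for b and \<Phi> :: "'b filter"
    using that by (simp add: topspace_eq)
  note lim = limitin_mult[OF limitin_mult[OF this] this]
  have "null \<Phi> (\<lambda>x. b \<otimes> y x \<otimes> c)"
    if "null \<Phi> y" "b \<in> carrier G" "c \<in> carrier G" "b \<otimes> c = \<one>" for y :: "'b \<Rightarrow> 'a" and b c
    using that lim[of b y \<one> \<Phi> c] by (simp add: null_def)
  then show ?thesis using a by (simp add: tame_def)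
qed

lemma tame_null: "null \<Phi> y \<Longrightarrow> tame \<Phi> y"
  unfolding tame_def by (simp add: null_closed null_mult null_inv)

lemma tame_inv: "tame \<Phi> a \<Longrightarrow> tame \<Phi> (\<lambda>x. inv (a x))"
  unfolding tame_def by auto

lemma tame_mult:
  assumes a: "tame \<Phi> a" and b: "tame \<Phi> b"
  shows "tame \<Phi> (\<lambda>x. a x \<otimes> b x)"
proof -
  note cl = tame_closed[OF a] tame_closed[OF b]
  have "null \<Phi> (\<lambda>x. a x \<otimes> b x \<otimes> y x \<otimes> inv (a x \<otimes> b x))" if y: "null \<Phi> y" for y
  proof -
    have "null \<Phi> (\<lambda>x. a x \<otimes> (b x \<otimes> y x \<otimes> inv (b x)) \<otimes> inv (a x))"
      using a b y unfolding tame_def by blast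
    then show ?thesis by (simp add: cl null_closed[OF y] m_assoc inv_mult_group)
  qed
  moreover have "null \<Phi> (\<lambda>x. inv (a x \<otimes> b x) \<otimes> y x \<otimes> (a x \<otimes> b x))" if y: "null \<Phi> y" for y
  proof -
    have "null \<Phi> (\<lambda>x. inv (b x) \<otimes> (inv (a x) \<otimes> y x \<otimes> a x) \<otimes> b x)"
      using a b y unfolding tame_def by blast
    then show ?thesis by (simp add: cl null_closed[OF y] m_assoc inv_mult_group)
  qed
  ultimately show ?thesis unfolding tame_def using cl by simp
qed

lemma near_refl: "tame \<Phi> a \<Longrightarrow> near \<Phi> a a"
  unfolding near_def by (simp add: tame_closed null_one)

lemma near_one: "null \<Phi> y \<Longrightarrow> near \<Phi> y (\<lambda>_. \<one>)"
  unfolding near_def by (simp add: tame_null tame_const null_closed)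

lemma near_mult:
  assumes ab: "near \<Phi> a a'" "near \<Phi> b b'"
  shows "near \<Phi> (\<lambda>x. a x \<otimes> b x) (\<lambda>x. a' x \<otimes> b' x)"
proof -
  have t: "tame \<Phi> a" "tame \<Phi> a'" "tame \<Phi> b" "tame \<Phi> b'"
    and n: "null \<Phi> (\<lambda>x. a x \<otimes> inv (a' x))" "null \<Phi> (\<lambda>x. b x \<otimes> inv (b' x))"
    using ab unfolding near_def by auto
  note cl = t[THEN tame_closed]
  have "null \<Phi> (\<lambda>x. a x \<otimes> (b x \<otimes> inv (b' x)) \<otimes> inv (a x))"
    using t(1) n(2) by (auto simp: tame_def)
  from null_mult[OF this n(1)]
  have "null \<Phi> (\<lambda>x. (a x \<otimes> (b x \<otimes> inv (b' x)) \<otimes> inv (a x)) \<otimes> (a x \<otimes> inv (a' x)))" .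
  moreover have "(a x \<otimes> (b x \<otimes> inv (b' x)) \<otimes> inv (a x)) \<otimes> (a x \<otimes> inv (a' x)) =
      a x \<otimes> b x \<otimes> inv (a' x \<otimes> b' x)" for x
  proof -
    have "inv (a x) \<otimes> (a x \<otimes> inv (a' x)) = inv (a' x)"
      using cl by (simp add: m_assoc[symmetric])
    then show ?thesis using cl by (simp add: m_assoc inv_mult_group)
  qed
  ultimately show ?thesis unfolding near_def using t by (simp add: tame_mult)
qed

lemma near_inv:
  assumes "near \<Phi> a a'"
  shows "near \<Phi> (\<lambda>x. inv (a x)) (\<lambda>x. inv (a' x))"
proof -
  have t: "tame \<Phi> a" "tame \<Phi> a'" and n: "null \<Phi> (\<lambda>x. a x \<otimes> inv (a' x))"
    using assms unfolding near_def by auto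
  note cl = t[THEN tame_closed]
  have "null \<Phi> (\<lambda>x. inv (a x) \<otimes> inv (a x \<otimes> inv (a' x)) \<otimes> a x)"
    using t(1) null_inv[OF n] by (auto simp: tame_def)
  moreover have "inv (a x) \<otimes> inv (a x \<otimes> inv (a' x)) \<otimes> a x = inv (a x) \<otimes> inv (inv (a' x))" for x
    using cl by (simp add: m_assoc inv_mult_group)
  ultimately show ?thesis unfolding near_def using t by (simp add: tame_inv)
qed

lemma near_comm:
  "near \<Phi> a a' \<Longrightarrow> near \<Phi> b b' \<Longrightarrow> near \<Phi> (\<lambda>x. comm (a x) (b x)) (\<lambda>x. comm (a' x) (b' x))"
  unfolding comm_def by (intro near_mult near_inv)

lemma comm_eqI:
  assumes "a \<in> carrier G" "b \<in> carrier G" "c \<in> carrier G" "a \<otimes> b = c \<otimes> (b \<otimes> a)"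
  shows "comm a b = c"
proof -
  have "comm a b = a \<otimes> b \<otimes> inv (b \<otimes> a)"
    unfolding comm_def using assms(1-3) by (simp add: inv_mult_group m_assoc)
  also have "\<dots> = c \<otimes> ((b \<otimes> a) \<otimes> inv (b \<otimes> a))"
    using assms(1-3) by (simp only: assms(4) m_assoc m_closed inv_closed)
  also have "\<dots> = c" using assms(1-3) by (simp only: r_inv m_closed r_one)
  finally show ?thesis .
qed

lemma nhd_comm:
  assumes "openin T U" "\<one> \<in> U"
  obtains V where "openin T V" "\<one> \<in> V" "\<And>a b. a \<in> V \<Longrightarrow> b \<in> V \<Longrightarrow> a \<otimes> b \<otimes> inv a \<in> U"
    "\<And>a b. a \<in> V \<Longrightarrow> b \<in> V \<Longrightarrow> comm a b \<in> U"
proof -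
  let ?\<Phi> = "nhdsin (prod_topology T T) (\<one>, \<one>)"
  have id: "limitin X (\<lambda>x. x) p (nhdsin X p)" if "p \<in> topspace X" for p :: 'p and X
    using that by (auto simp: limitin_def eventually_nhdsin)
  have p: "(\<one>, \<one>) \<in> topspace (prod_topology T T)" by (simp add: topspace_eq)
  have lim: "limitin T fst \<one> ?\<Phi>" "limitin T snd \<one> ?\<Phi>"
    using id[OF p] by (simp_all add: limitin_pairwise o_def)
  have "limitin T (\<lambda>x. fst x \<otimes> snd x \<otimes> inv (fst x)) (\<one> \<otimes> \<one> \<otimes> inv \<one>) ?\<Phi>"
    "limitin T (\<lambda>x. comm (fst x) (snd x)) (\<one> \<otimes> \<one> \<otimes> inv \<one> \<otimes> inv \<one>) ?\<Phi>"
    unfolding comm_def by (intro limitin_mult limitin_inv lim)+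
  then have "limitin T (\<lambda>x. fst x \<otimes> snd x \<otimes> inv (fst x)) \<one> ?\<Phi>"
    "limitin T (\<lambda>x. comm (fst x) (snd x)) \<one> ?\<Phi>"
    by simp_all
  from this[THEN limitinD, OF assms]
  have "\<forall>\<^sub>F x in ?\<Phi>. fst x \<otimes> snd x \<otimes> inv (fst x) \<in> U \<and> comm (fst x) (snd x) \<in> U"
    by (rule eventually_conj)
  then obtain W where W: "openin (prod_topology T T) W" "(\<one>, \<one>) \<in> W"
    "\<And>x. x \<in> W \<Longrightarrow> fst x \<otimes> snd x \<otimes> inv (fst x) \<in> U \<and> comm (fst x) (snd x) \<in> U"
    using p unfolding eventually_nhdsin by blast
  then obtain A B where AB: "openin T A" "openin T B" "\<one> \<in> A" "\<one> \<in> B" "A \<times> B \<subseteq> W"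
    unfolding openin_prod_topology_alt by metis
  show thesis
  proof (rule that[of "A \<inter> B"])
    show "a \<otimes> b \<otimes> inv a \<in> U" "comm a b \<in> U" if "a \<in> A \<inter> B" "b \<in> A \<inter> B" for a b
      using W(3)[of "(a, b)"] AB(5) that by auto
  qed (use AB in auto)
qed

end


section \<open>Rank-one updates of the identity matrix\<close>

\<comment> \<open>products are computed as explicit sums over the index range, by \<open>mat_mult_entry\<close>\<close>
declare index_mult_mat(1) [simp del]

definition rank_one_update :: "nat \<Rightarrow> (nat \<Rightarrow> 'a::comm_ring_1) \<Rightarrow> (nat \<Rightarrow> 'a) \<Rightarrow> 'a mat" where
  "rank_one_update n u v = mat n n (\<lambda>(a, b). (if a = b then 1 else 0) + u a * v b)"

definition unit_fun :: "nat \<Rightarrow> nat \<Rightarrow> 'a::comm_ring_1" where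
  "unit_fun i a = (if a = i then 1 else 0)"

definition dot :: "nat \<Rightarrow> (nat \<Rightarrow> 'a::comm_ring_1) \<Rightarrow> (nat \<Rightarrow> 'a) \<Rightarrow> 'a" where
  "dot n v w = (\<Sum>k<n. v k * w k)"

definition elem_mat :: "nat \<Rightarrow> nat \<Rightarrow> nat \<Rightarrow> 'a::comm_ring_1 \<Rightarrow> 'a mat" where
  "elem_mat n i j x = rank_one_update n (\<lambda>a. x * unit_fun i a) (unit_fun j)"

lemma rank_one_update_carrier [simp]: "rank_one_update n u v \<in> carrier_mat n n"
  by (simp add: rank_one_update_def)

lemma rank_one_update_dim [simp]:
  "dim_row (rank_one_update n u v) = n" "dim_col (rank_one_update n u v) = n"
  by (simp_all add: rank_one_update_def)

lemma rank_one_update_entry: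
  "a < n \<Longrightarrow> b < n \<Longrightarrow> rank_one_update n u v $$ (a, b) = (if a = b then 1 else 0) + u a * v b"
  by (simp add: rank_one_update_def)

lemma elem_mat_carrier [simp]: "elem_mat n i j x \<in> carrier_mat n n"
  by (simp add: elem_mat_def)

lemma elem_mat_dim [simp]: "dim_row (elem_mat n i j x) = n" "dim_col (elem_mat n i j x) = n"
  by (simp_all add: elem_mat_def)

lemma elem_mat_entry:
  "a < n \<Longrightarrow> b < n \<Longrightarrow>
     elem_mat n i j x $$ (a, b) = (if a = b then 1 else 0) + (if a = i \<and> b = j then x else 0)"
  by (simp add: elem_mat_def rank_one_update_entry unit_fun_def)

lemma dot_unit [simp]:
  "i < n \<Longrightarrow> dot n (unit_fun i) w = w i" "i < n \<Longrightarrow> dot n v (unit_fun i) = v i"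
  unfolding dot_def unit_fun_def by (simp_all add: if_distrib[of "\<lambda>x. x * _"] if_distrib[of "\<lambda>x. _ * x"] cong: if_cong)

lemma dot_scale [simp]: "dot n v (\<lambda>a. x * w a) = x * dot n v w" "dot n (\<lambda>a. x * v a) w = x * dot n v w"
  unfolding dot_def by (simp_all add: sum_distrib_left ac_simps)

lemma dot_uminus [simp]: "dot n v (\<lambda>a. - w a) = - dot n v w"
  by (simp add: dot_def sum_negf)

lemma dot_add: "dot n (\<lambda>a. v a + v' a) w = dot n v w + dot n v' w"
  "dot n v (\<lambda>a. w a + w' a) = dot n v w + dot n v w'"
  unfolding dot_def by (simp_all add: algebra_simps sum.distrib)

lemma mult_rank_one_update_left:
  assumes "M \<in> carrier_mat n n" "a < n" "b < n"
  shows "(rank_one_update n u v * M) $$ (a, b) = M $$ (a, b) + u a * dot n v (\<lambda>k. M $$ (k, b))"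
proof -
  have "(rank_one_update n u v * M) $$ (a, b) =
      (\<Sum>k<n. (if k = a then M $$ (k, b) else 0) + u a * (v k * M $$ (k, b)))"
    unfolding mat_mult_entry[OF rank_one_update_carrier assms]
    using assms by (intro sum.cong) (auto simp: rank_one_update_entry algebra_simps)
  then show ?thesis using assms by (simp add: sum.distrib sum_distrib_left dot_def)
qed

lemma mult_rank_one_updates:
  assumes "a < n" "b < n"
  shows "(rank_one_update n u v * rank_one_update n w \<phi>) $$ (a, b) =
    (if a = b then 1 else 0) + w a * \<phi> b + u a * v b + dot n v w * u a * \<phi> b"
proof -
  have "dot n v (\<lambda>k. rank_one_update n w \<phi> $$ (k, b)) = (\<Sum>k<n. (if k = b then v k else 0) + v k * w k * \<phi> b)"
    unfolding dot_def using assms by (intro sum.cong) (auto simp: rank_one_update_entry algebra_simps)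
  also have "\<dots> = v b + dot n v w * \<phi> b"
    using assms by (simp add: sum.distrib sum_distrib_right dot_def)
  finally show ?thesis
    using assms by (simp add: mult_rank_one_update_left rank_one_update_entry algebra_simps)
qed

lemma rank_one_update_add:
  assumes "dot n \<phi> w = 0"
  shows "rank_one_update n u \<phi> * rank_one_update n w \<phi> = rank_one_update n (\<lambda>a. u a + w a) \<phi>"
  by (rule eq_matI) (use assms in \<open>auto simp: mult_rank_one_updates rank_one_update_entry algebra_simps\<close>)

text \<open>
  Up to second order, \<open>I + u v\<^sup>t\<close> and \<open>I + w \<phi>\<^sup>t\<close> commute up to \<open>(v\<^sup>t w) u \<phi>\<^sup>t - (\<phi>\<^sup>t u) w v\<^sup>t\<close>.  When \<open>\<phi>\<close>
  annihilates both \<open>u\<close> and \<open>w\<close>, this is exact and the second term is absent, so that their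
  commutator is again a rank-one update.
\<close>

lemma rank_one_update_commutation:
  assumes u: "dot n \<phi> u = 0" and w: "dot n \<phi> w = 0"
  shows "rank_one_update n u v * rank_one_update n w \<phi> =
    rank_one_update n (\<lambda>a. dot n v w * u a) \<phi> * (rank_one_update n w \<phi> * rank_one_update n u v)"
proof (rule eq_matI)
  fix a b assume "a < dim_row (rank_one_update n (\<lambda>a. dot n v w * u a) \<phi> *
      (rank_one_update n w \<phi> * rank_one_update n u v))"
    "b < dim_col (rank_one_update n (\<lambda>a. dot n v w * u a) \<phi> *
      (rank_one_update n w \<phi> * rank_one_update n u v))"
  then have ab: "a < n" "b < n" by (auto simp: rank_one_update_def)
  have "dot n \<phi> (\<lambda>k. (rank_one_update n w \<phi> * rank_one_update n u v) $$ (k, b)) =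
      (\<Sum>k<n. (if k = b then \<phi> k else 0) + \<phi> k * u k * v b + \<phi> k * w k * \<phi> b)"
    unfolding dot_def using ab u
    by (intro sum.cong) (auto simp: mult_rank_one_updates algebra_simps )
  also have "\<dots> = \<phi> b + dot n \<phi> u * v b + dot n \<phi> w * \<phi> b"
    using ab by (simp add: sum.distrib sum_distrib_right dot_def)
  finally have "dot n \<phi> (\<lambda>k. (rank_one_update n w \<phi> * rank_one_update n u v) $$ (k, b)) = \<phi> b"
    using u w by simp
  then show "(rank_one_update n u v * rank_one_update n w \<phi>) $$ (a, b) =
      (rank_one_update n (\<lambda>a. dot n v w * u a) \<phi> *
      (rank_one_update n w \<phi> * rank_one_update n u v)) $$ (a, b)"
    using ab u by (subst mult_rank_one_update_left[OF mult_carrier_mat[of _ n n]])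
      (auto simp: mult_rank_one_updates )
qed (auto simp: rank_one_update_def)

lemma conj_elem_mat:
  fixes g h :: "'a::comm_ring_1 mat"
  assumes g: "g \<in> carrier_mat n n" and h: "h \<in> carrier_mat n n" and hg: "h * g = 1\<^sub>m n" "g * h = 1\<^sub>m n"
    and jk: "j < n" "k < n"
  shows "g * elem_mat n j k 1 * h = rank_one_update n (\<lambda>a. g $$ (a, j)) (\<lambda>b. h $$ (k, b))"
proof -
  let ?R = "rank_one_update n (\<lambda>a. g $$ (a, j)) (\<lambda>b. h $$ (k, b))"
  have "g * elem_mat n j k 1 = ?R * g"
  proof (rule eq_matI)
    fix a b assume "a < dim_row (?R * g)" "b < dim_col (?R * g)"
    then have ab: "a < n" "b < n" using g by (auto simp: rank_one_update_def)
    have "dot n (\<lambda>b. h $$ (k, b)) (\<lambda>c. g $$ (c, b)) = (h * g) $$ (k, b)"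
      using ab jk g h mat_mult_entry[of h n g k b] by (simp add: dot_def)
    also have "\<dots> = (if k = b then 1 else 0)" using hg ab jk by simp
    finally have 1: "(?R * g) $$ (a, b) = g $$ (a, b) + (if k = b then g $$ (a, j) else 0)"
      using g ab by (simp add: mult_rank_one_update_left)
    have "(g * elem_mat n j k 1) $$ (a, b) =
        (\<Sum>c<n. (if c = b then g $$ (a, c) else 0) + (if c = j then if k = b then g $$ (a, j) else 0 else 0))"
      unfolding mat_mult_entry[OF g elem_mat_carrier ab]
      using ab by (intro sum.cong) (auto simp: elem_mat_entry algebra_simps)
    also have "\<dots> = g $$ (a, b) + (if k = b then g $$ (a, j) else 0)"
      using ab jk by (simp add: sum.distrib)
    finally show "(g * elem_mat n j k 1) $$ (a, b) = (?R * g) $$ (a, b)" using 1 by simp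
  qed (use g in \<open>auto simp: rank_one_update_def elem_mat_def\<close>)
  then have "g * elem_mat n j k 1 * h = ?R * g * h" by simp
  also have "\<dots> = ?R * (g * h)" using g h by (intro assoc_mult_mat[of _ n n _ n _ n]) auto
  finally show ?thesis using hg by (simp add: right_mult_one_mat[of _ n n])
qed

lemma elem_mat_mult:
  assumes "i \<noteq> j" "j < n"
  shows "elem_mat n i j x * elem_mat n i j y = elem_mat n i j (x + y)"
  unfolding elem_mat_def using assms
  by (subst rank_one_update_add) (auto simp: unit_fun_def algebra_simps)

lemma elem_mat_0: "elem_mat n i j 0 = 1\<^sub>m n"
  by (rule eq_matI) (auto simp: elem_mat_entry)

lemma elem_mat_in_SL:
  assumes F: "subfield_set F" and x: "x \<in> F" and ij: "i < n" "j < n" "i \<noteq> j"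
  shows "elem_mat n i j x \<in> carrier (SL n F)"
proof -
  have "elem_mat n i j x = addrow_mat n x i j"
    by (rule eq_matI) (use ij in \<open>auto simp: elem_mat_entry\<close>)
  then have "Determinant.det (elem_mat n i j x) = 1" using det_addrow_mat[OF ij(3)] by simp
  then show ?thesis using x subfield_setD[OF F] by (auto simp: carrier_SL elem_mat_entry)
qed

lemma elem_mat_in_STplus:
  assumes F: "subfield_set F" and x: "x \<in> F" and ij: "i < j" "j < n"
  shows "elem_mat n i j x \<in> carrier (STplus n F)"
  using elem_mat_in_SL[OF F x, of i n j] ij by (auto simp: carrier_STplus elem_mat_entry)

definition torus_mat :: "nat \<Rightarrow> nat \<Rightarrow> nat \<Rightarrow> 'a::field \<Rightarrow> 'a mat" where
  "torus_mat n i l a = mat n n (\<lambda>(p, q). if p \<noteq> q then 0 else if p = i then a else if p = l then inverse a else 1)"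

lemma torus_mat_dim [simp]: "dim_row (torus_mat n i l a) = n" "dim_col (torus_mat n i l a) = n"
  and torus_mat_carrier [simp]: "torus_mat n i l a \<in> carrier_mat n n"
  by (simp_all add: torus_mat_def)

lemma torus_mult_entry:
  assumes "M \<in> carrier_mat n n" "p < n" "q < n"
  shows "(torus_mat n i l a * M) $$ (p, q) = torus_mat n i l a $$ (p, p) * M $$ (p, q)"
    and "(M * torus_mat n i l a) $$ (p, q) = M $$ (p, q) * torus_mat n i l a $$ (q, q)"
proof -
  have "(\<Sum>k<n. torus_mat n i l a $$ (p, k) * M $$ (k, q)) =
      (\<Sum>k<n. if k = p then torus_mat n i l a $$ (p, p) * M $$ (p, q) else 0)"
    "(\<Sum>k<n. M $$ (p, k) * torus_mat n i l a $$ (k, q)) =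
      (\<Sum>k<n. if k = q then M $$ (p, q) * torus_mat n i l a $$ (q, q) else 0)"
    by (intro sum.cong refl; use assms in \<open>simp add: torus_mat_def\<close>)+
  then show "(torus_mat n i l a * M) $$ (p, q) = torus_mat n i l a $$ (p, p) * M $$ (p, q)"
    "(M * torus_mat n i l a) $$ (p, q) = M $$ (p, q) * torus_mat n i l a $$ (q, q)"
    using assms mat_mult_entry[of "torus_mat n i l a" n M] mat_mult_entry[of M n "torus_mat n i l a"]
    by simp_all
qed

lemma torus_mat_in_STplus:
  assumes F: "subfield_set F" and a: "a \<in> F" "a \<noteq> 0" and il: "i < n" "l < n" "i \<noteq> l"
  shows "torus_mat n i l a \<in> carrier (STplus n F)"
proof -
  have c: "torus_mat n i l a \<in> carrier_mat n n" by (simp add: torus_mat_def)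
  have "upper_triangular (torus_mat n i l a)" by (auto simp: torus_mat_def)
  then have "Determinant.det (torus_mat n i l a) = (\<Prod>p<n. torus_mat n i l a $$ (p, p))"
    using det_upper_triangular[OF _ c] c
    by (simp add: diag_mat_def torus_mat_def prod.list_conv_set_nth atLeast0LessThan)
  also have "\<dots> = (\<Prod>p\<in>{i, l}. torus_mat n i l a $$ (p, p))"
    using il by (intro prod.mono_neutral_right) (auto simp: torus_mat_def)
  also have "\<dots> = 1" using il a by (simp add: torus_mat_def)
  finally show ?thesis
    using a subfield_setD[OF F] by (auto simp: carrier_STplus carrier_SL torus_mat_def)
qed

lemma torus_conj_elem_mat:
  assumes "i < n" "j < n" "l < n" "i \<noteq> j" "l \<noteq> i" "l \<noteq> j"
  shows "torus_mat n i l a * elem_mat n i j x = elem_mat n i j (a * x) * torus_mat n i l a"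
proof (rule eq_matI)
  fix p q assume "p < dim_row (elem_mat n i j (a * x) * torus_mat n i l a)"
    "q < dim_col (elem_mat n i j (a * x) * torus_mat n i l a)"
  then have pq: "p < n" "q < n" by (auto simp: elem_mat_def rank_one_update_def torus_mat_def)
  show "(torus_mat n i l a * elem_mat n i j x) $$ (p, q) =
      (elem_mat n i j (a * x) * torus_mat n i l a) $$ (p, q)"
    unfolding torus_mult_entry[OF elem_mat_carrier pq]
    using pq assms by (auto simp: elem_mat_entry torus_mat_def)
qed (auto simp: elem_mat_def rank_one_update_def torus_mat_def)


section \<open>Coarser group topologies on matrix groups\<close>

text \<open>
  \<open>H\<close> is \<open>SL(n, F)\<close>, \<open>ST\<^sup>+(n, F)\<close> or a group in between, and \<open>S\<close> is a competing group topology.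
  Entrywise convergence implies convergence in \<open>S\<close>; the aim is the converse for null nets.
\<close>

locale coarser_matrix_topology =
  fixes n :: nat and F :: "complex set" and H :: "complex mat set" and S :: "complex mat topology"
  assumes F: "subfield_set F" and n3: "n \<ge> 3"
    and H: "subgroup H (SL n UNIV)" and H_SL: "H \<subseteq> carrier (SL n F)" and ST_H: "carrier (STplus n F) \<subseteq> H"
    and tgS: "topological_group ((SL n UNIV)\<lparr>carrier := H\<rparr>) S"
    and coarser: "\<And>U. openin S U \<Longrightarrow> openin (subtopology (SL_topology n UNIV) H) U"
begin

abbreviation G :: "complex mat monoid" where
  "G \<equiv> (SL n UNIV)\<lparr>carrier := H\<rparr>"

sublocale Hausdorff_group G S
  by (intro Hausdorff_group.intro Hausdorff_group_axioms.intro tgS)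
    (use tgS in \<open>simp add: topological_group_def\<close>)

lemma H_carrier_mat: "g \<in> H \<Longrightarrow> g \<in> carrier_mat n n"
  using H_SL by (auto simp: carrier_SL)

lemma H_entry: "g \<in> H \<Longrightarrow> i < n \<Longrightarrow> j < n \<Longrightarrow> g $$ (i, j) \<in> F"
  using H_SL by (auto simp: carrier_SL)

lemma H_det: "g \<in> H \<Longrightarrow> Determinant.det g = 1"
  using H_SL by (auto simp: carrier_SL)

lemma H_mult: "g \<in> H \<Longrightarrow> h \<in> H \<Longrightarrow> g * h \<in> H"
  using m_closed[of g h] by simp

lemma H_one: "1\<^sub>m n \<in> H"
  using one_closed by simp

lemma H_inv: "g \<in> H \<Longrightarrow> inv\<^bsub>G\<^esub> g \<in> H" "g \<in> H \<Longrightarrow> inv\<^bsub>G\<^esub> g * g = 1\<^sub>m n" "g \<in> H \<Longrightarrow> g * inv\<^bsub>G\<^esub> g = 1\<^sub>m n"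
  using inv_closed[of g] l_inv[of g] r_inv[of g] by simp_all

lemma null_iff: "null \<Phi> f \<longleftrightarrow> (\<forall>x. f x \<in> H) \<and> limitin S f (1\<^sub>m n) \<Phi>"
  by (simp add: null_def)

lemma nhd_conj_comm:
  assumes "openin S U" "1\<^sub>m n \<in> U"
  obtains V where "openin S V" "1\<^sub>m n \<in> V"
    "\<And>a b. a \<in> V \<Longrightarrow> b \<in> V \<Longrightarrow> a * b * inv\<^bsub>G\<^esub> a \<in> U" "\<And>a b. a \<in> V \<Longrightarrow> b \<in> V \<Longrightarrow> comm a b \<in> U"
proof -
  have one: "\<one>\<^bsub>G\<^esub> = 1\<^sub>m n" and mult: "a \<otimes>\<^bsub>G\<^esub> b = a * b" for a b by simp_all
  show thesis
    by (rule nhd_comm[of U]) (use assms that in \<open>simp_all only: one mult\<close>)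
qed

lemma limitin_mono: "limitin S f a \<Phi> \<Longrightarrow> \<Phi>' \<le> \<Phi> \<Longrightarrow> limitin S f a \<Phi>'"
  by (auto simp: limitin_def le_filter_def)

lemma null_mono: "null \<Phi> f \<Longrightarrow> \<Phi>' \<le> \<Phi> \<Longrightarrow> null \<Phi>' f"
  by (auto simp: null_iff intro: limitin_mono)

lemma limitin_of_entries:
  assumes "a \<in> H" "\<forall>\<^sub>F x in \<Phi>. f x \<in> H"
    and "\<And>i j. i < n \<Longrightarrow> j < n \<Longrightarrow> ((\<lambda>x. f x $$ (i, j)) \<longlongrightarrow> a $$ (i, j)) \<Phi>"
  shows "limitin S f a \<Phi>"
proof -
  have "H \<subseteq> carrier (SL n UNIV)" using H_SL carrier_SL_UNIV by blast
  then have "limitin (subtopology (SL_topology n UNIV) H) f a \<Phi>"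
    unfolding limitin_subtopology limitin_SL_topology
    using assms by (auto elim: eventually_mono)
  then show ?thesis
    unfolding limitin_def using coarser assms(1) by (simp add: topspace_eq)
qed

lemma null_of_entries:
  assumes "\<And>x. f x \<in> H"
    and "\<And>i j. i < n \<Longrightarrow> j < n \<Longrightarrow> ((\<lambda>x. f x $$ (i, j)) \<longlongrightarrow> (if i = j then 1 else 0)) \<Phi>"
  shows "null \<Phi> f"
  using limitin_of_entries[OF H_one, of f \<Phi>] assms by (simp add: null_iff)

text \<open>
  The pairs \<open>(i, j)\<close> whose root subgroup lies in \<open>H\<close>: those with \<open>i < j\<close> for \<open>ST\<^sup>+(n, F)\<close>, and all
  pairs \<open>i \<noteq> j\<close> for \<open>SL(n, F)\<close>.
\<close>

definition is_root :: "nat \<Rightarrow> nat \<Rightarrow> bool" where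
  "is_root i j \<longleftrightarrow> i < n \<and> j < n \<and> i \<noteq> j \<and> (\<forall>x\<in>F. elem_mat n i j x \<in> H)"

lemma rootD: "is_root i j \<Longrightarrow> i < n" "is_root i j \<Longrightarrow> j < n" "is_root i j \<Longrightarrow> i \<noteq> j"
  "is_root i j \<Longrightarrow> x \<in> F \<Longrightarrow> elem_mat n i j x \<in> H"
  by (auto simp: is_root_def)

lemma root_upper: "i < j \<Longrightarrow> j < n \<Longrightarrow> is_root i j"
  using ST_H elem_mat_in_STplus[OF F] by (auto simp: is_root_def)

lemma inv_elem_mat:
  assumes "is_root i j" "x \<in> F"
  shows "inv\<^bsub>G\<^esub> (elem_mat n i j x) = elem_mat n i j (- x)"
  using inv_equality[of "elem_mat n i j (- x)" "elem_mat n i j x"] rootD[OF assms(1)] assms(2) subfield_setD[OF F]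
  by (simp add: elem_mat_mult elem_mat_0)

lemma limitin_elem_mat:
  assumes "is_root i j" "\<forall>\<^sub>F x in \<Phi>. r x \<in> F" "(r \<longlongrightarrow> 0) \<Phi>"
  shows "limitin S (\<lambda>x. elem_mat n i j (r x)) (1\<^sub>m n) \<Phi>"
proof (rule limitin_of_entries[OF H_one])
  show "\<forall>\<^sub>F x in \<Phi>. elem_mat n i j (r x) \<in> H"
    using assms(2) by eventually_elim (rule rootD[OF assms(1)])
  show "((\<lambda>x. elem_mat n i j (r x) $$ (a, b)) \<longlongrightarrow> 1\<^sub>m n $$ (a, b)) \<Phi>" if "a < n" "b < n" for a b
    using that tendsto_add[OF tendsto_const[of 1] assms(3)] assms(3)
    by (cases "a = i"; cases "b = j"; cases "a = b") (simp_all add: elem_mat_entry)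
qed

lemma nat_in_F: "of_nat m \<in> F"
  by (induction m) (auto simp: subfield_setD[OF F])

lemma tendsto_F: "((\<lambda>x. x) \<longlongrightarrow> 0) (inf (nhds 0) (principal F))"
  by (rule tendsto_mono[OF inf_le1]) (simp add: filterlim_ident)

lemma eventually_F: "\<forall>\<^sub>F x in inf (nhds 0) (principal F). x \<in> F"
  by (simp add: eventually_inf_principal)

lemma eventually_near_0:
  "(\<forall>\<^sub>F x in inf (nhds (0::complex)) (principal F). P x) \<longleftrightarrow> (\<exists>\<epsilon>>0. \<forall>x\<in>F. norm x < \<epsilon> \<longrightarrow> P x)"
  unfolding eventually_inf_principal eventually_nhds_metric by (auto simp: dist_norm)

text \<open>
  A torus element \<open>D(a)\<close> multiplies the coordinate of \<open>E(x)\<close> by \<open>a\<close>, so that the commutator of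
  \<open>D(1 + a)\<close> and \<open>E(x)\<close> is \<open>E(a x)\<close>.  Take a neighbourhood \<open>U\<close> of the identity without \<open>E(1)\<close>.
  As \<open>D(1 + a)\<close> tends to the identity for \<open>a \<rightarrow> 0\<close>, continuity of the commutator yields a
  neighbourhood \<open>V\<close> and a \<open>\<delta>\<close> such that \<open>E(a x) \<in> U\<close> whenever \<open>E(x) \<in> V\<close> and \<open>|a| < \<delta>\<close>.  Then \<open>E(x) \<in> V\<close>
  forces \<open>|x| \<le> 1 / \<delta>\<close>, because otherwise \<open>a = 1 / x\<close> is admissible.  Conjugating by \<open>D(t)\<close> with \<open>t\<close>
  large turns this bound into arbitrarily small ones.
\<close>

lemma tendsto_0_if_limitin_elem_mat:
  assumes ij: "is_root i j" and r: "\<forall>\<^sub>F x in \<Phi>. r x \<in> F"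
    and lim: "limitin S (\<lambda>x. elem_mat n i j (r x)) (1\<^sub>m n) \<Phi>"
  shows "(r \<longlongrightarrow> 0) \<Phi>"
proof -
  note ij' = rootD[OF ij] and Fs = subfield_setD[OF F]
  have "\<exists>l<n. l \<noteq> i \<and> l \<noteq> j"
  proof -
    have "\<not> {..<n} \<subseteq> {i, j}"
      using n3 card_mono[of "{i, j}" "{..<n}"] by (auto simp: card_insert_if split: if_splits)
    then show ?thesis by auto
  qed
  then obtain l where l: "l < n" "l \<noteq> i" "l \<noteq> j" by blast
  let ?E = "elem_mat n i j :: complex \<Rightarrow> complex mat" and ?D = "torus_mat n i l :: complex \<Rightarrow> complex mat"
  have D: "?D a \<in> H" if "a \<in> F" "a \<noteq> 0" for a
    using torus_mat_in_STplus[OF F that ij'(1) l(1)] l ST_H by auto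
  have conj: "?D a * ?E x * inv\<^bsub>G\<^esub> (?D a) = ?E (a * x)" if "a \<in> F" "a \<noteq> 0" "x \<in> F" for a x
  proof -
    have "?D a * ?E x * inv\<^bsub>G\<^esub> (?D a) = ?E (a * x) * ?D a * inv\<^bsub>G\<^esub> (?D a)"
      by (simp only: torus_conj_elem_mat[OF ij'(1,2) l(1) ij'(3) l(2,3)])
    also have "\<dots> = ?E (a * x) * (?D a * inv\<^bsub>G\<^esub> (?D a))"
      using H_carrier_mat[OF H_inv(1)[OF D[OF that(1,2)]]]
      by (intro assoc_mult_mat[of _ n n _ n _ n]) auto
    finally show ?thesis using H_inv(3)[OF D[OF that(1,2)]] by (simp add: right_mult_one_mat[of _ n n])
  qed
  have E1: "?E 1 \<noteq> 1\<^sub>m n" "?E 1 \<in> H"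
  proof -
    have "?E 1 $$ (i, j) \<noteq> 1\<^sub>m n $$ (i, j)" using ij' by (simp add: elem_mat_entry)
    then show "?E 1 \<noteq> 1\<^sub>m n" by auto
    show "?E 1 \<in> H" by (rule ij'(4)[OF Fs(2)])
  qed
  then obtain U U' where U: "openin S U" "1\<^sub>m n \<in> U" "?E 1 \<in> U'" "disjnt U U'"
    using Hausdorff H_one unfolding Hausdorff_space_def topspace_eq by simp metis
  obtain V where V: "openin S V" "1\<^sub>m n \<in> V"
    "\<And>a b. a \<in> V \<Longrightarrow> b \<in> V \<Longrightarrow> comm a b \<in> U"
    using nhd_conj_comm[OF U(1,2)] by metis
  let ?\<Psi> = "inf (nhds (0::complex)) (principal F)"
  have "\<forall>\<^sub>F a in ?\<Psi>. norm a < 1" unfolding eventually_near_0 by (intro exI[of _ 1]) simp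
  moreover have "limitin S (\<lambda>a. ?D (if 1 + a = 0 then 1 else 1 + a)) (1\<^sub>m n) ?\<Psi>"
  proof (rule limitin_of_entries[OF H_one])
    show "\<forall>\<^sub>F a in ?\<Psi>. ?D (if 1 + a = 0 then 1 else 1 + a) \<in> H"
      using eventually_F by eventually_elim (rule D, auto simp: Fs)
    have lim1: "((\<lambda>a. if 1 + a = 0 then 1 else 1 + a) \<longlongrightarrow> (1::complex)) ?\<Psi>"
    proof (rule Lim_transform_eventually)
      show "((\<lambda>a. 1 + a) \<longlongrightarrow> (1::complex)) ?\<Psi>" using tendsto_add[OF tendsto_const[of 1] tendsto_F] by simp
      show "\<forall>\<^sub>F a in ?\<Psi>. 1 + a = (if 1 + a = 0 then 1 else 1 + a)"
        unfolding eventually_near_0 by (intro exI[of _ 1]) (auto simp: add_eq_0_iff)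
    qed
    show "((\<lambda>a. ?D (if 1 + a = 0 then 1 else 1 + a) $$ (p, q)) \<longlongrightarrow> 1\<^sub>m n $$ (p, q)) ?\<Psi>"
      if "p < n" "q < n" for p q
      using that lim1 tendsto_inverse[OF lim1]
      by (cases "p = q"; cases "p = i"; cases "p = l") (simp_all add: torus_mat_def)
  qed
  from limitinD[OF this V(1,2)]
  have "\<forall>\<^sub>F a in ?\<Psi>. ?D (if 1 + a = 0 then 1 else 1 + a) \<in> V" .
  ultimately have "\<forall>\<^sub>F a in ?\<Psi>. ?D (1 + a) \<in> V \<and> 1 + a \<noteq> 0"
    by eventually_elim (auto simp: add_eq_0_iff split: if_splits)
  then obtain \<delta> where \<delta>: "\<delta> > 0" "\<And>a. a \<in> F \<Longrightarrow> norm a < \<delta> \<Longrightarrow> ?D (1 + a) \<in> V \<and> 1 + a \<noteq> 0"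
    unfolding eventually_near_0 by blast
  have bound: "norm x \<le> 1 / \<delta>" if x: "x \<in> F" "?E x \<in> V" for x
  proof (rule ccontr)
    assume "\<not> norm x \<le> 1 / \<delta>"
    then have nx: "norm x > 1 / \<delta>" by simp
    then have x0: "x \<noteq> 0" using \<delta>(1) by auto
    \<comment> \<open>the scalar that moves \<open>E(x)\<close> to \<open>E(1)\<close>\<close>
    define a where "a = inverse x"
    have na: "norm a = 1 / norm x" by (simp add: a_def norm_divide inverse_eq_divide)
    have a: "a \<in> F" "norm a < \<delta>"
    proof -
      show "a \<in> F" unfolding a_def by (rule Fs(6)[OF x(1)])
      show "norm a < \<delta>" unfolding na using nx \<delta>(1) x0 by (simp add: field_simps)
    qed
    have Da: "?D (1 + a) \<in> V" "1 + a \<noteq> 0" "1 + a \<in> F" using \<delta>(2)[OF a] Fs(2) Fs(3) a(1) by auto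
    have "comm (?D (1 + a)) (?E x) = ?E ((1 + a) * x) * inv\<^bsub>G\<^esub> (?E x)"
      using conj[OF Da(3,2) x(1)] by (simp add: comm_def)
    also have "\<dots> = ?E (a * x)"
      using x(1) Fs ij' by (simp add: inv_elem_mat[OF ij x(1)] elem_mat_mult algebra_simps)
    also have "\<dots> = ?E 1" using x0 by (simp add: a_def)
    finally have "?E 1 \<in> U" using V(3)[OF Da(1) x(2)] by simp
    then show False using U unfolding disjnt_def by auto
  qed
  show ?thesis
  proof (rule tendstoI)
    fix e :: real assume e: "e > 0"
    obtain t :: nat where t: "real t > 1 / (\<delta> * e)" using reals_Archimedean2 by blast
    have "real t > 0" by (rule less_trans[OF _ t]) (use \<delta>(1) e in simp)
    then have tF: "of_nat t \<in> F" "(of_nat t :: complex) \<noteq> 0" using nat_in_F by auto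
    have "limitin S (\<lambda>x. ?D (of_nat t)) (?D (of_nat t)) \<Phi>" "limitin S (\<lambda>x. inv\<^bsub>G\<^esub> (?D (of_nat t))) (inv\<^bsub>G\<^esub> (?D (of_nat t))) \<Phi>"
      using D[OF tF] H_inv(1)[OF D[OF tF]] by (simp_all add: topspace_eq)
    note limitin_mult[OF limitin_mult[OF this(1) lim] this(2)]
    then have "limitin S (\<lambda>x. ?D (of_nat t) * ?E (r x) * inv\<^bsub>G\<^esub> (?D (of_nat t))) (1\<^sub>m n) \<Phi>"
      using D[OF tF] by (simp add: H_inv H_carrier_mat right_mult_one_mat[of _ n n])
    from limitinD[OF this V(1,2)] r
    show "\<forall>\<^sub>F x in \<Phi>. dist (r x) 0 < e"
    proof eventually_elim
      case (elim x)
      then have "?E (of_nat t * r x) \<in> V" using conj[OF tF] by simp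
      then have "norm (of_nat t * r x) \<le> 1 / \<delta>" using elim(2) tF Fs by (intro bound) auto
      then have "real t * norm (r x) \<le> 1 / \<delta>" by (simp add: norm_mult)
      also have "\<dots> < real t * e" using t \<delta>(1) e by (simp add: field_simps)
      finally show ?case using \<open>real t > 0\<close> by simp
    qed
  qed
qed

text \<open>
  Conjugation by \<open>E(r)\<close> is equicontinuous for \<open>|r| \<le> 1\<close> because finitely many \<open>r\<close> approximate all of
  them.
\<close>

lemma tame_elem_mat:
  assumes ij: "is_root i j" and r: "\<And>x. r x \<in> F" "\<And>x. norm (r x) \<le> 1"
  shows "tame \<Phi> (\<lambda>x. elem_mat n i j (r x))"
proof -
  note ij' = rootD[OF ij] and Fs = subfield_setD[OF F]
  let ?E = "elem_mat n i j :: complex \<Rightarrow> complex mat"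
  have main: "null \<Phi> (\<lambda>x. ?E (r x) * y x * inv\<^bsub>G\<^esub> (?E (r x)))"
    if r: "\<And>x. r x \<in> F" "\<And>x. norm (r x) \<le> 1" and y: "null \<Phi> y" for r and y
    unfolding null_iff
  proof
    have yH: "y x \<in> H" for x using null_closed[OF y] by simp
    show "\<forall>x. ?E (r x) * y x * inv\<^bsub>G\<^esub> (?E (r x)) \<in> H"
      using yH r ij' by (auto intro!: H_mult H_inv)
    show "limitin S (\<lambda>x. ?E (r x) * y x * inv\<^bsub>G\<^esub> (?E (r x))) (1\<^sub>m n) \<Phi>"
      unfolding limitin_def
    proof (intro conjI allI impI)
      show "1\<^sub>m n \<in> topspace S" using H_one by (simp add: topspace_eq)
      fix U assume U: "openin S U \<and> 1\<^sub>m n \<in> U"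
      obtain V where V: "openin S V" "1\<^sub>m n \<in> V"
        "\<And>a b. a \<in> V \<Longrightarrow> b \<in> V \<Longrightarrow> a * b * inv\<^bsub>G\<^esub> a \<in> U"
        using nhd_conj_comm[of U] U by metis
      have "\<forall>\<^sub>F a in inf (nhds 0) (principal F). ?E a \<in> V"
        by (rule limitinD[OF limitin_elem_mat[OF ij eventually_F tendsto_F] V(1,2)])
      then obtain \<epsilon> where \<epsilon>: "\<epsilon> > 0" "\<And>a. a \<in> F \<Longrightarrow> norm a < \<epsilon> \<Longrightarrow> ?E a \<in> V"
        unfolding eventually_near_0 by blast
      obtain K where K: "finite K" "K \<subseteq> F" "\<And>a. a \<in> F \<Longrightarrow> norm a \<le> 1 \<Longrightarrow> \<exists>c\<in>K. norm (a - c) < \<epsilon>"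
      proof -
        have "cball (0::complex) 1 \<subseteq> (\<Union>b\<in>UNIV. ball b (\<epsilon> / 2))"
        proof
          fix y :: complex
          show "y \<in> (\<Union>b\<in>UNIV. ball b (\<epsilon> / 2))" using \<epsilon>(1) by (intro UN_I[of y]) auto
        qed
        then obtain B where B: "finite B" "cball (0::complex) 1 \<subseteq> (\<Union>b\<in>B. ball b (\<epsilon> / 2))"
          by (rule compactE_image[OF compact_cball, rotated]) auto
        define c where "c b = (SOME a. a \<in> F \<and> a \<in> ball b (\<epsilon> / 2))" for b
        show thesis
        proof (rule that[of "c ` {b \<in> B. \<exists>a. a \<in> F \<and> a \<in> ball b (\<epsilon> / 2)}"])
          have c: "c b \<in> F \<and> c b \<in> ball b (\<epsilon> / 2)" if "\<exists>a. a \<in> F \<and> a \<in> ball b (\<epsilon> / 2)" for b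
            unfolding c_def using that by (rule someI_ex)
          then show "c ` {b \<in> B. \<exists>a. a \<in> F \<and> a \<in> ball b (\<epsilon> / 2)} \<subseteq> F" by blast
          fix a assume a: "a \<in> F" "norm a \<le> 1"
          then obtain b where b: "b \<in> B" "a \<in> ball b (\<epsilon> / 2)" using B(2) by fastforce
          then have "c b \<in> ball b (\<epsilon> / 2)" using c a by blast
          then have "dist a (c b) < \<epsilon>"
            using b(2) dist_triangle_half_r[of b a \<epsilon> "c b"] by simp
          then show "\<exists>c\<in>c ` {b \<in> B. \<exists>a. a \<in> F \<and> a \<in> ball b (\<epsilon> / 2)}. norm (a - c) < \<epsilon>"
            using a b by (auto simp: dist_norm)
        qed (use B in simp)
      qed
      have "\<forall>\<^sub>F x in \<Phi>. ?E c * y x * inv\<^bsub>G\<^esub> (?E c) \<in> V" if c: "c \<in> K" for c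
      proof -
        have "tame \<Phi> (\<lambda>_. ?E c)" using c K(2) ij' by (intro tame_const) auto
        then have "null \<Phi> (\<lambda>x. ?E c * y x * inv\<^bsub>G\<^esub> (?E c))" using y unfolding tame_def by simp
        then have "limitin S (\<lambda>x. ?E c * y x * inv\<^bsub>G\<^esub> (?E c)) (1\<^sub>m n) \<Phi>"
          by (simp add: null_iff)
        from limitinD[OF this V(1,2)] show ?thesis .
      qed
      then have "\<forall>\<^sub>F x in \<Phi>. \<forall>c\<in>K. ?E c * y x * inv\<^bsub>G\<^esub> (?E c) \<in> V"
        using K(1) by (simp add: eventually_ball_finite)
      then show "\<forall>\<^sub>F x in \<Phi>. ?E (r x) * y x * inv\<^bsub>G\<^esub> (?E (r x)) \<in> U"
      proof eventually_elim
        case (elim x)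
        obtain c where c: "c \<in> K" "norm (r x - c) < \<epsilon>" using K(3)[OF r] by blast
        have cF: "c \<in> F" "r x - c \<in> F" using c K(2) r Fs by auto
        have EH: "?E c \<in> H" "?E (r x - c) \<in> H" using cF ij' by auto
        have "?E (r x - c) * (?E c * y x * inv\<^bsub>G\<^esub> (?E c)) * inv\<^bsub>G\<^esub> (?E (r x - c)) \<in> U"
          using V(3)[OF \<epsilon>(2)[OF cF(2) c(2)]] elim c(1) by blast
        also have "?E (r x - c) * (?E c * y x * inv\<^bsub>G\<^esub> (?E c)) * inv\<^bsub>G\<^esub> (?E (r x - c)) =
            (?E (r x - c) * ?E c) * y x * inv\<^bsub>G\<^esub> (?E (r x - c) * ?E c)"
          using EH yH[of x] inv_mult_group[of "?E (r x - c)" "?E c"] m_assoc by (simp add: H_mult H_inv)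
        also have "?E (r x - c) * ?E c = ?E (r x)" using ij' by (simp add: elem_mat_mult)
        finally show ?case .
      qed
    qed
  qed
  have "null \<Phi> (\<lambda>x. inv\<^bsub>G\<^esub> (?E (r x)) * y x * ?E (r x))" if "null \<Phi> y" for y
    using main[of "\<lambda>x. - r x" y] that r Fs ij' by (simp add: inv_elem_mat[OF ij])
  then show ?thesis unfolding tame_def using main[OF r] r ij' by simp
qed

lemma comm_rank_one_updates:
  assumes "rank_one_update n u v \<in> H" "rank_one_update n w \<phi> \<in> H" "dot n \<phi> u = 0" "dot n \<phi> w = 0"
  shows "comm (rank_one_update n u v) (rank_one_update n w \<phi>) = rank_one_update n (\<lambda>a. dot n v w * u a) \<phi>"
    (is "comm ?A ?B = ?C")
proof -
  have BA: "?B * ?A \<in> H" using assms by (simp add: H_mult)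
  have "?C = ?C * ((?B * ?A) * inv\<^bsub>G\<^esub> (?B * ?A))"
    using H_inv(3)[OF BA] by (simp add: right_mult_one_mat[of _ n n])
  also have "\<dots> = (?C * (?B * ?A)) * inv\<^bsub>G\<^esub> (?B * ?A)"
    using H_carrier_mat[OF BA] H_carrier_mat[OF H_inv(1)[OF BA]]
    by (intro assoc_mult_mat[symmetric, of _ n n _ n _ n]) auto
  also have "\<dots> = (?A * ?B) * inv\<^bsub>G\<^esub> (?B * ?A)"
    using rank_one_update_commutation[OF assms(3,4)] by simp
  finally have "?C \<in> H" using assms(1,2) BA by (metis H_mult H_inv(1))
  then show ?thesis
    using assms(1,2) rank_one_update_commutation[OF assms(3,4)] by (intro comm_eqI) simp_all
qed

lemma minus_one_in_H:
  assumes "even n"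
  shows "- 1\<^sub>m n \<in> H"
proof -
  have "- 1\<^sub>m n = (- 1 :: complex) \<cdot>\<^sub>m 1\<^sub>m n" by (rule eq_matI) auto
  then have "Determinant.det (- 1\<^sub>m n :: complex mat) = 1" using assms by simp
  then have "- 1\<^sub>m n \<in> carrier (STplus n F)"
    using subfield_setD[OF F] by (auto simp: carrier_STplus carrier_SL)
  then show ?thesis using ST_H by blast
qed

text \<open>
  Once \<open>c\<^sup>2\<close> is known to tend to \<open>1\<close>, the only alternative to \<open>c \<rightarrow> 1\<close> is \<open>c \<rightarrow> -1\<close> along a finer filter.
  But then \<open>f\<close> tends to \<open>- I\<close> entrywise, hence also in \<open>S\<close>, where its limit is \<open>I\<close>.
\<close>

lemma scalar_tendsto_1:
  assumes "even n" "null \<Phi> f"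
    and "\<And>i j. i < n \<Longrightarrow> j < n \<Longrightarrow> ((\<lambda>x. c x * f x $$ (i, j)) \<longlongrightarrow> (if i = j then 1 else 0)) \<Phi>"
    and "((\<lambda>x. c x ^ (2 ^ k)) \<longlongrightarrow> 1) \<Phi>"
  shows "(c \<longlongrightarrow> 1) \<Phi>"
  using assms(2-4)
proof (induction k arbitrary: f c)
  case 0
  then show ?case by simp
next
  case (Suc k)
  have fH: "f x \<in> H" for x using Suc.prems(1) by (simp add: null_iff)
  have "((\<lambda>x. (c x)\<^sup>2) \<longlongrightarrow> 1) \<Phi>"
  proof (rule Suc.IH[of "\<lambda>x. f x * f x"])
    show "null \<Phi> (\<lambda>x. f x * f x)" using null_mult[OF Suc.prems(1) Suc.prems(1)] by simp
    show "((\<lambda>x. (c x)\<^sup>2 ^ (2 ^ k)) \<longlongrightarrow> 1) \<Phi>"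
      using Suc.prems(3) by (simp add: power_mult[symmetric])
    fix i j assume ij: "i < n" "j < n"
    have "((\<lambda>x. \<Sum>k<n. (c x * f x $$ (i, k)) * (c x * f x $$ (k, j))) \<longlongrightarrow>
        (\<Sum>k<n. (if i = k then 1 else 0) * (if k = j then 1 else 0))) \<Phi>"
      using ij by (intro tendsto_sum tendsto_mult Suc.prems(2)) auto
    also have "(\<Sum>k<n. (if i = k then 1 else 0) * (if k = j then 1 else 0)) = (if i = j then 1 else (0::complex))"
      using ij by (simp add: if_distrib[of "\<lambda>x. x * _"] cong: if_cong)
    also have "(\<lambda>x. \<Sum>k<n. (c x * f x $$ (i, k)) * (c x * f x $$ (k, j))) = (\<lambda>x. (c x)\<^sup>2 * (f x * f x) $$ (i, j))"
      using mat_mult_entry[OF H_carrier_mat[OF fH] H_carrier_mat[OF fH] ij]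
      by (simp add: sum_distrib_left power2_eq_square ac_simps)
    finally show "((\<lambda>x. (c x)\<^sup>2 * (f x * f x) $$ (i, j)) \<longlongrightarrow> (if i = j then 1 else 0)) \<Phi>" .
  qed
  then have "((\<lambda>x. (c x)\<^sup>2 - 1) \<longlongrightarrow> 1 - 1) \<Phi>" by (intro tendsto_intros)
  then have "((\<lambda>x. norm ((c x)\<^sup>2 - 1)) \<longlongrightarrow> 0) \<Phi>" by (simp add: tendsto_norm_zero)
  then have sq: "((\<lambda>x. sqrt (norm ((c x)\<^sup>2 - 1))) \<longlongrightarrow> 0) \<Phi>"
    using tendsto_real_sqrt by fastforce
  have prod: "norm ((c x)\<^sup>2 - 1) = norm (c x + 1) * norm (c x - 1)" for x
    by (simp add: norm_mult[symmetric] power2_eq_square algebra_simps)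
  \<comment> \<open>where \<open>c x\<close> is at least as close to \<open>-1\<close> as to \<open>1\<close>\<close>
  let ?P = "\<lambda>x. norm (c x + 1) \<le> norm (c x - 1)"
  define \<Phi>' where "\<Phi>' = inf \<Phi> (principal {x. ?P x})"
  have le: "\<Phi>' \<le> \<Phi>" unfolding \<Phi>'_def by simp
  have "((\<lambda>x. norm (c x + 1)) \<longlongrightarrow> 0) \<Phi>'"
  proof (rule real_tendsto_sandwich[OF _ _ tendsto_const tendsto_mono[OF le sq]])
    show "\<forall>\<^sub>F x in \<Phi>'. norm (c x + 1) \<le> sqrt (norm ((c x)\<^sup>2 - 1))"
      unfolding \<Phi>'_def eventually_inf_principal prod
      by (intro always_eventually allI impI real_le_rsqrt) (auto simp: power2_eq_square intro: mult_left_mono)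
  qed simp
  then have "((\<lambda>x. c x + 1) \<longlongrightarrow> 0) \<Phi>'" by (rule tendsto_norm_zero_cancel)
  from tendsto_diff[OF this tendsto_const[of 1]] have cm: "(c \<longlongrightarrow> - 1) \<Phi>'" by simp
  have "limitin S f (- 1\<^sub>m n) \<Phi>'"
  proof (rule limitin_of_entries)
    show "- 1\<^sub>m n \<in> H" by (rule minus_one_in_H[OF assms(1)])
    fix i j assume ij: "i < n" "j < n"
    have "((\<lambda>x. c x * f x $$ (i, j) / c x) \<longlongrightarrow> (if i = j then 1 else 0) / (- 1)) \<Phi>'"
      by (intro tendsto_divide tendsto_mono[OF le Suc.prems(2)] ij cm) simp
    moreover have "\<forall>\<^sub>F x in \<Phi>'. c x \<noteq> 0"
      using cm by (rule tendsto_imp_eventually_ne) simp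
    then have "\<forall>\<^sub>F x in \<Phi>'. c x * f x $$ (i, j) / c x = f x $$ (i, j)" by eventually_elim simp
    ultimately have "((\<lambda>x. f x $$ (i, j)) \<longlongrightarrow> (if i = j then 1 else 0) / (- 1)) \<Phi>'"
      by (rule Lim_transform_eventually)
    then show "((\<lambda>x. f x $$ (i, j)) \<longlongrightarrow> (- 1\<^sub>m n) $$ (i, j)) \<Phi>'" using ij by (auto split: if_splits)
  qed (simp add: fH)
  moreover have "limitin S f (1\<^sub>m n) \<Phi>'"
    using null_mono[OF Suc.prems(1) le] by (simp add: null_iff)
  moreover have "- 1\<^sub>m n \<noteq> (1\<^sub>m n :: complex mat)"
  proof
    assume e: "- 1\<^sub>m n = (1\<^sub>m n :: complex mat)"
    have "(- 1\<^sub>m n) $$ (0, 0) = (1\<^sub>m n :: complex mat) $$ (0, 0)" using e by simp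
    then show False using n3 by simp
  qed
  ultimately have "\<Phi>' = bot" using limitin_Hausdorff_unique[OF _ _ _ Hausdorff] by blast
  then have "\<forall>\<^sub>F x in \<Phi>. \<not> ?P x"
    unfolding \<Phi>'_def trivial_limit_def eventually_inf_principal
    using eventually_inf_principal[of "\<lambda>_. False" \<Phi> "{x. ?P x}"] by (simp add: \<Phi>'_def)
  have "((\<lambda>x. norm (c x - 1)) \<longlongrightarrow> 0) \<Phi>"
  proof (rule real_tendsto_sandwich[OF _ _ tendsto_const sq])
    show "\<forall>\<^sub>F x in \<Phi>. norm (c x - 1) \<le> sqrt (norm ((c x)\<^sup>2 - 1))"
      using \<open>\<forall>\<^sub>F x in \<Phi>. \<not> ?P x\<close> unfolding prod
      by eventually_elim (intro real_le_rsqrt, auto simp: power2_eq_square intro: mult_right_mono)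
  qed simp
  then have "((\<lambda>x. c x - 1) \<longlongrightarrow> 0) \<Phi>" by (rule tendsto_norm_zero_cancel)
  from tendsto_add[OF this tendsto_const[of 1]] show ?case by simp
qed

text \<open>
  The scalar \<open>c\<close> is controlled by the determinant: \<open>det (c f) = c\<^sup>n\<close> tends to \<open>1\<close>.
\<close>

lemma entries_of_null_if_scalar_multiple:
  assumes n: "n = 2 ^ k" and f: "null \<Phi> f"
    and lim: "\<And>i j. i < n \<Longrightarrow> j < n \<Longrightarrow> ((\<lambda>x. c x * f x $$ (i, j)) \<longlongrightarrow> (if i = j then 1 else 0)) \<Phi>"
    and ij: "i < n" "j < n"
  shows "((\<lambda>x. f x $$ (i, j)) \<longlongrightarrow> (if i = j then 1 else 0)) \<Phi>"
proof -
  have fH: "f x \<in> H" for x using f by (simp add: null_iff)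
  have "((\<lambda>x. Determinant.det (c x \<cdot>\<^sub>m f x)) \<longlongrightarrow> Determinant.det (1\<^sub>m n :: complex mat)) \<Phi>"
  proof (rule tendsto_det[where n = n])
    show "((\<lambda>x. (c x \<cdot>\<^sub>m f x) $$ (i, j)) \<longlongrightarrow> 1\<^sub>m n $$ (i, j)) \<Phi>" if "i < n" "j < n" for i j
      using lim[OF that] that carrier_matD[OF H_carrier_mat[OF fH]] by simp
  qed (use H_carrier_mat[OF fH] in auto)
  moreover have "Determinant.det (c x \<cdot>\<^sub>m f x) = c x ^ n" for x
    using H_carrier_mat[OF fH[of x]] H_det[OF fH[of x]] by simp
  ultimately have "((\<lambda>x. c x ^ (2 ^ k)) \<longlongrightarrow> 1) \<Phi>" by (simp add: n)
  moreover have "even n" using n n3 by (cases k) auto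
  ultimately have c: "(c \<longlongrightarrow> 1) \<Phi>" using scalar_tendsto_1[OF _ f lim] by blast
  have "((\<lambda>x. c x * f x $$ (i, j) / c x) \<longlongrightarrow> (if i = j then 1 else 0) / 1) \<Phi>"
    by (intro tendsto_divide lim ij c) simp
  moreover have "\<forall>\<^sub>F x in \<Phi>. c x \<noteq> 0"
    using c by (rule tendsto_imp_eventually_ne) simp
  then have "\<forall>\<^sub>F x in \<Phi>. c x * f x $$ (i, j) / c x = f x $$ (i, j)" by eventually_elim simp
  ultimately show ?thesis by (simp add: Lim_transform_eventually)
qed

text \<open>
  By homogeneity, it suffices to compare the two topologies at the identity, where null nets decide.
\<close>

lemma eq_subtopology_if_null_entries:
  assumes null: "\<And>(f :: complex mat \<Rightarrow> complex mat) \<Phi> i j. null \<Phi> f \<Longrightarrow> i < n \<Longrightarrow> j < n \<Longrightarrow>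
      ((\<lambda>x. f x $$ (i, j)) \<longlongrightarrow> (if i = j then 1 else 0)) \<Phi>"
  shows "S = subtopology (SL_topology n UNIV) H"
proof -
  let ?T = "subtopology (SL_topology n (UNIV :: complex set)) H"
  have HU: "H \<subseteq> carrier (SL n UNIV)" using H_SL carrier_SL_UNIV by blast
  have "openin S U" if U: "openin ?T U" for U
  proof (subst openin_subopen, intro ballI)
    fix g assume g: "g \<in> U"
    have gH: "g \<in> H" using openin_subset[OF U] g by auto
    let ?\<Phi> = "nhdsin S g"
    define f where "f x = (if x \<in> H then inv\<^bsub>G\<^esub> g * x else 1\<^sub>m n)" for x
    have evH: "\<forall>\<^sub>F x in ?\<Phi>. x \<in> H"
      unfolding eventually_nhdsin using gH openin_topspace[of S] by (auto simp: topspace_eq)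
    have id: "limitin S (\<lambda>x. x) g ?\<Phi>"
      using gH by (auto simp: limitin_def eventually_nhdsin topspace_eq)
    have "null ?\<Phi> f"
      unfolding null_iff
    proof
      show "\<forall>x. f x \<in> H" using gH H_mult H_inv H_one by (auto simp: f_def)
      have "limitin S (\<lambda>x. inv\<^bsub>G\<^esub> g * x) (inv\<^bsub>G\<^esub> g * g) ?\<Phi>"
        using limitin_mult[OF _ id, of "\<lambda>_. inv\<^bsub>G\<^esub> g" "inv\<^bsub>G\<^esub> g"] H_inv(1)[OF gH] by (simp add: topspace_eq)
      then have "limitin S (\<lambda>x. inv\<^bsub>G\<^esub> g * x) (1\<^sub>m n) ?\<Phi>" using H_inv(2)[OF gH] by simp
      then show "limitin S f (1\<^sub>m n) ?\<Phi>"
        by (rule limitin_transform_eventually[rotated])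
          (use evH in eventually_elim, simp add: f_def)
    qed
    note lim = null[OF this]
    have fH: "f x \<in> H" for x using \<open>null ?\<Phi> f\<close> by (simp add: null_iff)
    have "limitin ?T (\<lambda>x. x) g ?\<Phi>"
      unfolding limitin_subtopology limitin_SL_topology
    proof (intro conjI allI impI)
      fix i j assume ij: "i < n" "j < n"
      have "((\<lambda>x. \<Sum>k<n. g $$ (i, k) * f x $$ (k, j)) \<longlongrightarrow> (\<Sum>k<n. g $$ (i, k) * (if k = j then 1 else 0))) ?\<Phi>"
        using ij by (intro tendsto_sum tendsto_mult tendsto_const lim) auto
      moreover have "(\<Sum>k<n. g $$ (i, k) * (if k = j then 1 else 0)) = g $$ (i, j)"
        using ij by (simp add: if_distrib[of "\<lambda>x. _ * x"] cong: if_cong)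
      moreover have "\<forall>\<^sub>F x in ?\<Phi>. (\<Sum>k<n. g $$ (i, k) * f x $$ (k, j)) = x $$ (i, j)"
        using evH
      proof eventually_elim
        case (elim x)
        have "g * f x = (g * inv\<^bsub>G\<^esub> g) * x"
          using elim gH H_carrier_mat H_inv(1) by (simp add: f_def assoc_mult_mat[of _ n n _ n _ n])
        also have "\<dots> = x" using gH elim H_carrier_mat by (simp add: H_inv left_mult_one_mat[of _ n n])
        finally show ?case
          using mat_mult_entry[OF H_carrier_mat[OF gH] H_carrier_mat[OF fH] ij, of x] by simp
      qed
      ultimately show "((\<lambda>x. x $$ (i, j)) \<longlongrightarrow> g $$ (i, j)) ?\<Phi>"
        using Lim_transform_eventually by fastforce
    qed (use gH HU evH in \<open>auto elim: eventually_mono\<close>)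
    from limitinD[OF this U g] show "\<exists>V. openin S V \<and> g \<in> V \<and> V \<subseteq> U"
      unfolding eventually_nhdsin using gH by (auto simp: topspace_eq)
  qed
  then show ?thesis using coarser by (auto simp: topology_eq)
qed

lemma comm_in_H: "a \<in> H \<Longrightarrow> b \<in> H \<Longrightarrow> comm a b \<in> H"
  by (simp add: comm_def H_mult H_inv)

text \<open>
  Conjugating an elementary matrix by a null net changes it by a null factor, while the conjugate
  displays column \<open>j\<close> of \<open>f x\<close> and row \<open>k\<close> of its inverse.  Commutators of it with other tame nets are
  used to move single products of such entries into a root subgroup, where \<open>S\<close> is known.
\<close>

lemma conj_elem_mat_near:
  assumes f: "null \<Phi> f" and jk: "is_root j k"
  shows "near \<Phi> (\<lambda>x. rank_one_update n (\<lambda>a. f x $$ (a, j)) (\<lambda>b. (inv\<^bsub>G\<^esub> (f x)) $$ (k, b)))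
    (\<lambda>_. elem_mat n j k 1)"
proof -
  have fH: "f x \<in> H" for x using f by (simp add: null_iff)
  have E: "elem_mat n j k 1 \<in> H" by (rule rootD(4)[OF jk]) (rule subfield_setD[OF F])
  have "near \<Phi> (\<lambda>x. f x \<otimes>\<^bsub>G\<^esub> elem_mat n j k 1 \<otimes>\<^bsub>G\<^esub> inv\<^bsub>G\<^esub> (f x))
      (\<lambda>x. \<one>\<^bsub>G\<^esub> \<otimes>\<^bsub>G\<^esub> elem_mat n j k 1 \<otimes>\<^bsub>G\<^esub> inv\<^bsub>G\<^esub> \<one>\<^bsub>G\<^esub>)"
    using f E by (intro near_mult near_inv near_one near_refl tame_const) simp_all
  moreover have "f x \<otimes>\<^bsub>G\<^esub> elem_mat n j k 1 \<otimes>\<^bsub>G\<^esub> inv\<^bsub>G\<^esub> (f x) =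
      rank_one_update n (\<lambda>a. f x $$ (a, j)) (\<lambda>b. (inv\<^bsub>G\<^esub> (f x)) $$ (k, b))" for x
    using conj_elem_mat[OF H_carrier_mat[OF fH] H_carrier_mat[OF H_inv(1)[OF fH]] H_inv(2)[OF fH]
        H_inv(3)[OF fH] rootD(1,2)[OF jk]] by simp
  moreover have "\<one>\<^bsub>G\<^esub> \<otimes>\<^bsub>G\<^esub> elem_mat n j k 1 \<otimes>\<^bsub>G\<^esub> inv\<^bsub>G\<^esub> \<one>\<^bsub>G\<^esub> = elem_mat n j k 1"
  proof -
    have E': "elem_mat n j k 1 \<in> carrier G" using E by simp
    show ?thesis by (simp only: inv_one l_one[OF E'] r_one[OF E'])
  qed
  ultimately show ?thesis by simp
qed

lemma near_elem_mat:
  assumes q: "is_root q l" and near: "near \<Phi> a b"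
    and a: "\<forall>\<^sub>F x in \<Phi>. a x = elem_mat n q l (y x) \<and> y x \<in> F" and b: "\<And>x. b x = elem_mat n q l z" and z: "z \<in> F"
  shows "(y \<longlongrightarrow> z) \<Phi>"
proof -
  have "limitin S (\<lambda>x. a x \<otimes>\<^bsub>G\<^esub> inv\<^bsub>G\<^esub> (b x)) (1\<^sub>m n) \<Phi>"
    using near by (simp add: near_def null_iff)
  moreover have "\<forall>\<^sub>F x in \<Phi>. a x \<otimes>\<^bsub>G\<^esub> inv\<^bsub>G\<^esub> (b x) = elem_mat n q l (y x - z)"
    using a by eventually_elim (simp add: b inv_elem_mat[OF q z] elem_mat_mult rootD[OF q])
  ultimately have "limitin S (\<lambda>x. elem_mat n q l (y x - z)) (1\<^sub>m n) \<Phi>"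
    using limitin_transform_eventually by fast
  moreover have "\<forall>\<^sub>F x in \<Phi>. y x - z \<in> F"
    using a by eventually_elim (simp add: subfield_setD[OF F] z)
  ultimately have "((\<lambda>x. y x - z) \<longlongrightarrow> 0) \<Phi>"
    by (intro tendsto_0_if_limitin_elem_mat[OF q])
  from tendsto_add[OF this tendsto_const[of z]] show ?thesis by simp
qed

lemma inv_row_dot_col:
  assumes "g \<in> H" "k < n" "j < n"
  shows "(\<Sum>b<n. (inv\<^bsub>G\<^esub> g) $$ (k, b) * g $$ (b, j)) = (if k = j then 1 else 0)"
    and "(\<Sum>b<n. g $$ (k, b) * (inv\<^bsub>G\<^esub> g) $$ (b, j)) = (if k = j then 1 else 0)"
  using mat_mult_entry[OF H_carrier_mat[OF H_inv(1)[OF assms(1)]] H_carrier_mat[OF assms(1)] assms(2,3)]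
    mat_mult_entry[OF H_carrier_mat[OF assms(1)] H_carrier_mat[OF H_inv(1)[OF assms(1)]] assms(2,3)]
    H_inv(2,3)[OF assms(1)] assms(2,3) by simp_all


subsection \<open>The special linear group\<close>

lemma elem_mat_as_rank_one_update:
  "elem_mat n i j 1 = rank_one_update n (unit_fun i) (unit_fun j)"
  by (simp add: elem_mat_def)

text \<open>
  Each commutator is an instance of \<open>comm_rank_one_updates\<close>.  From \<open>u v\<^sup>t\<close>, the first one replaces the
  functional \<open>v\<close> by \<open>\<phi>\<close> and extracts \<open>v k\<close>, the second one replaces the vector \<open>u\<close> by the unit vector
  at \<open>q\<close> and extracts \<open>u p\<close>, and the third one replaces \<open>\<phi>\<close> by the coordinate functional at \<open>l\<close>.
\<close>

lemma comm_word_all_roots: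
  assumes roots: "\<And>i j. i < n \<Longrightarrow> j < n \<Longrightarrow> i \<noteq> j \<Longrightarrow> is_root i j"
    and uv: "rank_one_update n u v \<in> H" and \<phi>: "\<phi> = (\<lambda>b. unit_fun i b + s * unit_fun l b)"
    and \<phi>H: "rank_one_update n (unit_fun k) \<phi> \<in> H"
    and u: "dot n \<phi> u = 0"
    and less: "i < n" "l < n" "k < n" "q < n" "p < n"
    and neq: "i \<noteq> l" "k \<noteq> i" "k \<noteq> l" "q \<noteq> i" "q \<noteq> l" "q \<noteq> p"
  shows "comm (comm (elem_mat n q p 1) (comm (rank_one_update n u v) (rank_one_update n (unit_fun k) \<phi>)))
      (elem_mat n i l 1) = elem_mat n q l (v k * u p)"
proof -
  have E: "rank_one_update n (unit_fun a) (unit_fun b) \<in> H" if "a < n" "b < n" "a \<noteq> b" for a b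
    using rootD(4)[OF roots[OF that] subfield_setD(2)[OF F]] by (simp add: elem_mat_as_rank_one_update)
  have \<phi>dot: "dot n \<phi> w = w i + s * w l" for w
    using less unfolding \<phi> by (simp add: dot_add)
  have 1: "comm (rank_one_update n u v) (rank_one_update n (unit_fun k) \<phi>) =
      rank_one_update n (\<lambda>a. v k * u a) \<phi>"
    using comm_rank_one_updates[OF uv \<phi>H u] less neq by (simp add: \<phi>dot unit_fun_def[of k])
  then have H1: "rank_one_update n (\<lambda>a. v k * u a) \<phi> \<in> H" using comm_in_H[OF uv \<phi>H] by simp
  have 2: "comm (elem_mat n q p 1) (rank_one_update n (\<lambda>a. v k * u a) \<phi>) =
      rank_one_update n (\<lambda>a. v k * u p * unit_fun q a) \<phi>"
    unfolding elem_mat_as_rank_one_update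
    using comm_rank_one_updates[OF E[of q p] H1] less neq u by (simp add: \<phi>dot[of "unit_fun q"] unit_fun_def[of q])
  then have H2: "rank_one_update n (\<lambda>a. v k * u p * unit_fun q a) \<phi> \<in> H"
    using comm_in_H[OF E[of q p] H1] less neq by (simp add: elem_mat_as_rank_one_update)
  have "comm (rank_one_update n (\<lambda>a. v k * u p * unit_fun q a) \<phi>) (elem_mat n i l 1) =
      rank_one_update n (\<lambda>a. dot n \<phi> (unit_fun i) * (v k * u p * unit_fun q a)) (unit_fun l)"
    unfolding elem_mat_as_rank_one_update
    by (rule comm_rank_one_updates[OF H2 E]) (use less neq in \<open>simp_all add: unit_fun_def\<close>)
  also have "dot n \<phi> (unit_fun i) = 1" using neq(1) by (simp add: \<phi>dot unit_fun_def[of i])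
  finally show ?thesis unfolding 1 2 by (simp add: elem_mat_def)
qed

text \<open>
  The functional \<open>\<phi> = e\<^sub>i - r e\<^sub>l\<close> has to annihilate column \<open>j\<close> of \<open>f x\<close>, which fixes \<open>r\<close>.  The assumption
  on the order of the two entries of that column gives \<open>|r| \<le> 1\<close>, and this makes \<open>I + e\<^sub>k \<phi>\<^sup>t\<close> a tame
  net.  The same word evaluated at \<open>f x = I\<close> is \<open>E(1)\<close> or \<open>E(0)\<close>.
\<close>

lemma null_entries_all_roots_ordered:
  assumes roots: "\<And>i j. i < n \<Longrightarrow> j < n \<Longrightarrow> i \<noteq> j \<Longrightarrow> is_root i j"
    and f: "null \<Phi> f" and less: "i < n" "l < n" "j < n" "k < n" "p < n"
    and neq: "j \<noteq> k" "i \<noteq> l" "i \<noteq> j" "i \<noteq> k" "l \<noteq> j" "l \<noteq> k"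
    and le: "\<forall>\<^sub>F x in \<Phi>. norm (f x $$ (i, j)) \<le> norm (f x $$ (l, j))"
  shows "((\<lambda>x. (inv\<^bsub>G\<^esub> (f x)) $$ (k, k) * f x $$ (p, j)) \<longlongrightarrow> (if p = j then 1 else 0)) \<Phi>"
proof -
  note Fs = subfield_setD[OF F]
  have fH: "f x \<in> H" for x using f by (simp add: null_iff)
  note fF = H_entry[OF fH] and hF = H_entry[OF H_inv(1)[OF fH]]
  define u where "u = (\<lambda>x a. f x $$ (a, j))"
  define v where "v = (\<lambda>x b. (inv\<^bsub>G\<^esub> (f x)) $$ (k, b))"
  define r where "r x = (if norm (u x i) \<le> norm (u x l) then u x i / u x l else 0)" for x
  define \<phi> where "\<phi> x = (\<lambda>b. unit_fun i b + (- r x) * unit_fun l b)" for x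
  \<comment> \<open>any index other than \<open>i\<close>, \<open>l\<close> and \<open>p\<close>\<close>
  define q where "q = (if p = j then k else j)"
  have q: "q < n" "q \<noteq> i" "q \<noteq> l" "q \<noteq> p" using less neq by (auto simp: q_def)
  have rF: "- r x \<in> F" for x using Fs fF less by (auto simp: r_def u_def)
  have r1: "norm (- r x) \<le> 1" for x
    by (cases "u x l = 0") (auto simp: r_def norm_divide divide_le_eq_1)
  have \<phi>dot: "dot n (\<phi> x) w = w i - r x * w l" for x w
    using less unfolding \<phi>_def by (simp only: dot_add dot_scale dot_unit) simp
  let ?\<sigma> = "\<lambda>x. elem_mat n k i 1 * elem_mat n k l (- r x)"
  have \<sigma>: "?\<sigma> x = rank_one_update n (unit_fun k) (\<phi> x)" for x
    unfolding elem_mat_def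
    by (rule eq_matI) (use less neq in \<open>auto simp: mult_rank_one_updates rank_one_update_entry \<phi>_def
        unit_fun_def[of k i] unit_fun_def[of i k] algebra_simps\<close>)
  have E1: "elem_mat n a b 1 \<in> H" if "a < n" "b < n" "a \<noteq> b" for a b
    using rootD(4)[OF roots[OF that] Fs(2)] .
  have "tame \<Phi> (\<lambda>x. elem_mat n k i 1 \<otimes>\<^bsub>G\<^esub> elem_mat n k l (- r x))"
    using less neq E1 rF r1 by (intro tame_mult tame_const tame_elem_mat roots) auto
  then have t\<sigma>: "tame \<Phi> (\<lambda>x. rank_one_update n (unit_fun k) (\<phi> x))" by (simp add: \<sigma>)
  then have \<sigma>H: "rank_one_update n (unit_fun k) (\<phi> x) \<in> H" for x using tame_closed by fastforce
  let ?A = "\<lambda>x. rank_one_update n (u x) (v x)"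
  have nearA: "near \<Phi> ?A (\<lambda>_. elem_mat n j k 1)"
    using conj_elem_mat_near[OF f roots[OF less(3,4) neq(1)]] by (simp add: u_def v_def)
  then have AH: "?A x \<in> H" for x using tame_closed unfolding near_def by fastforce
  have "near \<Phi> (\<lambda>x. comm (comm (elem_mat n q p 1) (comm (?A x) (rank_one_update n (unit_fun k) (\<phi> x)))) (elem_mat n i l 1))
     (\<lambda>x. comm (comm (elem_mat n q p 1) (comm (elem_mat n j k 1) (rank_one_update n (unit_fun k) (\<phi> x)))) (elem_mat n i l 1))"
    using E1[OF q(1) less(5) q(4)] E1[OF less(1,2) neq(2)]
    by (intro near_comm near_refl tame_const nearA t\<sigma>) simp_all
  moreover have "\<forall>\<^sub>F x in \<Phi>. comm (comm (elem_mat n q p 1) (comm (?A x) (rank_one_update n (unit_fun k) (\<phi> x)))) (elem_mat n i l 1)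
      = elem_mat n q l (v x k * u x p) \<and> v x k * u x p \<in> F"
    using le
  proof eventually_elim
    case (elim x)
    then have "u x i = r x * u x l" by (cases "u x l = 0") (auto simp: r_def u_def)
    then have "dot n (\<phi> x) (u x) = 0" by (simp add: \<phi>dot)
    moreover have "v x k * u x p \<in> F" using Fs fF hF less by (simp add: u_def v_def)
    ultimately show ?case
      using comm_word_all_roots[OF roots AH \<phi>_def \<sigma>H] less neq q by simp
  qed
  moreover have "comm (comm (elem_mat n q p 1) (comm (elem_mat n j k 1) (rank_one_update n (unit_fun k) (\<phi> x)))) (elem_mat n i l 1)
      = elem_mat n q l (if p = j then 1 else 0)" for x
  proof -
    have "dot n (\<phi> x) (unit_fun j) = 0" using neq by (simp add: \<phi>dot unit_fun_def)
    then show ?thesis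
      using comm_word_all_roots[OF roots _ \<phi>_def \<sigma>H, of "unit_fun j" "unit_fun k"] E1[OF less(3,4) neq(1)] less neq q
      by (simp add: elem_mat_as_rank_one_update unit_fun_def[of k k] unit_fun_def[of j p])
  qed
  ultimately have "((\<lambda>x. v x k * u x p) \<longlongrightarrow> (if p = j then 1 else 0)) \<Phi>"
    by (rule near_elem_mat[OF roots[OF q(1) less(2) q(3)]]) (simp add: Fs)
  then show ?thesis by (simp add: u_def v_def)
qed

text \<open>
  There must be room for two indices \<open>i\<close> and \<open>l\<close> besides \<open>j\<close> and \<open>k\<close>, hence \<open>n \<ge> 4\<close>.  The filter is
  split according to which of the two entries of column \<open>j\<close> is larger.
\<close>

lemma null_entries_all_roots:
  assumes roots: "\<And>i j. i < n \<Longrightarrow> j < n \<Longrightarrow> i \<noteq> j \<Longrightarrow> is_root i j" and n4: "n \<ge> 4"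
    and f: "null \<Phi> f" and less: "j < n" "k < n" "p < n" and neq: "j \<noteq> k"
  shows "((\<lambda>x. (inv\<^bsub>G\<^esub> (f x)) $$ (k, k) * f x $$ (p, j)) \<longlongrightarrow> (if p = j then 1 else 0)) \<Phi>"
    (is "(?g \<longlongrightarrow> ?c) \<Phi>")
proof -
  have "card ({..<n} - {j, k}) \<ge> 2" using less neq n4 by (subst card_Diff_subset) auto
  then obtain Q where Q: "Q \<subseteq> {..<n} - {j, k}" "card Q = 2"
    by (rule obtain_subset_with_card_n)
  then obtain i l where "Q = {i, l}" "i \<noteq> l" by (auto simp: card_2_iff)
  with Q have il: "i \<in> {..<n} - {j, k}" "l \<in> {..<n} - {j, k}" "i \<noteq> l" by auto
  let ?P = "{x. norm (f x $$ (i, j)) \<le> norm (f x $$ (l, j))}"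
  have "(?g \<longlongrightarrow> ?c) (inf \<Phi> (principal ?P))"
    by (rule null_entries_all_roots_ordered[OF roots null_mono[OF f], of _ i l])
      (use il less neq in \<open>auto simp: eventually_inf_principal\<close>)
  moreover have "(?g \<longlongrightarrow> ?c) (inf \<Phi> (principal (- ?P)))"
    by (rule null_entries_all_roots_ordered[OF roots null_mono[OF f], of _ l i])
      (use il less neq in \<open>auto simp: eventually_inf_principal\<close>)
  ultimately show ?thesis
    unfolding tendsto_def eventually_inf_principal
  proof (intro allI impI)
    fix U assume "open U" "?c \<in> U"
      and 1: "\<forall>U. open U \<longrightarrow> ?c \<in> U \<longrightarrow> (\<forall>\<^sub>F x in \<Phi>. x \<in> ?P \<longrightarrow> ?g x \<in> U)"
      and 2: "\<forall>U. open U \<longrightarrow> ?c \<in> U \<longrightarrow> (\<forall>\<^sub>F x in \<Phi>. x \<in> - ?P \<longrightarrow> ?g x \<in> U)"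
    show "\<forall>\<^sub>F x in \<Phi>. ?g x \<in> U"
      using 1[rule_format, OF \<open>open U\<close> \<open>?c \<in> U\<close>] 2[rule_format, OF \<open>open U\<close> \<open>?c \<in> U\<close>]
      by eventually_elim blast
  qed
qed

text \<open>
  The scalar that normalises \<open>f\<close> is the first diagonal entry of its inverse.  It handles all columns
  but the first one; there the second diagonal entry serves, and the quotient of the two tends to \<open>1\<close>.
\<close>

lemma entries_of_null_all_roots:
  assumes roots: "\<And>i j. i < n \<Longrightarrow> j < n \<Longrightarrow> i \<noteq> j \<Longrightarrow> is_root i j" and n4: "n \<ge> 4" and n: "n = 2 ^ m"
    and f: "null \<Phi> f" and ij: "i < n" "j < n"
  shows "((\<lambda>x. f x $$ (i, j)) \<longlongrightarrow> (if i = j then 1 else 0)) \<Phi>"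
proof (rule entries_of_null_if_scalar_multiple[OF n f _ ij])
  let ?h = "\<lambda>k x. (inv\<^bsub>G\<^esub> (f x)) $$ (k, k)"
  note lim = null_entries_all_roots[OF roots n4 f]
  fix p j assume pj: "p < n" "j < n"
  show "((\<lambda>x. ?h 0 x * f x $$ (p, j)) \<longlongrightarrow> (if p = j then 1 else 0)) \<Phi>"
  proof (cases "j = 0")
    case False
    then show ?thesis using lim[of j 0 p] pj n4 by simp
  next
    case True
    have l: "((\<lambda>x. ?h 0 x * f x $$ (2, 2)) \<longlongrightarrow> 1) \<Phi>" "((\<lambda>x. ?h 1 x * f x $$ (2, 2)) \<longlongrightarrow> 1) \<Phi>"
      using lim[of 2 0 2] lim[of 2 1 2] n4 by simp_all
    have "((\<lambda>x. (?h 1 x * f x $$ (p, j)) * (?h 0 x * f x $$ (2, 2)) / (?h 1 x * f x $$ (2, 2))) \<longlongrightarrow>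
        (if p = j then 1 else 0) * 1 / 1) \<Phi>"
      using lim[of j 1 p] l pj n4 True by (intro tendsto_intros) simp_all
    moreover have "\<forall>\<^sub>F x in \<Phi>. ?h 1 x * f x $$ (2, 2) \<noteq> 0"
      using l(2) by (rule tendsto_imp_eventually_ne) simp
    then have "\<forall>\<^sub>F x in \<Phi>. (?h 1 x * f x $$ (p, j)) * (?h 0 x * f x $$ (2, 2)) / (?h 1 x * f x $$ (2, 2)) =
        ?h 0 x * f x $$ (p, j)"
      by eventually_elim (simp add: field_simps)
    ultimately show ?thesis by (simp add: Lim_transform_eventually)
  qed
qed


subsection \<open>The upper triangular group\<close>

lemma diag_mult_inv_diag:
  assumes upper: "\<And>g i j. g \<in> H \<Longrightarrow> i < n \<Longrightarrow> j < i \<Longrightarrow> g $$ (i, j) = 0"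
    and g: "g \<in> H" and i: "i < n"
  shows "g $$ (i, i) * (inv\<^bsub>G\<^esub> g) $$ (i, i) = 1"
proof -
  have "(\<Sum>b<n. g $$ (i, b) * (inv\<^bsub>G\<^esub> g) $$ (b, i)) =
      (\<Sum>b<n. if b = i then g $$ (i, i) * (inv\<^bsub>G\<^esub> g) $$ (i, i) else 0)"
  proof (rule sum.cong[OF refl])
    fix b assume "b \<in> {..<n}"
    then show "g $$ (i, b) * (inv\<^bsub>G\<^esub> g) $$ (b, i) = (if b = i then g $$ (i, i) * (inv\<^bsub>G\<^esub> g) $$ (i, i) else 0)"
      using upper[OF g i, of b] upper[OF H_inv(1)[OF g], of b i] by (cases b i rule: linorder_cases) auto
  qed
  then show ?thesis using inv_row_dot_col(2)[OF g i i] i by simp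
qed

text \<open>
  The corner \<open>(0, N)\<close> is the one position that conjugation inside the unipotent group does not see.  If
  all other entries of \<open>s\<close> converge, then \<open>s\<close> is the product of an entrywise convergent net, which
  is null, and an elementary matrix at the corner, which is then null as well.
\<close>

lemma corner_of_null:
  assumes N_def: "n = Suc N"
    and upper: "\<And>g i j. g \<in> H \<Longrightarrow> i < n \<Longrightarrow> j < i \<Longrightarrow> g $$ (i, j) = 0"
    and s: "null \<Phi> s"
    and lim: "\<And>p q. p < n \<Longrightarrow> q < n \<Longrightarrow> (p, q) \<noteq> (0, N) \<Longrightarrow>
      ((\<lambda>x. s x $$ (p, q)) \<longlongrightarrow> (if p = q then 1 else 0)) \<Phi>"
  shows "((\<lambda>x. s x $$ (0, N)) \<longlongrightarrow> 0) \<Phi>"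
proof -
  have N: "0 < N" "N < n" "0 < n" using n3 N_def by auto
  then have is_root: "is_root 0 N" by (intro root_upper) auto
  have sH: "s x \<in> H" for x using s by (simp add: null_iff)
  note sF = H_entry[OF sH]
  define z where "z x = s x $$ (0, N) / s x $$ (0, 0)" for x
  have zF: "z x \<in> F" for x unfolding z_def using sF N by (intro subfield_setD[OF F]) auto
  note zH = rootD(4)[OF is_root zF] and mzH = rootD(4)[OF is_root subfield_setD(5)[OF F zF]]
  \<comment> \<open>the column operation that clears the corner\<close>
  define s' where "s' x = s x * elem_mat n 0 N (- z x)" for x
  have s'H: "s' x \<in> H" for x unfolding s'_def using sH mzH by (rule H_mult)
  have entry: "s' x $$ (p, q) = s x $$ (p, q) + (if q = N then - z x * s x $$ (p, 0) else 0)"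
    if pq: "p < n" "q < n" for x p q
  proof -
    have "s' x $$ (p, q) = (\<Sum>k<n. (if k = q then s x $$ (p, k) else 0) +
        (if k = 0 then if q = N then - z x * s x $$ (p, 0) else 0 else 0))"
      unfolding s'_def mat_mult_entry[OF H_carrier_mat[OF sH] elem_mat_carrier pq]
      using pq by (intro sum.cong) (auto simp: elem_mat_entry algebra_simps)
    then show ?thesis using pq by (simp add: sum.distrib)
  qed
  have s00: "((\<lambda>x. s x $$ (0, 0)) \<longlongrightarrow> 1) \<Phi>" using lim[of 0 0] N by simp
  then have ne: "\<forall>\<^sub>F x in \<Phi>. s x $$ (0, 0) \<noteq> 0" by (rule tendsto_imp_eventually_ne) simp
  have "null \<Phi> s'"
  proof (rule null_of_entries[OF s'H])
    fix p q assume pq: "p < n" "q < n"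
    show "((\<lambda>x. s' x $$ (p, q)) \<longlongrightarrow> (if p = q then 1 else 0)) \<Phi>"
    proof (cases "(p, q) = (0, N)")
      case True
      have "\<forall>\<^sub>F x in \<Phi>. 0 = s' x $$ (p, q)"
        using ne by eventually_elim (use True pq entry in \<open>simp add: z_def\<close>)
      then show ?thesis using True N by (auto intro: Lim_transform_eventually[OF tendsto_const])
    next
      case False
      have "s' x $$ (p, q) = s x $$ (p, q)" for x
        using entry[OF pq] upper[OF sH, of p 0] pq False by auto
      then show ?thesis using lim[OF pq False] by simp
    qed
  qed
  then have "null \<Phi> (\<lambda>x. inv\<^bsub>G\<^esub> (s' x) * s x)" using null_mult[OF null_inv s] by simp
  moreover have "inv\<^bsub>G\<^esub> (s' x) * s x = elem_mat n 0 N (z x)" for x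
  proof -
    have "inv\<^bsub>G\<^esub> (s' x) = elem_mat n 0 N (z x) * inv\<^bsub>G\<^esub> (s x)"
      using inv_mult_group[of "s x" "elem_mat n 0 N (- z x)"] sH mzH
      by (simp add: s'_def inv_elem_mat[OF is_root subfield_setD(5)[OF F zF]])
    then show ?thesis
      using m_assoc[of "elem_mat n 0 N (z x)" "inv\<^bsub>G\<^esub> (s x)" "s x"] zH sH
      by (simp add: H_inv right_mult_one_mat[of _ n n])
  qed
  ultimately have "(z \<longlongrightarrow> 0) \<Phi>"
    using zF by (intro tendsto_0_if_limitin_elem_mat[OF is_root]) (simp_all add: null_iff)
  from tendsto_mult[OF this s00] have "((\<lambda>x. z x * s x $$ (0, 0)) \<longlongrightarrow> 0) \<Phi>" by simp
  then show ?thesis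
    by (rule Lim_transform_eventually) (use ne in eventually_elim, simp add: z_def)
qed

text \<open>
  For \<open>p > 0\<close> and \<open>j < N\<close>, the commutator of \<open>E\<^sub>0\<^sub>p\<close> with the conjugate of \<open>E\<^sub>j\<^sub>N\<close> lies in the corner
  root subgroup.  Row \<open>0\<close> and column \<open>N\<close> are the entries that are missing afterwards; they appear as
  corner entries of the null nets that compare an elementary matrix with its conjugate, by \<open>f\<close> for row
  \<open>0\<close> and by the inverse of \<open>f\<close> for column \<open>N\<close>.
\<close>

lemma null_entries_off_corner:
  assumes N_def: "n = Suc N"
    and upper: "\<And>g i j. g \<in> H \<Longrightarrow> i < n \<Longrightarrow> j < i \<Longrightarrow> g $$ (i, j) = 0"
    and f: "null \<Phi> f" and pq: "p < n" "q < n" "(p, q) \<noteq> (0, N)"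
  shows "((\<lambda>x. (inv\<^bsub>G\<^esub> (f x)) $$ (N, N) * f x $$ (p, q)) \<longlongrightarrow> (if p = q then 1 else 0)) \<Phi>"
proof -
  note Fs = subfield_setD[OF F]
  define h where "h x = inv\<^bsub>G\<^esub> (f x)" for x
  have N: "0 < N" "N < n" "0 < n" using n3 N_def by auto
  have fH: "f x \<in> H" for x using f by (simp add: null_iff)
  have hH: "h x \<in> H" for x unfolding h_def by (rule H_inv(1)[OF fH])
  have hnull: "null \<Phi> h" unfolding h_def by (rule null_inv[OF f])
  have inv_h: "inv\<^bsub>G\<^esub> (h x) = f x" for x using inv_inv[of "f x"] fH by (simp add: h_def)
  note fF = H_entry[OF fH] and hF = H_entry[OF hH]
  have E1: "elem_mat n a b 1 \<in> H" if "a < b" "b < n" for a b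
    using rootD(4)[OF root_upper[OF that] Fs(2)] .
  have hN: "h x $$ (N, b) = h x $$ (N, N) * unit_fun N b" if "b < n" for x b
  proof -
    have "b = N \<or> b < N" using that N_def by linarith
    then show ?thesis using upper[OF hH, of N b x] N(2) by (auto simp: unit_fun_def)
  qed
  have f0: "h x $$ (a, 0) = h x $$ (0, 0) * unit_fun 0 a" if "a < n" for x a
    using upper[OF hH, of a 0] that N by (cases "a = 0") (auto simp: unit_fun_def)
  have diag: "f x $$ (N, N) * h x $$ (N, N) = 1" "f x $$ (0, 0) * h x $$ (0, 0) = 1" for x
    unfolding h_def using N by (auto intro!: diag_mult_inv_diag[OF upper fH])
  have col_pos: "((\<lambda>x. h x $$ (N, N) * f x $$ (p, j)) \<longlongrightarrow> (if p = j then 1 else 0)) \<Phi>"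
    if p: "0 < p" "p < n" and j: "j < N" for p j
  proof -
    let ?A = "\<lambda>x. rank_one_update n (\<lambda>a. f x $$ (a, j)) (\<lambda>b. h x $$ (N, b))"
    have root_j: "is_root j N" using j N by (intro root_upper) auto
    have near: "near \<Phi> ?A (\<lambda>_. elem_mat n j N 1)"
      using conj_elem_mat_near[OF f root_j] by (simp add: h_def)
    then have AH: "?A x \<in> H" for x using tame_closed unfolding near_def by fastforce
    note E0p = E1[OF p]
    have "near \<Phi> (\<lambda>x. comm (elem_mat n 0 p 1) (?A x)) (\<lambda>x. comm (elem_mat n 0 p 1) (elem_mat n j N 1))"
      using E0p by (intro near_comm near_refl tame_const near) simp_all
    moreover have "comm (elem_mat n 0 p 1) (?A x) = elem_mat n 0 N (h x $$ (N, N) * f x $$ (p, j))" for x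
    proof -
      have "dot n (\<lambda>b. h x $$ (N, b)) (\<lambda>a. f x $$ (a, j)) = 0"
        using inv_row_dot_col(1)[OF fH, of N j x] j N by (simp add: dot_def h_def)
      moreover have "dot n (\<lambda>b. h x $$ (N, b)) (unit_fun 0) = 0"
        using upper[OF hH N(2,1)] N by simp
      ultimately have "comm (elem_mat n 0 p 1) (?A x) =
          rank_one_update n (\<lambda>a. f x $$ (p, j) * unit_fun 0 a) (\<lambda>b. h x $$ (N, b))"
        using comm_rank_one_updates[OF _ AH, of "unit_fun 0" "unit_fun p" x] E0p p
        by (simp add: elem_mat_as_rank_one_update)
      also have "\<dots> = elem_mat n 0 N (h x $$ (N, N) * f x $$ (p, j))"
        by (rule eq_matI) (auto simp: elem_mat_def rank_one_update_entry hN[of _ x])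
      finally show ?thesis .
    qed
    moreover have "comm (elem_mat n 0 p 1) (elem_mat n j N 1) = elem_mat n 0 N (if p = j then 1 else 0)"
    proof -
      have "comm (elem_mat n 0 p 1) (elem_mat n j N 1) =
        rank_one_update n (\<lambda>a. unit_fun p j * unit_fun 0 a) (unit_fun N)"
        using comm_rank_one_updates[of "unit_fun 0" "unit_fun p" "unit_fun j" "unit_fun N"] E0p E1[of j N] p j N
        by (simp add: elem_mat_as_rank_one_update unit_fun_def[of N])
      then show ?thesis by (simp add: elem_mat_def unit_fun_def[of p j] eq_commute[of j p])
    qed
    ultimately show ?thesis
      using N p j fF hF by (intro near_elem_mat[OF root_upper[OF N(1,2)]]) (auto simp: Fs)
  qed
  have col: "((\<lambda>x. h x $$ (N, N) * f x $$ (p, j)) \<longlongrightarrow> (if p = j then 1 else 0)) \<Phi>"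
    if p: "p < n" and j: "j < N" for p j
  proof (cases "p = 0")
    case False
    then show ?thesis using col_pos p j by simp
  next
    case p0: True
    let ?A = "\<lambda>x. rank_one_update n (\<lambda>a. f x $$ (a, j)) (\<lambda>b. h x $$ (N, b))"
    have root_j: "is_root j N" using j N by (intro root_upper) auto
    define s where "s x = ?A x * elem_mat n j N (- 1)" for x
    have "near \<Phi> ?A (\<lambda>_. elem_mat n j N 1)"
      using conj_elem_mat_near[OF f root_j] by (simp add: h_def)
    then have s: "null \<Phi> s"
      by (simp add: near_def s_def[abs_def] inv_elem_mat[OF root_j Fs(2)])
    have entry: "s x $$ (a, b) = (if a = b then 1 else 0) +
        unit_fun N b * (h x $$ (N, N) * f x $$ (a, j) - unit_fun j a)" if "a < n" "b < n" for x a b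
      using that j N upper[OF hH, of N j x]
      by (simp add: s_def elem_mat_def mult_rank_one_updates hN[of b x] algebra_simps)
    have "((\<lambda>x. s x $$ (0, N)) \<longlongrightarrow> 0) \<Phi>"
    proof (rule corner_of_null[OF N_def upper s])
      fix a b assume ab: "a < n" "b < n" "(a, b) \<noteq> (0, N)"
      show "((\<lambda>x. s x $$ (a, b)) \<longlongrightarrow> (if a = b then 1 else 0)) \<Phi>"
      proof (cases "b = N")
        case True
        have "((\<lambda>x. (if a = b then 1 else 0) + unit_fun N b * (h x $$ (N, N) * f x $$ (a, j) - unit_fun j a)) \<longlongrightarrow>
           (if a = b then 1 else 0) + unit_fun N b * ((if a = j then 1 else 0) - unit_fun j a)) \<Phi>"
          using True ab j by (intro tendsto_intros col_pos) auto
        then show ?thesis using ab by (simp add: entry unit_fun_def[of j a])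
      qed (use ab in \<open>simp add: entry unit_fun_def[of N]\<close>)
    qed
    then have "((\<lambda>x. h x $$ (N, N) * f x $$ (0, j) - unit_fun j 0) \<longlongrightarrow> 0) \<Phi>"
      using N by (simp add: entry unit_fun_def[of N])
    from tendsto_add[OF this tendsto_const[of "unit_fun j 0"]] show ?thesis
      using p0 by (simp add: unit_fun_def)
  qed
  have c0: "((\<lambda>x. h x $$ (N, N) * f x $$ (0, 0)) \<longlongrightarrow> 1) \<Phi>" using col[of 0 0] N by simp
  then have ne: "\<forall>\<^sub>F x in \<Phi>. h x $$ (N, N) * f x $$ (0, 0) \<noteq> 0"
    by (rule tendsto_imp_eventually_ne) simp
  have h00: "h x $$ (0, 0) * a = h x $$ (N, N) * a / (h x $$ (N, N) * f x $$ (0, 0))"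
    if "h x $$ (N, N) * f x $$ (0, 0) \<noteq> 0" for x a
    using that diag(2)[of x] by (simp add: divide_simps) (simp add: mult.commute)
  have last: "((\<lambda>x. h x $$ (N, N) * f x $$ (p, N)) \<longlongrightarrow> 0) \<Phi>" if p: "0 < p" "p < N" for p
  proof -
    let ?A = "\<lambda>x. rank_one_update n (\<lambda>a. h x $$ (a, 0)) (\<lambda>b. f x $$ (p, b))"
    have root_p: "is_root 0 p" using p N by (intro root_upper) auto
    define s where "s x = ?A x * elem_mat n 0 p (- 1)" for x
    have "near \<Phi> ?A (\<lambda>_. elem_mat n 0 p 1)"
      using conj_elem_mat_near[OF hnull root_p] by (simp add: inv_h)
    then have s: "null \<Phi> s"
      by (simp add: near_def s_def[abs_def] inv_elem_mat[OF root_p Fs(2)])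
    have entry: "s x $$ (a, b) = (if a = b then 1 else 0) +
        unit_fun 0 a * (h x $$ (0, 0) * f x $$ (p, b) - unit_fun p b)" if "a < n" "b < n" for x a b
      using that p N upper[OF fH, of p 0 x]
      by (simp add: s_def elem_mat_def mult_rank_one_updates f0[of a x] algebra_simps)
    have "((\<lambda>x. s x $$ (0, N)) \<longlongrightarrow> 0) \<Phi>"
    proof (rule corner_of_null[OF N_def upper s])
      fix a b assume ab: "a < n" "b < n" "(a, b) \<noteq> (0, N)"
      show "((\<lambda>x. s x $$ (a, b)) \<longlongrightarrow> (if a = b then 1 else 0)) \<Phi>"
      proof (cases "a = 0")
        case True
        have "((\<lambda>x. h x $$ (N, N) * f x $$ (p, b) / (h x $$ (N, N) * f x $$ (0, 0))) \<longlongrightarrow>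
            (if p = b then 1 else 0) / 1) \<Phi>"
          using True ab p N N_def by (intro tendsto_divide col c0) auto
        then have "((\<lambda>x. h x $$ (0, 0) * f x $$ (p, b)) \<longlongrightarrow> (if p = b then 1 else 0) / 1) \<Phi>"
          by (rule Lim_transform_eventually) (use ne in eventually_elim, simp add: h00)
        then have "((\<lambda>x. (if a = b then 1 else 0) + unit_fun 0 a * (h x $$ (0, 0) * f x $$ (p, b) - unit_fun p b)) \<longlongrightarrow>
           (if a = b then 1 else 0) + unit_fun 0 a * ((if p = b then 1 else 0) / 1 - unit_fun p b)) \<Phi>"
          by (intro tendsto_intros)
        then show ?thesis using ab by (simp add: entry unit_fun_def[of p b] eq_commute[of p b])
      qed (use ab in \<open>simp add: entry unit_fun_def[of 0]\<close>)
    qed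
    then have "((\<lambda>x. h x $$ (0, 0) * f x $$ (p, N)) \<longlongrightarrow> 0) \<Phi>"
      using N p by (simp add: entry unit_fun_def)
    from tendsto_mult[OF this c0]
    have "((\<lambda>x. h x $$ (0, 0) * f x $$ (p, N) * (h x $$ (N, N) * f x $$ (0, 0))) \<longlongrightarrow> 0) \<Phi>" by simp
    moreover have "h x $$ (0, 0) * f x $$ (p, N) * (h x $$ (N, N) * f x $$ (0, 0)) =
        (f x $$ (0, 0) * h x $$ (0, 0)) * (h x $$ (N, N) * f x $$ (p, N))" for x
      by (simp add: ac_simps)
    ultimately show ?thesis by (simp add: diag)
  qed
  have "((\<lambda>x. h x $$ (N, N) * f x $$ (p, q)) \<longlongrightarrow> (if p = q then 1 else 0)) \<Phi>"
  proof (cases "q < N")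
    case True
    then show ?thesis using col pq by simp
  next
    case False
    then have q: "q = N" using pq N_def by simp
    moreover have "p = N \<or> p < N" using pq(1) N_def by linarith
    ultimately show ?thesis
      using last[of p] pq diag(1) by (cases "p = N") (auto simp: mult.commute)
  qed
  then show ?thesis by (simp add: h_def)
qed

text \<open>
  Only the corner entry is left.  Unlike unipotent elements, the torus moves it: for \<open>d = D(2)\<close>, the
  commutator of \<open>d\<close> and \<open>f\<close> is a null net.  As \<open>d\<close> doubles the corner coordinate, the corner entry of
  this commutator is that of the normalised \<open>f\<close> up to terms that tend to \<open>0\<close>.
\<close>

lemma entries_of_null_upper:
  assumes N_def: "n = Suc N"
    and upper: "\<And>g i j. g \<in> H \<Longrightarrow> i < n \<Longrightarrow> j < i \<Longrightarrow> g $$ (i, j) = 0" and n: "n = 2 ^ m"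
    and f: "null \<Phi> f" and ij: "i < n" "j < n"
  shows "((\<lambda>x. f x $$ (i, j)) \<longlongrightarrow> (if i = j then 1 else 0)) \<Phi>"
proof (rule entries_of_null_if_scalar_multiple[OF n f _ ij])
  note Fs = subfield_setD[OF F]
  define h where "h x = inv\<^bsub>G\<^esub> (f x)" for x
  have N: "0 < N" "N < n" "0 < n" "1 < N" using n3 N_def by auto
  have fH: "f x \<in> H" for x using f by (simp add: null_iff)
  have hH: "h x \<in> H" for x unfolding h_def by (rule H_inv(1)[OF fH])
  have hnull: "null \<Phi> h" unfolding h_def by (rule null_inv[OF f])
  have inv_h: "inv\<^bsub>G\<^esub> (h x) = f x" for x using inv_inv[of "f x"] fH by (simp add: h_def)
  \<comment> \<open>\<open>f\<close> and its inverse, normalised by reciprocal scalars, so that products of the two are unchanged\<close>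
  define X where "X x p q = h x $$ (N, N) * f x $$ (p, q)" for x p q
  define Y where "Y x p q = f x $$ (N, N) * h x $$ (p, q)" for x p q
  have X: "((\<lambda>x. X x p q) \<longlongrightarrow> (if p = q then 1 else 0)) \<Phi>" if "p < n" "q < n" "(p, q) \<noteq> (0, N)" for p q
    using null_entries_off_corner[OF N_def upper f that] by (simp add: X_def h_def)
  have Y: "((\<lambda>x. Y x p q) \<longlongrightarrow> (if p = q then 1 else 0)) \<Phi>" if "p < n" "q < n" "(p, q) \<noteq> (0, N)" for p q
    using null_entries_off_corner[OF N_def upper hnull that] by (simp add: Y_def inv_h)
  have XY_upper: "X x p q = 0" "Y x p q = 0" if "q < p" "p < n" for x p q
    using upper[OF fH, of p q x] upper[OF hH, of p q x] that by (simp_all add: X_def Y_def)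
  have diag: "f x $$ (N, N) * h x $$ (N, N) = 1" for x
    unfolding h_def using N by (auto intro!: diag_mult_inv_diag[OF upper fH])
  have XY: "X x p k * Y x k q = f x $$ (p, k) * h x $$ (k, q)" for x p k q
  proof -
    have "X x p k * Y x k q = (f x $$ (N, N) * h x $$ (N, N)) * (f x $$ (p, k) * h x $$ (k, q))"
      by (simp add: X_def Y_def ac_simps)
    then show ?thesis by (simp add: diag)
  qed
  let ?d = "torus_mat n 0 1 (2 :: complex)"
  define e where "e p = ?d $$ (p, p)" for p
  have two: "(2::complex) \<in> F" using nat_in_F[of 2] by simp
  have d: "?d \<in> H"
    using torus_mat_in_STplus[OF F two _ N(3), of 1] N ST_H by auto
  have e: "e p \<noteq> 0" if "p < n" for p using that by (simp add: e_def torus_mat_def)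
  have e0: "e 0 = 2" "e N = 1" using N by (simp_all add: e_def torus_mat_def)
  define s where "s x = ?d * f x * inv\<^bsub>G\<^esub> ?d * h x" for x
  have s: "null \<Phi> s"
  proof -
    have "tame \<Phi> (\<lambda>_. ?d)" using d by (intro tame_const) simp
    then have "null \<Phi> (\<lambda>x. ?d * f x * inv\<^bsub>G\<^esub> ?d)" using f unfolding tame_def by simp
    from null_mult[OF this hnull] show ?thesis by (simp add: s_def[abs_def])
  qed
  have entry: "s x $$ (p, q) = (\<Sum>k<n. e p / e k * (X x p k * Y x k q))" if pq: "p < n" "q < n" for x p q
  proof -
    let ?g = "?d * f x * inv\<^bsub>G\<^esub> ?d"
    have gH: "?g \<in> H" using d fH by (intro H_mult H_inv)
    have "?g * ?d = ?d * f x"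
      using m_assoc[of "?d * f x" "inv\<^bsub>G\<^esub> ?d" ?d] d fH H_mult[OF d fH]
      by (simp add: H_inv right_mult_one_mat[OF H_carrier_mat])
    then have "?g $$ (p, k) * e k = e p * f x $$ (p, k)" if "k < n" for k
      using torus_mult_entry(2)[OF H_carrier_mat[OF gH] pq(1) that, of 0 1 2]
        torus_mult_entry(1)[OF H_carrier_mat[OF fH] pq(1) that, of 0 1 2 x] by (simp add: e_def)
    then have "?g $$ (p, k) = e p / e k * f x $$ (p, k)" if "k < n" for k
      using e[OF that] that by (simp add: field_simps)
    then show ?thesis
      unfolding s_def mat_mult_entry[OF H_carrier_mat[OF gH] H_carrier_mat[OF hH] pq]
      by (intro sum.cong) (auto simp: XY)
  qed
  have "((\<lambda>x. s x $$ (0, N)) \<longlongrightarrow> 0) \<Phi>"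
  proof (rule corner_of_null[OF N_def upper s])
    fix p q assume pq: "p < n" "q < n" "(p, q) \<noteq> (0, N)"
    have lim_k: "((\<lambda>x. X x p k * Y x k q) \<longlongrightarrow> (if p = k then 1 else 0) * (if k = q then 1 else 0)) \<Phi>" if k: "k < n" for k
    proof (cases "(p, k) = (0, N) \<or> (k, q) = (0, N)")
      case True
      moreover have "q < N" if "q \<noteq> N" using pq that N_def by linarith
      ultimately have "(\<lambda>x. X x p k * Y x k q) = (\<lambda>_. 0)"
        using pq k XY_upper(2)[of q k] XY_upper(1)[of k p] by (auto simp: fun_eq_iff)
      moreover have "(if p = k then 1 else 0) * (if k = q then 1 else 0) = (0::complex)" using True pq by auto
      ultimately show ?thesis by (simp only: tendsto_const)
    qed (use pq k in \<open>intro tendsto_mult X Y; auto\<close>)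
    have "((\<lambda>x. s x $$ (p, q)) \<longlongrightarrow> (\<Sum>k<n. e p / e k * ((if p = k then 1 else 0) * (if k = q then 1 else 0)))) \<Phi>"
      unfolding entry[OF pq(1,2)] by (intro tendsto_sum tendsto_mult[OF tendsto_const] lim_k) auto
    also have "(\<Sum>k<n. e p / e k * ((if p = k then 1 else 0) * (if k = q then 1 else 0))) =
        (\<Sum>k<n. if k = p then if p = q then 1 else 0 else 0)"
      using e[OF pq(1)] by (intro sum.cong) auto
    also have "\<dots> = (if p = q then 1 else 0)" using pq by simp
    finally show "((\<lambda>x. s x $$ (p, q)) \<longlongrightarrow> (if p = q then 1 else 0)) \<Phi>" .
  qed
  moreover have "X x 0 N = s x $$ (0, N) - (\<Sum>k\<in>{0<..<N}. (e 0 / e k - 1) * (X x 0 k * Y x k N))" for x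
  proof -
    have "s x $$ (0, N) = (\<Sum>k<n. e 0 / e k * (X x 0 k * Y x k N)) - (\<Sum>k<n. X x 0 k * Y x k N)"
      using entry[of 0 N x] inv_row_dot_col(2)[OF fH, of 0 N x] N by (simp add: XY h_def)
    also have "\<dots> = (\<Sum>k<n. (e 0 / e k - 1) * (X x 0 k * Y x k N))"
      by (simp add: sum_subtractf[symmetric] algebra_simps)
    also have "{..<n} = insert 0 (insert N {0<..<N})" using N N_def by auto
    also have "(\<Sum>k\<in>insert 0 (insert N {0<..<N}). (e 0 / e k - 1) * (X x 0 k * Y x k N)) =
        X x 0 N + (\<Sum>k\<in>{0<..<N}. (e 0 / e k - 1) * (X x 0 k * Y x k N))"
      using N e0 diag[of x] by (simp add: Y_def)
    finally show ?thesis by simp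
  qed
  moreover have "((\<lambda>x. \<Sum>k\<in>{0<..<N}. (e 0 / e k - 1) * (X x 0 k * Y x k N)) \<longlongrightarrow>
      (\<Sum>k\<in>{0<..<N}. (e 0 / e k - 1) * ((if 0 = k then 1 else 0) * (if k = N then 1 else 0)))) \<Phi>"
    using N N_def by (intro tendsto_sum tendsto_mult tendsto_const X Y) auto
  ultimately have corner: "((\<lambda>x. X x 0 N) \<longlongrightarrow> 0) \<Phi>"
    using tendsto_diff by fastforce
  fix p q assume pq: "p < n" "q < n"
  show "((\<lambda>x. h x $$ (N, N) * f x $$ (p, q)) \<longlongrightarrow> (if p = q then 1 else 0)) \<Phi>"
    using X[OF pq] corner N by (cases "(p, q) = (0, N)") (auto simp: X_def)
qed

end


section \<open>Minimality in degrees that are powers of two\<close>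

lemma minimal_SL_if_power_of_2:
  fixes F :: "complex set"
  assumes F: "subfield_set F" and n: "n = 2 ^ m" "n \<ge> 4"
  shows "minimal_topological_group (SL n F) (SL_topology n F)"
  unfolding minimal_topological_group_iff_no_coarser
proof (intro conjI allI impI)
  show "topological_group (SL n F) (SL_topology n F)"
    using topological_group_subgroup[OF topological_group_SL_UNIV subgroup_SL[OF F, of n]]
    by (simp only: SL_eq[of n F, symmetric] SL_topology_eq[of n F, symmetric])
  fix S assume S: "topological_group (SL n F) S \<and> (\<forall>U. openin S U \<longrightarrow> openin (SL_topology n F) U)"
  interpret coarser_matrix_topology n F "carrier (SL n F)" S
  proof (rule coarser_matrix_topology.intro)
    show "topological_group ((SL n UNIV)\<lparr>carrier := carrier (SL n F)\<rparr>) S"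
      using S by (simp only: SL_eq[of n F, symmetric])
    show "openin (subtopology (SL_topology n UNIV) (carrier (SL n F))) U" if "openin S U" for U
      using S that by (simp only: SL_topology_eq[of n F, symmetric])
    show "subgroup (carrier (SL n F)) (SL n UNIV)" by (rule subgroup_SL[OF F])
  qed (use F n in \<open>auto simp: carrier_STplus\<close>)
  have "is_root i j" if "i < n" "j < n" "i \<noteq> j" for i j
    using elem_mat_in_SL[OF F _ that] that by (simp add: is_root_def)
  then have "S = subtopology (SL_topology n UNIV) (carrier (SL n F))"
    using n by (intro eq_subtopology_if_null_entries entries_of_null_all_roots)
  then show "S = SL_topology n F" by (simp only: SL_topology_eq[of n F, symmetric])
qed

lemma minimal_STplus_if_power_of_2:
  fixes F :: "complex set"
  assumes F: "subfield_set F" and n: "n = 2 ^ m" "n \<ge> 3"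
  shows "minimal_topological_group (STplus n F) (STplus_topology n F)"
  unfolding minimal_topological_group_iff_no_coarser
proof (intro conjI allI impI)
  show "topological_group (STplus n F) (STplus_topology n F)"
    using topological_group_subgroup[OF topological_group_SL_UNIV subgroup_STplus[OF F, of n]]
    by (simp only: STplus_eq[of n F, symmetric] STplus_topology_eq[of n F, symmetric])
  fix S assume S: "topological_group (STplus n F) S \<and> (\<forall>U. openin S U \<longrightarrow> openin (STplus_topology n F) U)"
  interpret coarser_matrix_topology n F "carrier (STplus n F)" S
  proof (rule coarser_matrix_topology.intro)
    show "topological_group ((SL n UNIV)\<lparr>carrier := carrier (STplus n F)\<rparr>) S"
      using S by (simp only: STplus_eq[of n F, symmetric])
    show "openin (subtopology (SL_topology n UNIV) (carrier (STplus n F))) U" if "openin S U" for U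
      using S that by (simp only: STplus_topology_eq[of n F, symmetric])
    show "subgroup (carrier (STplus n F)) (SL n UNIV)" by (rule subgroup_STplus[OF F])
  qed (use F n in \<open>auto simp: carrier_STplus\<close>)
  have N: "n = Suc (n - 1)" using n by simp
  have "g $$ (i, j) = 0" if "g \<in> carrier (STplus n F)" "i < n" "j < i" for g i j
    using that by (simp add: carrier_STplus)
  then have "S = subtopology (SL_topology n UNIV) (carrier (STplus n F))"
    using n by (intro eq_subtopology_if_null_entries entries_of_null_upper[OF N])
  then show "S = STplus_topology n F" by (simp only: STplus_topology_eq[of n F, symmetric])
qed


section \<open>Failure of minimality in degrees with an odd divisor\<close>

text \<open>
  The matrix \<open>diag(a, ..., a, a\<^sup>1\<^sup>-\<^sup>n)\<close> of determinant \<open>1\<close>, which tends to a scalar matrix if \<open>a\<close> tends to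
  an \<open>n\<close>-th root of unity.
\<close>

definition almost_scalar_mat :: "nat \<Rightarrow> 'a::field \<Rightarrow> 'a mat" where
  "almost_scalar_mat n a = mat n n (\<lambda>(i, j). if i \<noteq> j then 0 else if i = n - 1 then inverse a ^ (n - 1) else a)"

lemma almost_scalar_mat_in_STplus:
  assumes F: "subfield_set F" and a: "a \<in> F" "a \<noteq> 0" and n: "n > 0"
  shows "almost_scalar_mat n a \<in> carrier (STplus n F)"
proof -
  have c: "almost_scalar_mat n a \<in> carrier_mat n n" by (simp add: almost_scalar_mat_def)
  have "upper_triangular (almost_scalar_mat n a)" by (auto simp: almost_scalar_mat_def)
  then have "Determinant.det (almost_scalar_mat n a) = (\<Prod>p<n. almost_scalar_mat n a $$ (p, p))"
    using det_upper_triangular[OF _ c] c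
    by (simp add: diag_mat_def almost_scalar_mat_def prod.list_conv_set_nth atLeast0LessThan)
  also have "{..<n} = insert (n - 1) {..<n - 1}" using n by auto
  also have "(\<Prod>p\<in>insert (n - 1) {..<n - 1}. almost_scalar_mat n a $$ (p, p)) = inverse a ^ (n - 1) * (\<Prod>p<n - 1. a)"
    using n by (subst prod.insert) (auto simp: almost_scalar_mat_def intro!: prod.cong)
  also have "\<dots> = 1" using a by (simp add: power_mult_distrib[symmetric])
  finally show ?thesis
    using a subfield_setD[OF F] subfield_set_power[OF F]
    by (auto simp: carrier_STplus carrier_SL almost_scalar_mat_def)
qed

text \<open>
  The scalar matrices \<open>z I\<close> with \<open>z\<^sup>r = 1\<close> form a finite central subgroup of \<open>SL(n, \<complex>)\<close>.  Over \<open>F\<close> it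
  becomes trivial, but each \<open>z I\<close> is a limit of almost scalar matrices over \<open>F\<close>.
\<close>

lemma not_minimal_if_missing_roots_of_unity:
  fixes F :: "complex set"
  assumes F: "subfield_set F" and dense: "closure F = UNIV"
    and r: "r > 1" "r dvd n" and n: "n > 0" and missing: "\<And>z. z \<in> F \<Longrightarrow> z ^ r = 1 \<Longrightarrow> z = 1"
    and H: "subgroup H (SL n UNIV)" "carrier (STplus n F) \<subseteq> H" "H \<subseteq> carrier (SL n F)"
  shows "\<not> minimal_topological_group ((SL n UNIV)\<lparr>carrier := H\<rparr>) (subtopology (SL_topology n UNIV) H)"
proof -
  let ?L = "SL n (UNIV :: complex set)" and ?T = "SL_topology n (UNIV :: complex set)"
  define Z where "Z = (\<lambda>z. z \<cdot>\<^sub>m 1\<^sub>m n :: complex mat) ` {z. z ^ r = 1}"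
  have zn: "z ^ n = 1" if "z ^ r = 1" for z :: complex
    using r(2) that by (metis dvd_def power_mult power_one)
  have ZL: "z \<cdot>\<^sub>m 1\<^sub>m n \<in> carrier ?L" if "z ^ r = 1" for z
    using zn[OF that] by (simp add: carrier_SL)
  have mult: "z \<cdot>\<^sub>m 1\<^sub>m n * A = z \<cdot>\<^sub>m A" "A * (z \<cdot>\<^sub>m 1\<^sub>m n) = z \<cdot>\<^sub>m A"
    if "A \<in> carrier_mat n n" for A :: "complex mat" and z
    using that by (simp_all add: mult_smult_assoc_mat[of _ n n _ n] mult_smult_distrib[of _ n n _ n])
  have one: "(1 :: complex) \<cdot>\<^sub>m 1\<^sub>m n = 1\<^sub>m n" by (rule eq_matI) simp_all
  have "subgroup Z ?L"
  proof (rule group.subgroupI[OF group_SL[OF subfield_set_UNIV]])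
    show "Z \<subseteq> carrier ?L" using ZL by (auto simp: Z_def)
    show "Z \<noteq> {}" unfolding Z_def by (auto intro!: exI[of _ 1])
  next
    fix A assume "A \<in> Z"
    then obtain z where z: "A = z \<cdot>\<^sub>m 1\<^sub>m n" "z ^ r = 1" by (auto simp: Z_def)
    then have z0: "z \<noteq> 0" using r by (auto simp: power_0_left)
    have iz: "inverse z ^ r = 1" using z by (simp add: power_inverse)
    have "inverse z \<cdot>\<^sub>m 1\<^sub>m n * A = (1\<^sub>m n :: complex mat)"
      unfolding z(1) by (rule eq_matI) (use z0 in \<open>simp_all add: mult\<close>)
    then have "inv\<^bsub>?L\<^esub> A = inverse z \<cdot>\<^sub>m 1\<^sub>m n"
      using ZL[OF z(2)] ZL[OF iz]
      by (intro group.inv_equality[OF group_SL[OF subfield_set_UNIV]]) (simp_all add: z(1))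
    then show "inv\<^bsub>?L\<^esub> A \<in> Z" using iz by (auto simp: Z_def)
  next
    fix A B assume "A \<in> Z" "B \<in> Z"
    then obtain z w where zw: "A = z \<cdot>\<^sub>m 1\<^sub>m n" "z ^ r = 1" "B = w \<cdot>\<^sub>m 1\<^sub>m n" "w ^ r = 1" by (auto simp: Z_def)
    have "A * B = (z * w) \<cdot>\<^sub>m 1\<^sub>m n"
      unfolding zw by (rule eq_matI) (simp_all add: mult)
    moreover have "(z * w) ^ r = 1" using zw by (simp add: power_mult_distrib)
    ultimately show "A \<otimes>\<^bsub>?L\<^esub> B \<in> Z" by (auto simp: Z_def)
  qed
  moreover have "finite Z" unfolding Z_def using r by (intro finite_imageI finite_nth_roots) auto
  moreover have "z \<otimes>\<^bsub>?L\<^esub> x = x \<otimes>\<^bsub>?L\<^esub> z" if "z \<in> Z" "x \<in> carrier ?L" for z x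
    using that by (auto simp: Z_def mult carrier_SL)
  moreover have "H \<inter> Z = {\<one>\<^bsub>?L\<^esub>}"
  proof
    show "{\<one>\<^bsub>?L\<^esub>} \<subseteq> H \<inter> Z"
      using subgroup.one_closed[OF H(1)] by (auto simp: Z_def one intro!: image_eqI[of _ _ 1])
    show "H \<inter> Z \<subseteq> {\<one>\<^bsub>?L\<^esub>}"
    proof
      fix A assume A: "A \<in> H \<inter> Z"
      then obtain z where z: "A = z \<cdot>\<^sub>m 1\<^sub>m n" "z ^ r = 1" by (auto simp: Z_def)
      have "A $$ (0, 0) \<in> F" using A H(3) n by (auto simp: carrier_SL)
      then have "z = 1" using z n missing by simp
      then show "A \<in> {\<one>\<^bsub>?L\<^esub>}" using z one by simp
    qed
  qed
  moreover obtain z :: complex where z: "z ^ r = 1" "z \<noteq> 1"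
  proof -
    have "card {z::complex. z ^ r = 1} = r" using r by (intro card_nth_roots) auto
    then have "\<not> {z::complex. z ^ r = 1} \<subseteq> {1}" using r card_mono[of "{1}" "{z::complex. z ^ r = 1}"] by auto
    then show thesis using that by auto
  qed
  have "z \<cdot>\<^sub>m 1\<^sub>m n \<in> ?T closure_of H"
    unfolding in_closure_of topspace_SL_topology
  proof (intro conjI allI impI ZL z(1), elim conjE)
    fix U assume U: "z \<cdot>\<^sub>m 1\<^sub>m n \<in> U" "openin ?T U"
    have z0: "z \<noteq> 0" using z r by (auto simp: power_0_left)
    obtain a where a: "\<And>k. a k \<in> F" "a \<longlonglongrightarrow> z"
      using dense closure_sequential[of z F] by auto
    have a0: "\<forall>\<^sub>F k in sequentially. a k \<noteq> 0"
      by (rule tendsto_imp_eventually_ne[OF a(2) z0])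
    then have inH: "\<forall>\<^sub>F k in sequentially. almost_scalar_mat n (a k) \<in> H"
      by eventually_elim (use almost_scalar_mat_in_STplus[OF F a(1) _ n] H(2) in auto)
    have "limitin ?T (\<lambda>k. almost_scalar_mat n (a k)) (z \<cdot>\<^sub>m 1\<^sub>m n) sequentially"
      unfolding limitin_SL_topology
    proof (intro conjI allI impI ZL z(1))
      show "\<forall>\<^sub>F k in sequentially. almost_scalar_mat n (a k) \<in> carrier ?L"
        using inH by eventually_elim (use H(3) carrier_SL_UNIV in blast)
      have "z * z ^ (n - 1) = 1" using zn[OF z(1)] n by (simp add: power_eq_if)
      then have "inverse z ^ (n - 1) = z" using z0 by (simp add: field_simps)
      then have "((\<lambda>k. inverse (a k) ^ (n - 1)) \<longlonglongrightarrow> z)"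
        using tendsto_power[OF tendsto_inverse[OF a(2) z0], of "n - 1"] by simp
      then show "((\<lambda>k. almost_scalar_mat n (a k) $$ (i, j)) \<longlonglongrightarrow> (z \<cdot>\<^sub>m 1\<^sub>m n) $$ (i, j))" if "i < n" "j < n" for i j
        using that a(2) by (cases "i = j"; cases "i = n - 1") (simp_all add: almost_scalar_mat_def)
    qed
    from eventually_conj[OF limitinD[OF this U(2,1)] inH]
    show "\<exists>y. y \<in> H \<and> y \<in> U" using eventually_happens by fastforce
  qed
  moreover have "z \<cdot>\<^sub>m 1\<^sub>m n \<noteq> \<one>\<^bsub>?L\<^esub>"
  proof
    assume "z \<cdot>\<^sub>m 1\<^sub>m n = \<one>\<^bsub>?L\<^esub>"
    then have "(z \<cdot>\<^sub>m 1\<^sub>m n) $$ (0, 0) = (1\<^sub>m n :: complex mat) $$ (0, 0)" by simp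
    then show False using n z by simp
  qed
  ultimately show ?thesis
    using z not_minimal_if_closure_meets_finite_central_subgroup[OF topological_group_SL_UNIV H(1), of Z "z \<cdot>\<^sub>m 1\<^sub>m n"]
    by (auto simp: Z_def)
qed


section \<open>Gaussian rationals and Mersenne primes\<close>

lemma subfield_set_gaussian_rationals: "subfield_set gaussian_rationals"
  by (auto simp: subfield_set_def gaussian_rationals_def)

lemma closure_gaussian_rationals: "closure gaussian_rationals = UNIV"
proof -
  have "z \<in> closure gaussian_rationals" for z
    unfolding closure_approachable
  proof (intro allI impI)
    fix e :: real assume e: "e > 0"
    obtain x y where xy: "x \<in> \<rat>" "Re z < x" "x < Re z + e / 2" "y \<in> \<rat>" "Im z < y" "y < Im z + e / 2"
      using Rats_dense_in_real[of "Re z" "Re z + e / 2"] Rats_dense_in_real[of "Im z" "Im z + e / 2"] e by auto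
    have "dist (Complex x y) z \<le> \<bar>x - Re z\<bar> + \<bar>y - Im z\<bar>"
      unfolding dist_norm using cmod_le[of "Complex x y - z"] by simp
    also have "\<dots> < e" using xy by simp
    finally show "\<exists>w\<in>gaussian_rationals. dist w z < e"
      using xy by (intro bexI[of _ "Complex x y"]) (auto simp: gaussian_rationals_def)
  qed
  then show ?thesis by auto
qed

text \<open>
  With \<open>2 Re z = p / q\<close> in lowest terms, the recurrence
  \<open>z\<^sup>m\<^sup>+\<^sup>2 + z\<^sup>-\<^sup>m\<^sup>-\<^sup>2 = (2 Re z) (z\<^sup>m\<^sup>+\<^sup>1 + z\<^sup>-\<^sup>m\<^sup>-\<^sup>1) - (z\<^sup>m + z\<^sup>-\<^sup>m)\<close> shows that \<open>q\<^sup>m (z\<^sup>m + z\<^sup>-\<^sup>m)\<close> is an integer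
  congruent to \<open>p\<^sup>m\<close> modulo \<open>q\<close>.  For a root of unity, some \<open>m\<close> makes it \<open>2 q\<^sup>m\<close>, and \<open>q\<close> divides \<open>p\<^sup>m\<close>.
\<close>

lemma two_Re_root_of_unity_integer:
  fixes z :: complex
  assumes r: "r > 0" "z ^ r = 1" and rat: "Re z \<in> \<rat>"
  shows "2 * Re z \<in> \<int>"
proof -
  have "norm z ^ r = 1" using r(2) norm_power[of z r] by simp
  then have nz: "norm z = 1" using r(1) power_eq_1_iff[of "norm z" r] by simp
  have zc: "z * cnj z = 1" using nz using complex_norm_square[of z] by simp
  have "2 * Re z \<in> \<rat>" using rat by simp
  then obtain p q :: int where q: "q > 0" "coprime p q" "2 * Re z = of_int p / of_int q"
    by (rule Rats_cases') 
  define s where "s m = z ^ m + cnj z ^ m" for m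
  have t: "z + cnj z = of_int p / of_int q"
    unfolding complex_add_cnj q(3) by simp
  have rec: "s (Suc (Suc m)) = (z + cnj z) * s (Suc m) - s m" for m
  proof -
    have "(z + cnj z) * s (Suc m) = s (Suc (Suc m)) + (z * cnj z) * s m"
      by (simp add: s_def algebra_simps)
    then show ?thesis using zc by simp
  qed
  have "(\<exists>P. of_int q ^ m * s m = of_int P) \<and>
      (\<exists>P. of_int q ^ Suc m * s (Suc m) = of_int P \<and> q dvd P - p ^ Suc m)" for m
  proof (induction m)
    case 0
    have "of_int q * s 1 = of_int p" using t q(1) by (simp add: s_def)
    then show ?case by (auto simp: s_def intro: exI[of _ 2])
  next
    case (Suc m)
    then obtain P P' where P: "of_int q ^ m * s m = of_int P" "of_int q ^ Suc m * s (Suc m) = of_int P'" "q dvd P' - p ^ Suc m"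
      by blast
    have "of_int q ^ Suc (Suc m) * s (Suc (Suc m)) =
        (of_int q * (z + cnj z)) * (of_int q ^ Suc m * s (Suc m)) - of_int q ^ 2 * (of_int q ^ m * s m)"
      unfolding rec by (simp add: algebra_simps power2_eq_square)
    also have "of_int q * (z + cnj z) = of_int p" unfolding t using q(1) by simp
    finally have "of_int q ^ Suc (Suc m) * s (Suc (Suc m)) = of_int (p * P' - q ^ 2 * P)"
      unfolding P by simp
    moreover have "q dvd (p * P' - q ^ 2 * P) - p ^ Suc (Suc m)"
    proof -
      have "(p * P' - q ^ 2 * P) - p ^ Suc (Suc m) = p * (P' - p ^ Suc m) - q * (q * P)"
        by (simp add: algebra_simps power2_eq_square)
      then show ?thesis using P(3) by simp
    qed
    ultimately show ?case using P(2) by blast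
  qed
  from this[of "r - 1"] obtain P where P: "of_int q ^ r * s r = of_int P" "q dvd P - p ^ r"
    using r(1) by auto
  have "s r = 2" using r(2) by (simp add: s_def flip: complex_cnj_power)
  then have "of_int (q ^ r * 2) = (of_int P :: complex)" using P(1) by simp
  then have "P = q ^ r * 2" unfolding of_int_eq_iff by simp
  then have "q dvd P" using r(1) by (simp add: dvd_power)
  then have "q dvd p ^ r" using P(2) by (simp add: dvd_diff_right_iff)
  moreover have "coprime q (p ^ r)" using q(2) by (simp add: coprime_commute)
  ultimately have "is_unit q" using coprime_common_divisor[of q "p ^ r" q] by simp
  then have "q = 1" using q(1) by simp
  then show ?thesis using q(3) by simp
qed

lemma rational_square_neq_3:
  fixes y :: real
  assumes "y \<in> \<rat>"
  shows "y\<^sup>2 \<noteq> 3"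
proof
  assume y: "y\<^sup>2 = 3"
  obtain a b :: int where ab: "b > 0" "coprime a b" "y = of_int a / of_int b"
    using assms by (rule Rats_cases')
  have "of_int (a\<^sup>2) = (of_int (3 * b\<^sup>2) :: real)"
    using y ab(1) unfolding ab(3) by (simp add: power_divide field_simps)
  then have sq: "a\<^sup>2 = 3 * b\<^sup>2" unfolding of_int_eq_iff .
  have p3: "prime (3::int)" by simp
  have "3 dvd a" using sq by (intro prime_dvd_power[OF p3, of a 2]) simp
  then obtain c where c: "a = 3 * c" by blast
  then have "b\<^sup>2 = 3 * c\<^sup>2" using sq by (simp add: power2_eq_square)
  then have "3 dvd b" by (intro prime_dvd_power[OF p3, of b 2]) simp
  then show False using ab(2) \<open>3 dvd a\<close> coprime_common_divisor[of a b 3] by simp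
qed

text \<open>
  The integer \<open>2 Re z\<close> has absolute value at most \<open>2\<close>.  The values \<open>1\<close> and \<open>-1\<close> would make \<open>2 Im z\<close> a
  rational square root of \<open>3\<close>; the others belong to fourth roots of unity, of which only \<open>1\<close> has odd
  order.
\<close>

lemma gaussian_rational_root_of_unity_odd:
  assumes z: "z \<in> gaussian_rationals" "z ^ r = 1" and r: "odd r"
  shows "z = 1"
proof -
  have r0: "r > 0" using r by (auto intro: Nat.gr0I)
  obtain t :: int where t: "2 * Re z = of_int t"
    using two_Re_root_of_unity_integer[OF r0 z(2)] z(1) by (auto simp: gaussian_rationals_def elim: Ints_cases)
  have "norm z ^ r = 1" using z(2) norm_power[of z r] by simp
  then have nz: "norm z = 1" using r0 power_eq_1_iff[of "norm z" r] by simp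
  then have sq: "(Re z)\<^sup>2 + (Im z)\<^sup>2 = 1" by (metis cmod_power2 one_power2)
  have "\<bar>Re z\<bar> \<le> 1" using abs_Re_le_cmod[of z] nz by simp
  then have "\<bar>of_int t :: real\<bar> \<le> 2" unfolding t[symmetric] by simp
  then have "t \<in> {-2, -1, 0, 1, 2}" by auto
  moreover have "t \<noteq> 1" "t \<noteq> - 1"
  proof -
    have "2 * Im z \<in> \<rat>" using z(1) by (simp add: gaussian_rationals_def)
    then have "(2 * Im z)\<^sup>2 \<noteq> 3" by (rule rational_square_neq_3)
    moreover have "(2 * Im z)\<^sup>2 = 4 - (of_int t)\<^sup>2"
      using sq unfolding t[symmetric] by (simp add: power_mult_distrib)
    ultimately show "t \<noteq> 1" "t \<noteq> - 1" by auto
  qed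
  moreover have "t \<noteq> 0"
  proof
    assume "t = 0"
    then have "Re z = 0" using t by simp
    then have "z\<^sup>2 = - 1" using sq by (simp add: complex_eq_iff power2_eq_square)
    have "1 = (z ^ r)\<^sup>2" using z(2) by simp
    also have "\<dots> = (z\<^sup>2) ^ r" by (simp add: power_mult[symmetric] mult.commute)
    also have "\<dots> = - 1" using \<open>z\<^sup>2 = - 1\<close> r by simp
    finally show False by simp
  qed
  moreover have "t \<noteq> - 2"
  proof
    assume "t = - 2"
    then have "Re z = - 1" using t by simp
    then have "z = - 1" using sq by (simp add: complex_eq_iff)
    then show False using z(2) r by simp
  qed
  ultimately have "Re z = 1" using t by auto
  then show ?thesis using sq by (simp add: complex_eq_iff)
qed

lemma power_of_2_or_odd_divisor:
  fixes n :: nat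
  assumes "n > 0"
  shows "(\<exists>k. n = 2 ^ k) \<or> (\<exists>r>1. odd r \<and> r dvd n)"
  using assms
proof (induction n rule: less_induct)
  case (less n)
  show ?case
  proof (cases "odd n")
    case True
    show ?thesis
    proof (cases "n = 1")
      case True
      then have "n = 2 ^ 0" by simp
      then show ?thesis by (intro disjI1 exI)
    next
      case False
      then have "n > 1" using less.prems by simp
      then have "\<exists>r>1. odd r \<and> r dvd n" using \<open>odd n\<close> by (intro exI[of _ n] conjI) simp_all
      then show ?thesis by (rule disjI2)
    qed
  next
    case False
    then obtain m where m: "n = 2 * m" by auto
    then have "m < n" "m > 0" using less.prems by auto
    from less.IH[OF this] show ?thesis
    proof
      assume "\<exists>k. m = 2 ^ k"
      then obtain k where "m = 2 ^ k" ..
      then have "n = 2 ^ Suc k" using m by simp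
      then show ?thesis by (intro disjI1 exI)
    qed (use m in \<open>auto intro!: disjI2\<close>)
  qed
qed

text \<open>
  The exponent is prime because \<open>2\<^sup>d - 1\<close> divides \<open>2\<^sup>k - 1\<close> for every divisor \<open>d\<close> of \<open>k\<close>.
\<close>

lemma mersenne_prime_iff_power_of_2:
  assumes p: "prime p"
  shows "mersenne_prime p \<longleftrightarrow> (\<exists>k. p + 1 = 2 ^ k)"
proof
  assume "mersenne_prime p"
  then obtain q where "p = 2 ^ q - 1" unfolding mersenne_prime_def by blast
  then have "p + 1 = 2 ^ q" by simp
  then show "\<exists>k. p + 1 = 2 ^ k" ..
next
  assume "\<exists>k. p + 1 = 2 ^ k"
  then obtain k where k: "p + 1 = 2 ^ k" ..
  have p2: "p \<ge> 2" using p by (rule prime_ge_2_nat)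
  have k1: "k > 1"
  proof (rule ccontr)
    assume "\<not> k > 1"
    then have "(2::nat) ^ k \<le> 2 ^ 1" by (intro power_increasing) auto
    then show False using k p2 by simp
  qed
  have "d = 1 \<or> d = k" if "d dvd k" for d
  proof -
    obtain c where c: "k = d * c" using \<open>d dvd k\<close> by (rule dvdE)
    have "(2::int) ^ d - 1 dvd (2 ^ d) ^ c - 1" by (simp add: power_diff_1_eq)
    moreover have "(2::int) ^ k = int p + 1" using k by (metis of_nat_1 of_nat_add of_nat_numeral of_nat_power)
    ultimately have "(2::int) ^ d - 1 dvd int p" by (simp add: c power_mult)
    moreover have "(2::int) ^ d - 1 = int (2 ^ d - 1)" by (simp add: of_nat_diff)
    ultimately have "2 ^ d - 1 dvd p" by (metis of_nat_dvd_iff)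
    then have "2 ^ d - 1 = (1::nat) \<or> 2 ^ d - 1 = p" using p by (auto simp: prime_nat_iff)
    then have "2 ^ d = (2::nat) ^ 1 \<or> 2 ^ d = (2::nat) ^ k" using k p2 by auto
    then show ?thesis using power_inject_exp[of "2::nat" d 1] power_inject_exp[of "2::nat" d k] by auto
  qed
  then have "prime k" using k1 by (auto simp: prime_nat_iff)
  then show "mersenne_prime p"
    unfolding mersenne_prime_def using p k by (metis add_diff_cancel_right')
qed

theorem theorem3p1:
  fixes p :: nat
  assumes "prime p"
  shows "(mersenne_prime p \<longleftrightarrow>
            minimal_topological_group (SL (p + 1) gaussian_rationals)
              (SL_topology (p + 1) gaussian_rationals)) \<and>
         (minimal_topological_group (SL (p + 1) gaussian_rationals)
              (SL_topology (p + 1) gaussian_rationals) \<longleftrightarrow>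
            minimal_topological_group (STplus (p + 1) gaussian_rationals)
              (STplus_topology (p + 1) gaussian_rationals))"
proof (cases "\<exists>k. p + 1 = 2 ^ k")
  case True
  then obtain k where k: "p + 1 = 2 ^ k" ..
  have p2: "p \<ge> 2" using assms by (rule prime_ge_2_nat)
  have "\<not> k < 2"
  proof
    assume "k < 2"
    then have "(2::nat) ^ k \<le> 2 ^ 1" by (intro power_increasing) auto
    then show False using k p2 by simp
  qed
  then have "(2::nat) ^ 2 \<le> 2 ^ k" by (intro power_increasing) auto
  then have "p + 1 \<ge> 4" using k by simp
  then show ?thesis
    using minimal_SL_if_power_of_2[OF subfield_set_gaussian_rationals k]
      minimal_STplus_if_power_of_2[OF subfield_set_gaussian_rationals k]
      mersenne_prime_iff_power_of_2[OF assms] True by simp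
next
  case False
  then obtain r where r: "r > 1" "odd r" "r dvd p + 1"
    using power_of_2_or_odd_divisor[of "p + 1"] by auto
  note F = subfield_set_gaussian_rationals
  have pos: "0 < p + 1" by simp
  have missing: "z = 1" if "z \<in> gaussian_rationals" "z ^ r = 1" for z
    using gaussian_rational_root_of_unity_odd[OF that r(2)] .
  have sub: "carrier (STplus (p + 1) gaussian_rationals) \<subseteq> carrier (SL (p + 1) gaussian_rationals)"
    by (auto simp: carrier_STplus)
  have SL: "\<not> minimal_topological_group (SL (p + 1) gaussian_rationals) (SL_topology (p + 1) gaussian_rationals)"
  proof -
    have "\<not> minimal_topological_group ((SL (p + 1) UNIV)\<lparr>carrier := carrier (SL (p + 1) gaussian_rationals)\<rparr>)
        (subtopology (SL_topology (p + 1) UNIV) (carrier (SL (p + 1) gaussian_rationals)))"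
      by (rule not_minimal_if_missing_roots_of_unity[OF F closure_gaussian_rationals r(1,3) pos _ subgroup_SL[OF F] sub subset_refl])
        (rule missing)
    then show ?thesis
      by (simp only: SL_eq[of "p + 1" gaussian_rationals, symmetric]
          SL_topology_eq[of "p + 1" gaussian_rationals, symmetric] not_False_eq_True)
  qed
  have STplus: "\<not> minimal_topological_group (STplus (p + 1) gaussian_rationals) (STplus_topology (p + 1) gaussian_rationals)"
  proof -
    have "\<not> minimal_topological_group ((SL (p + 1) UNIV)\<lparr>carrier := carrier (STplus (p + 1) gaussian_rationals)\<rparr>)
        (subtopology (SL_topology (p + 1) UNIV) (carrier (STplus (p + 1) gaussian_rationals)))"
      by (rule not_minimal_if_missing_roots_of_unity[OF F closure_gaussian_rationals r(1,3) pos _ subgroup_STplus[OF F] subset_refl sub])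
        (rule missing)
    then show ?thesis
      by (simp only: STplus_eq[of "p + 1" gaussian_rationals, symmetric]
          STplus_topology_eq[of "p + 1" gaussian_rationals, symmetric] not_False_eq_True)
  qed
  show ?thesis
    using SL STplus mersenne_prime_iff_power_of_2[OF assms] False by simp
qed

end
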